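(* Let $\lambda\in(0,1)$ and $N\in\mathbb N$. There exists $\varepsilon_0=\varepsilon_0(\lambda,N)>0$ such that for any $$f_0=h_0+\sum_{k=1}^N a_k h_k,\qquad a_k\in\mathbb C,\qquad \max_k|a_k|<\varepsilon_0,$$ there exists a domain $U_\lambda\subset\mathbb R^2$, which is a real-analytic perturbation of a disk, with $$\mathcal L_{U_\lambda}f_0=\lambda f_0 .$$
   Context: Let $\varphi(t)=2^{1/4}e^{-\pi t^2}$ on $\mathbb R$. For $f\in L^2(\mathbb R)$ put $V_\varphi f(x,\omega)=\int_{\mathbb R}f(t)\overline{\varphi(t-x)}e^{-2\pi i t\omega}\,dt$. For a measurable set $\Omega\subset\mathbb R^2$ of finite measure, the localization operator $\mathcal L_\Omega$ is the bounded operator on $L^2(\mathbb R)$ defined by $\langle\mathcal L_\Omega f,g\rangle=\int_\Omega V_\varphi f\,\overline{V_\varphi g}\,dx\,d\omega$ for $f,g\in L^2(\mathbb R)$. $\{h_k\}_{k\ge0}$ denotes the orthonormal basis of $L^2(\mathbb R)$ of Hermite functions, $h_k(t)=c_k(-1)^k e^{\pi t^2}\frac{d^k}{dt^k}e^{-2\pi t^2}$ with $c_k>0$ chosen so that $\|h_k\|_{L^2}=1$; in particular $h_0=\varphi$. "Real-analytic perturbation of a disk": identifying $\mathbb R^2$ with $\mathbb C$, the domain has the form $\{re^{2\pi i\theta}:0\le r<r_\lambda+\phi(\theta)\}$, where $r_\lambda>0$ is determined by $1-e^{-\pi r_\lambda^2}=\lambda$ and $\phi$ is a real-valued, $1$-periodic,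 real-analytic function with $\sup|\phi|<r_\lambda/2$. *)

theory Defs
  imports "HOL-Analysis.Analysis"
begin

text \<open>Elements of \<open>L\<^sup>2(\<real>)\<close> are represented by Borel functions; equality in \<open>L\<^sup>2(\<real>)\<close> is equality
  almost everywhere.\<close>

definition L2 :: "(real \<Rightarrow> complex) set" where
  "L2 = {f. f \<in> borel_measurable lborel \<and> integrable lborel (\<lambda>t. (cmod (f t))\<^sup>2)}"

definition inner_L2 :: "(real \<Rightarrow> complex) \<Rightarrow> (real \<Rightarrow> complex) \<Rightarrow> complex" where
  "inner_L2 f g = (LINT t|lborel. f t * cnj (g t))"

definition gauss_window :: "real \<Rightarrow> complex" where
  "gauss_window t = of_real (2 powr (1/4) * exp (- pi * t\<^sup>2))"

definition STFT :: "(real \<Rightarrow> complex) \<Rightarrow> real \<Rightarrow> real \<Rightarrow> complex" where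
  "STFT f x \<omega> = (LINT t|lborel. f t * cnj (gauss_window (t - x)) * exp (- 2 * pi * \<i> * t * \<omega>))"

text \<open>\<open>h\<close> represents the value at \<open>f\<close> of the localization operator of \<open>\<Omega>\<close>.\<close>

definition is_loc_op_value :: "(real \<times> real) set \<Rightarrow> (real \<Rightarrow> complex) \<Rightarrow> (real \<Rightarrow> complex) \<Rightarrow> bool" where
  "is_loc_op_value \<Omega> f h \<longleftrightarrow>
     h \<in> L2 \<and>
     (\<forall>g\<in>L2. inner_L2 h g =
        set_lebesgue_integral lborel \<Omega> (\<lambda>(x, \<omega>). STFT f x \<omega> * cnj (STFT g x \<omega>)))"

text \<open>For \<open>f\<close> in \<open>L\<^sup>2\<close> and \<open>\<Omega>\<close> measurable of finite measure a value exists (the sesquilinear form is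
  bounded), and it is unique almost everywhere by \<open>is_loc_op_value_unique\<close> below.\<close>

definition loc_op :: "(real \<times> real) set \<Rightarrow> (real \<Rightarrow> complex) \<Rightarrow> (real \<Rightarrow> complex)" where
  "loc_op \<Omega> f = (SOME h. is_loc_op_value \<Omega> f h)"

definition hermite_raw :: "nat \<Rightarrow> real \<Rightarrow> real" where
  "hermite_raw k t = (-1) ^ k * exp (pi * t\<^sup>2) * (deriv ^^ k) (\<lambda>s. exp (- 2 * pi * s\<^sup>2)) t"

definition hermite_fun :: "nat \<Rightarrow> real \<Rightarrow> complex" where
  "hermite_fun k t = of_real (hermite_raw k t / sqrt (LINT s|lborel. (hermite_raw k s)\<^sup>2))"

definition real_analytic :: "(real \<Rightarrow> real) \<Rightarrow> bool" where
  "real_analytic \<phi> \<longleftrightarrow>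
     (\<forall>x0. \<exists>c. \<exists>\<delta>>0. \<forall>x. \<bar>x - x0\<bar> < \<delta> \<longrightarrow> (\<lambda>n. c n * (x - x0) ^ n) sums \<phi> x)"

text \<open>The supremum is a genuine one: a periodic real-analytic function is bounded.\<close>

definition analytic_perturbed_disk :: "real \<Rightarrow> (real \<times> real) set \<Rightarrow> bool" where
  "analytic_perturbed_disk lam U \<longleftrightarrow>
     (\<exists>r \<phi>. r > 0 \<and> 1 - exp (- pi * r\<^sup>2) = lam \<and>
        real_analytic \<phi> \<and> (\<forall>\<theta>. \<phi> (\<theta> + 1) = \<phi> \<theta>) \<and> (SUP \<theta>. \<bar>\<phi> \<theta>\<bar>) < r / 2 \<and>
        U = {(\<rho> * cos (2 * pi * \<theta>), \<rho> * sin (2 * pi * \<theta>)) | \<rho> \<theta>. 0 \<le> \<rho> \<and> \<rho> < r + \<phi> \<theta>})"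

lemma L2_mult_cnj_integrable:
  assumes "f \<in> L2" "g \<in> L2"
  shows "integrable lborel (\<lambda>t. f t * cnj (g t))"
proof (rule Bochner_Integration.integrable_bound)
  show "integrable lborel (\<lambda>t. (cmod (f t))\<^sup>2 + (cmod (g t))\<^sup>2)"
    using assms by (auto simp: L2_def)
  have [measurable]: "f \<in> borel_measurable borel" "g \<in> borel_measurable borel"
    using assms by (auto simp: L2_def)
  have "(\<lambda>t. cnj (g t)) \<in> borel_measurable borel"
    by (rule borel_measurable_continuous_onI[THEN measurable_compose[rotated]])
       (auto intro!: continuous_intros)
  then show "(\<lambda>t. f t * cnj (g t)) \<in> borel_measurable lborel"
    by simp
  show "AE t in lborel. norm (f t * cnj (g t)) \<le> norm ((cmod (f t))\<^sup>2 + (cmod (g t))\<^sup>2)"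
  proof (rule AE_I2)
    fix t
    have "2 * (cmod (f t) * cmod (g t)) \<le> (cmod (f t))\<^sup>2 + (cmod (g t))\<^sup>2"
      using sum_squares_bound[of "cmod (f t)" "cmod (g t)"] by simp
    moreover have "0 \<le> cmod (f t) * cmod (g t)" by simp
    ultimately have "cmod (f t) * cmod (g t) \<le> (cmod (f t))\<^sup>2 + (cmod (g t))\<^sup>2" by linarith
    then show "norm (f t * cnj (g t)) \<le> norm ((cmod (f t))\<^sup>2 + (cmod (g t))\<^sup>2)"
      by (simp add: norm_mult)
  qed
qed

lemma L2_diff:
  assumes "f \<in> L2" "g \<in> L2"
  shows "(\<lambda>t. f t - g t) \<in> L2"
proof -
  have [measurable]: "f \<in> borel_measurable borel" "g \<in> borel_measurable borel"
    using assms by (auto simp: L2_def)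
  have "integrable lborel (\<lambda>t. (cmod (f t - g t))\<^sup>2)"
  proof (rule Bochner_Integration.integrable_bound)
    show "integrable lborel (\<lambda>t. 2 * (cmod (f t))\<^sup>2 + 2 * (cmod (g t))\<^sup>2)"
      using assms by (auto simp: L2_def)
    show "AE t in lborel. norm ((cmod (f t - g t))\<^sup>2) \<le>
        norm (2 * (cmod (f t))\<^sup>2 + 2 * (cmod (g t))\<^sup>2)"
    proof (rule AE_I2)
      fix t
      have "(cmod (f t - g t))\<^sup>2 \<le> (cmod (f t) + cmod (g t))\<^sup>2"
        by (intro power_mono norm_triangle_ineq4) auto
      also have "\<dots> \<le> 2 * (cmod (f t))\<^sup>2 + 2 * (cmod (g t))\<^sup>2"
        using sum_squares_bound[of "cmod (f t)" "cmod (g t)"] by (simp add: power2_sum)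
      finally show "norm ((cmod (f t - g t))\<^sup>2) \<le>
        norm (2 * (cmod (f t))\<^sup>2 + 2 * (cmod (g t))\<^sup>2)" by simp
    qed
  qed measurable
  then show ?thesis by (simp add: L2_def)
qed

lemma is_loc_op_value_unique:
  assumes "is_loc_op_value \<Omega> f h" "is_loc_op_value \<Omega> f h'"
  shows "AE t in lborel. h t = h' t"
proof -
  let ?d = "\<lambda>t. h t - h' t"
  have L: "h \<in> L2" "h' \<in> L2" using assms by (auto simp: is_loc_op_value_def)
  then have d: "?d \<in> L2" by (rule L2_diff)
  have eq: "inner_L2 h ?d = inner_L2 h' ?d"
    using assms d by (simp add: is_loc_op_value_def)
  have "(LINT t|lborel. ?d t * cnj (?d t)) = inner_L2 h ?d - inner_L2 h' ?d"
    unfolding inner_L2_def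
    using Bochner_Integration.integral_diff
      [OF L2_mult_cnj_integrable[OF L(1) d] L2_mult_cnj_integrable[OF L(2) d]]
    by (simp add: left_diff_distrib)
  then have "(LINT t|lborel. complex_of_real ((cmod (?d t))\<^sup>2)) = 0"
    using eq by (simp only: complex_norm_square) simp
  then have "(LINT t|lborel. (cmod (?d t))\<^sup>2) = 0"
    by (metis integral_complex_of_real of_real_eq_0_iff)
  then have "AE t in lborel. (cmod (?d t))\<^sup>2 = 0"
    using d by (subst (asm) integral_nonneg_eq_0_iff_AE) (auto simp: L2_def)
  then show ?thesis by simp
qed

end

theory Submission
  imports Defs "HOL-Probability.Probability" "HOL-Complex_Analysis.Complex_Analysis"
begin

text \<open>
  Identify the phase plane with the complex plane by \<open>z = x + \<i> \<omega>\<close>. The Gaussian short-time Fourier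
  transform of a finite combination of Hermite functions is a fixed Gaussian factor times a polynomial
  \<open>F\<close> in \<open>cnj z\<close>. Evaluating the localization operator at a point \<open>t\<close> therefore turns the eigenvalue
  equation into
  \<open>\<integral>\<^sub>U F (cnj z) E z exp (- pi \<bar>z\<bar>\<^sup>2) = lam \<integral> F (cnj z) E z exp (- pi \<bar>z\<bar>\<^sup>2)\<close>,
  where \<open>E\<close> runs through the generating functions of the Hermite functions
  (\<open>loc_op_eigenfunction\<close>, \<open>deriv_hermite_gen_0\<close>). A domain with this property for every entire \<open>E\<close> is constructed.

  Let \<open>\<gamma>\<^sub>k (u)\<close> be the integral of \<open>s\<^sup>k exp (- pi s)\<close> over \<open>[0, u]\<close>. Since
  \<open>z\<^sup>-\<^sup>k\<^sup>-\<^sup>1 \<gamma>\<^sub>k (\<bar>z\<bar>\<^sup>2)\<close> is a primitive of \<open>cnj z\<^sup>k exp (- pi \<bar>z\<bar>\<^sup>2)\<close> with respect to \<open>cnj z\<close>, Green's formula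
  (\<open>green_star\<close>) shows that the difference of the two sides is a boundary integral of \<open>M E dz / z\<close> with
  \<open>M = \<Sum>\<^sub>k F\<^sub>k z\<^sup>-\<^sup>k (\<gamma>\<^sub>k (\<bar>z\<bar>\<^sup>2) - lam k! / pi\<^sup>k\<^sup>+\<^sup>1)\<close>. It vanishes if \<open>M\<close> is the boundary value of a
  holomorphic function on \<open>U\<close> that is zero at the origin. In a conformal parametrisation
  \<open>z = r w exp (p w)\<close>, \<open>\<bar>w\<bar> = 1\<close>, this says that \<open>M\<close> has no Fourier coefficients of index at most \<open>0\<close>.

  For \<open>F = 1\<close> the disk, \<open>p = 0\<close>, makes \<open>M\<close> vanish, and the linearisation there is a positive multiple of
  \<open>p + cnj p\<close>, which the coefficients of index at most \<open>0\<close> determine. So for small perturbations of \<open>F\<close> a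
  contraction argument finds \<open>p\<close> (\<open>boundary_fun_solution\<close>). It takes place in a Banach algebra of absolutely
  convergent Laurent series with weights \<open>2\<^sup>\<bar>\<^sup>n\<^sup>\<bar>\<close>: an algebra, because \<open>M\<close> is built from \<open>p\<close> by products and
  exponentials; with coefficient norms, because truncations are then continuous; and weighted, because the solution then
  extends across the circle, which makes the boundary curve real-analytic. The latter is read off in
  polar coordinates, where the angle is inverted holomorphically (\<open>bump_analytic\<close>).

  There is one real equation more than there are unknowns, because the normalisation makes \<open>p\<close> real at
  the origin: the contraction only achieves that the constant coefficient of \<open>M\<close> is imaginary. That it
  vanishes follows from the equation itself, tested with the \<open>E\<close> whose coefficients are conjugate to
  those of \<open>F\<close>, for which all integrals are real (\<open>solution_domain\<close>).
\<close>

section \<open>A weighted Wiener algebra\<close>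

text \<open>The geometric growth of the weights makes every element sum to a function that is holomorphic
  in a neighbourhood of the unit circle; any base above \<open>1\<close> has this effect.\<close>

definition wt :: "int \<Rightarrow> real" where
  "wt n = 2 ^ nat \<bar>n\<bar>"

definition wsum :: "(int \<Rightarrow> complex) \<Rightarrow> bool" where
  "wsum a \<longleftrightarrow> (\<lambda>n. cmod (a n) * wt n) summable_on UNIV"

definition conv :: "(int \<Rightarrow> complex) \<Rightarrow> (int \<Rightarrow> complex) \<Rightarrow> int \<Rightarrow> complex" where
  "conv a b n = (\<Sum>\<^sub>\<infinity>j. a j * b (n - j))"

lemma wt_ge_1: "1 \<le> wt n"
  by (simp add: wt_def)

lemma wt_pos: "0 < wt n"
  using wt_ge_1[of n] by linarith

lemma wt_mult: "wt (m + n) \<le> wt m * wt n"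
proof -
  have "nat \<bar>m + n\<bar> \<le> nat \<bar>m\<bar> + nat \<bar>n\<bar>" by linarith
  then show ?thesis
    unfolding wt_def power_add[symmetric] by (rule power_increasing) simp
qed

lemma wsum_comparison:
  assumes "wsum a" "\<And>n. cmod (b n) \<le> cmod (a n)"
  shows "wsum b"
  using assms(1) unfolding wsum_def
  by (rule summable_on_comparison_test) (auto intro!: mult_right_mono assms(2) simp: less_imp_le[OF wt_pos])

lemma wsum_imp_abs_summable:
  assumes "wsum a"
  shows "(\<lambda>n. cmod (a n)) summable_on UNIV"
  using assms unfolding wsum_def
  by (rule summable_on_comparison_test) (use mult_left_mono[OF wt_ge_1] in \<open>auto\<close>)

lemma wsum_add:
  assumes "wsum a" "wsum b"
  shows "wsum (\<lambda>n. a n + b n)"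
proof -
  have "(\<lambda>n. cmod (a n) * wt n + cmod (b n) * wt n) summable_on UNIV"
    using assms unfolding wsum_def by (rule summable_on_add)
  then show ?thesis
    unfolding wsum_def
  proof (rule summable_on_comparison_test)
    fix n
    show "cmod (a n + b n) * wt n \<le> cmod (a n) * wt n + cmod (b n) * wt n"
      unfolding distrib_right[symmetric]
      by (intro mult_right_mono norm_triangle_ineq less_imp_le[OF wt_pos])
  qed (auto simp: less_imp_le[OF wt_pos])
qed

lemma wsum_scaleR: "wsum a \<Longrightarrow> wsum (\<lambda>n. r *\<^sub>R a n)"
  unfolding wsum_def using summable_on_cmult_right[of "\<lambda>n. cmod (a n) * wt n" UNIV "\<bar>r\<bar>"]
  by (simp add: mult.assoc)

lemma wsum_uminus: "wsum a \<Longrightarrow> wsum (\<lambda>n. - a n)"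
  by (simp add: wsum_def)

lemma wsum_diff: "wsum a \<Longrightarrow> wsum b \<Longrightarrow> wsum (\<lambda>n. a n - b n)"
  using wsum_add[OF _ wsum_uminus, of a b] by simp

lemma wsum_single: "wsum (\<lambda>n. if n = k then c else 0)"
  unfolding wsum_def
  by (rule finite_nonzero_values_imp_summable_on)
     (auto intro!: finite_subset[of _ "{k}"] split: if_splits)

lemma product_summable_weighted:
  assumes "wsum a" "wsum b"
  shows "(\<lambda>(j, k). (cmod (a j) * wt j) * (cmod (b k) * wt k)) summable_on UNIV \<times> UNIV"
proof (rule summable_on_SigmaI)
  show "((\<lambda>k. case (j, k) of (j, k) \<Rightarrow> (cmod (a j) * wt j) * (cmod (b k) * wt k)) has_sum
      (cmod (a j) * wt j) * (\<Sum>\<^sub>\<infinity>k. cmod (b k) * wt k)) UNIV" for j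
    using assms(2) by (auto intro!: has_sum_cmult_right simp: wsum_def)
  show "(\<lambda>j. (cmod (a j) * wt j) * (\<Sum>\<^sub>\<infinity>k. cmod (b k) * wt k)) summable_on UNIV"
    using assms(1) by (auto intro!: summable_on_cmult_left simp: wsum_def)
qed (auto simp: less_imp_le[OF wt_pos])

text \<open>The substitution \<open>(j, k) \<mapsto> (j + k, j)\<close> carries the product of two norms to the double sum
  that dominates the norm of a convolution, because the weights are submultiplicative.\<close>

lemma shear_summable_weighted:
  assumes "wsum a" "wsum b"
  shows "(\<lambda>(n, j). (cmod (a j) * wt j) * (cmod (b (n - j)) * wt (n - j))) summable_on UNIV \<times> UNIV"
  using product_summable_weighted[OF assms]
  by (rule iffD1[OF summable_on_reindex_bij_witness[where i = "\<lambda>(n, j). (j, n - j)" and j = "\<lambda>(j, k). (j + k, j)"], rotated -1])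
     auto

lemma shear_infsum_weighted:
  assumes "wsum a" "wsum b"
  shows "(\<Sum>\<^sub>\<infinity>n. \<Sum>\<^sub>\<infinity>j. (cmod (a j) * wt j) * (cmod (b (n - j)) * wt (n - j)))
    = (\<Sum>\<^sub>\<infinity>n. cmod (a n) * wt n) * (\<Sum>\<^sub>\<infinity>n. cmod (b n) * wt n)"
proof -
  have "(\<Sum>\<^sub>\<infinity>n. \<Sum>\<^sub>\<infinity>j. (cmod (a j) * wt j) * (cmod (b (n - j)) * wt (n - j)))
     = (\<Sum>\<^sub>\<infinity>j. \<Sum>\<^sub>\<infinity>n. (cmod (a j) * wt j) * (cmod (b (n - j)) * wt (n - j)))"
    using shear_summable_weighted[OF assms] by (rule infsum_swap_banach)
  also have "\<dots> = (\<Sum>\<^sub>\<infinity>j. (cmod (a j) * wt j) * (\<Sum>\<^sub>\<infinity>k. cmod (b k) * wt k))"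
  proof (rule infsum_cong)
    fix j
    have "(\<Sum>\<^sub>\<infinity>n. cmod (b (n - j)) * wt (n - j)) = (\<Sum>\<^sub>\<infinity>k. cmod (b k) * wt k)"
      by (rule infsum_reindex_bij_witness[where i = "\<lambda>k. k + j" and j = "\<lambda>n. n - j"]) auto
    then show "(\<Sum>\<^sub>\<infinity>n. (cmod (a j) * wt j) * (cmod (b (n - j)) * wt (n - j)))
      = (cmod (a j) * wt j) * (\<Sum>\<^sub>\<infinity>k. cmod (b k) * wt k)"
      by (simp add: infsum_cmult_right')
  qed
  also have "\<dots> = (\<Sum>\<^sub>\<infinity>n. cmod (a n) * wt n) * (\<Sum>\<^sub>\<infinity>n. cmod (b n) * wt n)"
    by (simp add: infsum_cmult_left')
  finally show ?thesis .
qed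

lemma conv_term_le:
  "cmod (a j * b (n - j)) * wt n \<le> (cmod (a j) * wt j) * (cmod (b (n - j)) * wt (n - j))"
proof -
  have "(cmod (a j) * cmod (b (n - j))) * wt n \<le> (cmod (a j) * cmod (b (n - j))) * (wt j * wt (n - j))"
    using wt_mult[of j "n - j"] by (intro mult_left_mono) auto
  then show ?thesis by (simp add: norm_mult ac_simps)
qed

lemma conv_abs_summable:
  assumes "wsum a" "wsum b"
  shows "(\<lambda>j. norm (a j * b (n - j))) summable_on UNIV"
proof -
  have "(\<lambda>j. (cmod (a j) * wt j) * (cmod (b (n - j)) * wt (n - j))) summable_on UNIV"
    using summable_on_SigmaD1[OF shear_summable_weighted[OF assms], of n] by simp
  then show ?thesis
  proof (rule summable_on_comparison_test)
    fix j
    have "cmod (a j * b (n - j)) * 1 \<le> cmod (a j * b (n - j)) * wt n"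
      by (intro mult_left_mono wt_ge_1) auto
    also note conv_term_le
    finally show "norm (a j * b (n - j)) \<le> (cmod (a j) * wt j) * (cmod (b (n - j)) * wt (n - j))"
      by simp
  qed auto
qed

lemma conv_summable: "wsum a \<Longrightarrow> wsum b \<Longrightarrow> (\<lambda>j. a j * b (n - j)) summable_on UNIV"
  by (rule abs_summable_summable[OF conv_abs_summable])

lemma conv_bound:
  assumes "wsum a" "wsum b"
  shows "cmod (conv a b n) * wt n \<le>
    (\<Sum>\<^sub>\<infinity>j. (cmod (a j) * wt j) * (cmod (b (n - j)) * wt (n - j)))"
proof -
  have "cmod (conv a b n) * wt n \<le> (\<Sum>\<^sub>\<infinity>j. cmod (a j * b (n - j))) * wt n"
    unfolding conv_def
    by (intro mult_right_mono norm_infsum_bound conv_abs_summable assms less_imp_le[OF wt_pos])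
  also have "\<dots> = (\<Sum>\<^sub>\<infinity>j. cmod (a j * b (n - j)) * wt n)"
    by (simp add: infsum_cmult_left')
  also have "\<dots> \<le> (\<Sum>\<^sub>\<infinity>j. (cmod (a j) * wt j) * (cmod (b (n - j)) * wt (n - j)))"
    using conv_abs_summable[OF assms, of n] summable_on_SigmaD1[OF shear_summable_weighted[OF assms], of n]
    by (intro infsum_mono summable_on_cmult_left conv_term_le) auto
  finally show ?thesis .
qed

lemma wsum_conv:
  assumes "wsum a" "wsum b"
  shows "wsum (conv a b)"
proof -
  have "(\<lambda>n. \<Sum>\<^sub>\<infinity>j. (cmod (a j) * wt j) * (cmod (b (n - j)) * wt (n - j))) summable_on UNIV"
    using summable_on_Sigma_banach[OF shear_summable_weighted[OF assms]] by simp
  then show ?thesis unfolding wsum_def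
    by (rule summable_on_comparison_test) (auto intro!: conv_bound assms simp: less_imp_le[OF wt_pos])
qed

lemma norm_conv_le:
  assumes "wsum a" "wsum b"
  shows "(\<Sum>\<^sub>\<infinity>n. cmod (conv a b n) * wt n)
    \<le> (\<Sum>\<^sub>\<infinity>n. cmod (a n) * wt n) * (\<Sum>\<^sub>\<infinity>n. cmod (b n) * wt n)"
proof -
  have "(\<Sum>\<^sub>\<infinity>n. cmod (conv a b n) * wt n)
    \<le> (\<Sum>\<^sub>\<infinity>n. \<Sum>\<^sub>\<infinity>j. (cmod (a j) * wt j) * (cmod (b (n - j)) * wt (n - j)))"
    using wsum_conv[OF assms] summable_on_Sigma_banach[OF shear_summable_weighted[OF assms]]
    by (intro infsum_mono conv_bound assms) (auto simp: wsum_def)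
  then show ?thesis by (simp add: shear_infsum_weighted[OF assms])
qed

lemma conv_commute: "conv a b = conv b a"
proof
  fix n
  show "conv a b n = conv b a n"
    unfolding conv_def
    by (rule infsum_reindex_bij_witness[where i = "\<lambda>k. n - k" and j = "\<lambda>k. n - k"]) auto
qed

lemma shear_summable:
  assumes "wsum a" "wsum b" "\<And>n j. cmod (f n) \<le> C"
  shows "(\<lambda>(n, j). a j * b (n - j) * f n) summable_on UNIV \<times> UNIV"
proof -
  have "(\<lambda>p. C * (case p of (n, j) \<Rightarrow> (cmod (a j) * wt j) * (cmod (b (n - j)) * wt (n - j)))) summable_on UNIV \<times> UNIV"
    using shear_summable_weighted[OF assms(1,2)] by (rule summable_on_cmult_right)
  then have "(\<lambda>p. norm (case p of (n, j) \<Rightarrow> a j * b (n - j) * f n)) summable_on UNIV \<times> UNIV"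
  proof (rule summable_on_comparison_test)
    fix p :: "int \<times> int"
    obtain n j where p: "p = (n, j)" by (cases p)
    have "0 \<le> C" using assms(3)[of n] norm_ge_zero[of "f n"] by linarith
    have "cmod (a j * b (n - j)) * 1 \<le> cmod (a j * b (n - j)) * wt n"
      by (intro mult_left_mono wt_ge_1) auto
    also note conv_term_le
    finally have "cmod (a j * b (n - j)) * cmod (f n) \<le> (cmod (a j) * wt j) * (cmod (b (n - j)) * wt (n - j)) * C"
      using assms(3)[of n] by (intro mult_mono) (auto simp: less_imp_le[OF wt_pos])
    then show "norm (case p of (n, j) \<Rightarrow> a j * b (n - j) * f n) \<le>
        C * (case p of (n, j) \<Rightarrow> (cmod (a j) * wt j) * (cmod (b (n - j)) * wt (n - j)))"
      by (simp add: p norm_mult mult.commute)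
  qed auto
  then show ?thesis by (rule abs_summable_summable)
qed

lemma coeff_le_total:
  assumes "wsum a"
  shows "cmod (a n) \<le> (\<Sum>\<^sub>\<infinity>k. cmod (a k) * wt k)"
proof -
  have "cmod (a n) * 1 \<le> cmod (a n) * wt n" by (intro mult_left_mono wt_ge_1) auto
  also have "\<dots> = (\<Sum>k\<in>{n}. cmod (a k) * wt k)" by simp
  also have "\<dots> \<le> (\<Sum>\<^sub>\<infinity>k. cmod (a k) * wt k)"
    using assms by (intro finite_sum_le_infsum) (auto simp: wsum_def less_imp_le[OF wt_pos])
  finally show ?thesis by simp
qed

lemma conv_assoc:
  assumes "wsum a" "wsum b" "wsum c"
  shows "conv (conv a b) c = conv a (conv b c)"
proof
  fix n
  have "conv (conv a b) c n = (\<Sum>\<^sub>\<infinity>k. \<Sum>\<^sub>\<infinity>j. a j * b (k - j) * c (n - k))"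
    unfolding conv_def by (simp add: infsum_cmult_left')
  also have "\<dots> = (\<Sum>\<^sub>\<infinity>j. \<Sum>\<^sub>\<infinity>k. a j * b (k - j) * c (n - k))"
    by (rule infsum_swap_banach, rule shear_summable[OF assms(1,2), of "\<lambda>k. c (n - k)"])
       (rule coeff_le_total[OF assms(3)])
  also have "\<dots> = (\<Sum>\<^sub>\<infinity>j. a j * conv b c (n - j))"
  proof (rule infsum_cong)
    fix j
    have "(\<Sum>\<^sub>\<infinity>k. b (k - j) * c (n - k)) = conv b c (n - j)"
      unfolding conv_def
      by (rule infsum_reindex_bij_witness[where i = "\<lambda>k. k + j" and j = "\<lambda>k. k - j"])
         (auto simp: algebra_simps)
    then show "(\<Sum>\<^sub>\<infinity>k. a j * b (k - j) * c (n - k)) = a j * conv b c (n - j)"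
      by (simp add: infsum_cmult_right' mult.assoc)
  qed
  finally show "conv (conv a b) c n = conv a (conv b c) n" unfolding conv_def[of a] .
qed

text \<open>Elements are sequences of Laurent coefficients, multiplied by convolution, so that summing the
  Laurent series on the unit circle is a ring homomorphism.\<close>

typedef wiener = "{a. wsum a}" morphisms coef Wiener
  by (rule exI[of _ "\<lambda>n. if n = 0 then 0 else 0"]) (use wsum_single in blast)

setup_lifting type_definition_wiener

lemma wsum_coef [simp]: "wsum (coef a)"
  using coef by simp

lemma wiener_eqI: "(\<And>n. coef a n = coef b n) \<Longrightarrow> a = b"
  by (simp add: coef_inject[symmetric] fun_eq_iff)

lift_definition laurent_monom :: "int \<Rightarrow> complex \<Rightarrow> wiener" is "\<lambda>k c n. if n = k then c else 0"
  by (rule wsum_single)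

instantiation wiener :: comm_ring_1
begin

lift_definition zero_wiener :: wiener is "\<lambda>_. 0"
  using wsum_single[of 0 0] by simp

lift_definition one_wiener :: wiener is "\<lambda>n. if n = 0 then 1 else 0"
  by (rule wsum_single)

lift_definition plus_wiener :: "wiener \<Rightarrow> wiener \<Rightarrow> wiener" is "\<lambda>a b n. a n + b n"
  by (rule wsum_add)

lift_definition minus_wiener :: "wiener \<Rightarrow> wiener \<Rightarrow> wiener" is "\<lambda>a b n. a n - b n"
  by (rule wsum_diff)

lift_definition uminus_wiener :: "wiener \<Rightarrow> wiener" is "\<lambda>a n. - a n"
  by (rule wsum_uminus)

lift_definition times_wiener :: "wiener \<Rightarrow> wiener \<Rightarrow> wiener" is conv
  by (rule wsum_conv)

instance
proof
  fix a b c :: wiener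
  show "a * b * c = a * (b * c)" by transfer (rule conv_assoc)
  show "a * b = b * a" by transfer (rule conv_commute)
  show "1 * a = a"
  proof transfer
    fix a :: "int \<Rightarrow> complex"
    have "(\<lambda>j. (if j = 0 then 1 else 0) * a (n - j)) = (\<lambda>j. if j = 0 then a n else 0)" for n :: int
      by (auto simp: fun_eq_iff)
    moreover have "(\<Sum>\<^sub>\<infinity>j::int. if j = 0 then a n else 0) = a n" for n :: int
      using infsum_cong_neutral[of "{0::int}" UNIV "\<lambda>j. if j = 0 then a n else 0" "\<lambda>j. if j = 0 then a n else 0"]
      by simp
    ultimately show "conv (\<lambda>n. if n = 0 then 1 else 0) a = a" by (simp add: conv_def fun_eq_iff)
  qed
  show "(a + b) * c = a * c + b * c"
    by transfer (auto simp: conv_def fun_eq_iff distrib_right intro!: infsum_add conv_summable)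
qed (transfer; auto simp: fun_eq_iff algebra_simps; metis zero_neq_one)+

end

lemma coef_simps [simp]:
  "coef 0 n = 0" "coef (a + b) n = coef a n + coef b n" "coef (a - b) n = coef a n - coef b n"
  "coef (- a) n = - coef a n" "coef (laurent_monom k c) n = (if n = k then c else 0)"
  "coef 1 n = (if n = 0 then 1 else 0)"
  by (transfer; simp)+

instantiation wiener :: real_vector
begin

lift_definition scaleR_wiener :: "real \<Rightarrow> wiener \<Rightarrow> wiener" is "\<lambda>r a n. r *\<^sub>R a n"
  by (rule wsum_scaleR)

instance
  by standard (transfer; simp add: fun_eq_iff scaleR_add_right scaleR_add_left)+

end

instantiation wiener :: real_normed_algebra_1
begin

lift_definition norm_wiener :: "wiener \<Rightarrow> real" is "\<lambda>a. \<Sum>\<^sub>\<infinity>n. cmod (a n) * wt n" .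

definition dist_wiener :: "wiener \<Rightarrow> wiener \<Rightarrow> real" where "dist_wiener a b = norm (a - b)"

definition sgn_wiener :: "wiener \<Rightarrow> wiener" where "sgn_wiener a = a /\<^sub>R norm a"

definition uniformity_wiener :: "(wiener \<times> wiener) filter" where
  "uniformity_wiener = (INF e\<in>{0<..}. principal {(x, y). dist x y < e})"

definition open_wiener :: "wiener set \<Rightarrow> bool" where
  "open_wiener U = (\<forall>x\<in>U. \<forall>\<^sub>F (x', y) in uniformity. x' = x \<longrightarrow> y \<in> U)"

instance
proof
  fix a b :: wiener and r s :: real
  show "norm a = 0 \<longleftrightarrow> a = 0"
  proof transfer
    fix a assume a: "wsum a"
    have "a = (\<lambda>_. 0)" if "(\<Sum>\<^sub>\<infinity>n. cmod (a n) * wt n) = 0"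
      using coeff_le_total[OF a] that by (auto simp: fun_eq_iff)
    then show "((\<Sum>\<^sub>\<infinity>n. cmod (a n) * wt n) = 0) = (a = (\<lambda>_. 0))" by auto
  qed
  show "norm (a + b) \<le> norm a + norm b"
  proof transfer
    fix a b assume ab: "wsum a" "wsum b"
    have "(\<Sum>\<^sub>\<infinity>n. cmod (a n + b n) * wt n) \<le> (\<Sum>\<^sub>\<infinity>n. cmod (a n) * wt n + cmod (b n) * wt n)"
    proof (rule infsum_mono)
      show "(\<lambda>n. cmod (a n + b n) * wt n) summable_on UNIV"
        using wsum_add[OF ab] by (simp add: wsum_def)
      show "(\<lambda>n. cmod (a n) * wt n + cmod (b n) * wt n) summable_on UNIV"
        using ab by (intro summable_on_add) (auto simp: wsum_def)
      show "cmod (a n + b n) * wt n \<le> cmod (a n) * wt n + cmod (b n) * wt n" for n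
        unfolding distrib_right[symmetric]
        by (intro mult_right_mono norm_triangle_ineq less_imp_le[OF wt_pos])
    qed
    also have "\<dots> = (\<Sum>\<^sub>\<infinity>n. cmod (a n) * wt n) + (\<Sum>\<^sub>\<infinity>n. cmod (b n) * wt n)"
      using ab by (intro infsum_add) (auto simp: wsum_def)
    finally show "(\<Sum>\<^sub>\<infinity>n. cmod (a n + b n) * wt n) \<le>
      (\<Sum>\<^sub>\<infinity>n. cmod (a n) * wt n) + (\<Sum>\<^sub>\<infinity>n. cmod (b n) * wt n)" .
  qed
  show "norm (r *\<^sub>R a) = \<bar>r\<bar> * norm a"
    by transfer (simp add: mult.assoc infsum_cmult_right')
  show "norm (a * b) \<le> norm a * norm b" by transfer (rule norm_conv_le)
  show "norm (1::wiener) = 1"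
  proof transfer
    have "(\<Sum>\<^sub>\<infinity>n::int. cmod (if n = 0 then 1 else 0) * wt n) = (\<Sum>\<^sub>\<infinity>n\<in>{0::int}. cmod (if n = 0 then 1 else 0) * wt n)"
      by (rule infsum_cong_neutral) auto
    then show "(\<Sum>\<^sub>\<infinity>n::int. cmod (if n = 0 then 1 else 0) * wt n) = 1" by (simp add: wt_def)
  qed
  show "r *\<^sub>R a * b = r *\<^sub>R (a * b)"
    by transfer (simp add: conv_def fun_eq_iff scaleR_conv_of_real mult.assoc infsum_cmult_right')
  show "a * r *\<^sub>R b = r *\<^sub>R (a * b)"
  proof transfer
    fix r :: real and a b :: "int \<Rightarrow> complex"
    have "a j * r *\<^sub>R b (n - j) = of_real r * (a j * b (n - j))" for n j
      by (simp add: scaleR_conv_of_real)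
    then show "conv a (\<lambda>n. r *\<^sub>R b n) = (\<lambda>n. r *\<^sub>R conv a b n)"
      unfolding conv_def fun_eq_iff scaleR_conv_of_real[of r "infsum _ _"]
      by (simp only: infsum_cmult_right' simp_thms)
  qed
qed (fact dist_wiener_def sgn_wiener_def uniformity_wiener_def open_wiener_def)+

end

lemma coef_scaleR [simp]: "coef (r *\<^sub>R a) n = r *\<^sub>R coef a n"
  by transfer simp

lemma summable_coef: "(\<lambda>n. cmod (coef a n) * wt n) summable_on UNIV"
  using wsum_coef[of a] by (simp add: wsum_def)

lemma norm_coef_le: "cmod (coef a n) \<le> norm a"
  using coeff_le_total[of "coef a" n] by (simp add: norm_wiener.rep_eq)

lemma wsum_of_bounded_sums:
  assumes "\<And>F. finite F \<Longrightarrow> (\<Sum>n\<in>F. cmod (c n) * wt n) \<le> B"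
  shows "wsum c" and "(\<Sum>\<^sub>\<infinity>n. cmod (c n) * wt n) \<le> B"
proof -
  show "wsum c" unfolding wsum_def
    by (rule nonneg_bounded_partial_sums_imp_summable_on[where C = B])
       (auto simp: less_imp_le[OF wt_pos] eventually_finite_subsets_at_top intro!: assms)
  then show "(\<Sum>\<^sub>\<infinity>n. cmod (c n) * wt n) \<le> B"
    by (intro infsum_le_finite_sums assms) (auto simp: wsum_def)
qed

text \<open>Coefficients of a Cauchy sequence converge one at a time. The finite partial sums of the norm of
  a difference are bounded uniformly, and this bound survives the limit: it puts the limit into the
  algebra and gives convergence in norm.\<close>

instance wiener :: banach
proof
  fix X :: "nat \<Rightarrow> wiener" assume X: "Cauchy X"
  have "Cauchy (\<lambda>i. coef (X i) n)" for n
  proof (rule metric_CauchyI)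
    fix e :: real assume "0 < e"
    then obtain M where M: "\<And>i j. i \<ge> M \<Longrightarrow> j \<ge> M \<Longrightarrow> dist (X i) (X j) < e"
      using X by (meson metric_CauchyD)
    have "dist (coef (X i) n) (coef (X j) n) \<le> dist (X i) (X j)" for i j
      using norm_coef_le[of "X i - X j" n] by (simp add: dist_norm)
    then show "\<exists>M. \<forall>i\<ge>M. \<forall>j\<ge>M. dist (coef (X i) n) (coef (X j) n) < e"
      using M le_less_trans by blast
  qed
  then have "\<exists>l. (\<lambda>i. coef (X i) n) \<longlonglongrightarrow> l" for n
    using Cauchy_convergent convergent_def by blast
  then obtain c where c: "\<And>n. (\<lambda>i. coef (X i) n) \<longlonglongrightarrow> c n" by metis
  have key: "(\<Sum>n\<in>F. cmod (c n - coef (X i) n) * wt n) \<le> e"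
    if M: "\<forall>i\<ge>M. \<forall>j\<ge>M. dist (X i) (X j) < e" and "i \<ge> M" "finite F" for F i e M
  proof (rule tendsto_upperbound)
    show "(\<lambda>j. \<Sum>n\<in>F. cmod (coef (X j) n - coef (X i) n) * wt n)
      \<longlonglongrightarrow> (\<Sum>n\<in>F. cmod (c n - coef (X i) n) * wt n)"
      by (intro tendsto_intros c)
    show "\<forall>\<^sub>F j in sequentially. (\<Sum>n\<in>F. cmod (coef (X j) n - coef (X i) n) * wt n) \<le> e"
    proof (rule eventually_sequentiallyI[of M])
      fix j assume j: "M \<le> j"
      have "(\<Sum>n\<in>F. cmod (coef (X j - X i) n) * wt n) \<le> (\<Sum>\<^sub>\<infinity>n. cmod (coef (X j - X i) n) * wt n)"
        by (intro finite_sum_le_infsum summable_coef \<open>finite F\<close>) (auto simp: less_imp_le[OF wt_pos])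
      also have "\<dots> = dist (X j) (X i)" by (simp add: dist_norm norm_wiener.rep_eq)
      also have "\<dots> \<le> e" using M j \<open>i \<ge> M\<close> by (simp add: less_imp_le)
      finally show "(\<Sum>n\<in>F. cmod (coef (X j) n - coef (X i) n) * wt n) \<le> e" by simp
    qed
  qed auto
  \<comment> \<open>One tail member suffices to see that the limit lies in the algebra.\<close>
  obtain M1 where M1: "\<forall>i\<ge>M1. \<forall>j\<ge>M1. dist (X i) (X j) < 1"
    using X zero_less_one by (metis metric_CauchyD)
  have "wsum (\<lambda>n. c n - coef (X M1) n)"
    by (rule wsum_of_bounded_sums(1)[where B = 1]) (use key[OF M1] in auto)
  from wsum_add[OF this wsum_coef[of "X M1"]] have "wsum c" by simp
  then obtain L where L: "c = coef L" by (metis Wiener_inverse mem_Collect_eq)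
  have "X \<longlonglongrightarrow> L"
  proof (rule metric_LIMSEQ_I)
    fix e :: real assume e: "0 < e"
    then obtain M where M: "\<forall>i\<ge>M. \<forall>j\<ge>M. dist (X i) (X j) < e/2"
      using X by (metis half_gt_zero metric_CauchyD)
    have "dist (X i) L < e" if "i \<ge> M" for i
    proof -
      have "(\<Sum>\<^sub>\<infinity>n. cmod (c n - coef (X i) n) * wt n) \<le> e/2"
        by (rule wsum_of_bounded_sums(2)) (use key[OF M that] in auto)
      then have "dist L (X i) \<le> e/2" by (simp add: dist_norm norm_wiener.rep_eq L)
      then show ?thesis using e by (simp add: dist_commute)
    qed
    then show "\<exists>M. \<forall>i\<ge>M. dist (X i) L < e" by blast
  qed
  then show "convergent X" by (auto simp: convergent_def)
qed

subsection \<open>Evaluation on the unit circle\<close>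

definition ev :: "real \<Rightarrow> wiener \<Rightarrow> complex" where
  "ev s a = (\<Sum>\<^sub>\<infinity>n. coef a n * cis (of_int n * s))"

lemma ev_summable: "(\<lambda>n. coef a n * cis (of_int n * s)) summable_on UNIV"
proof (rule abs_summable_summable)
  show "(\<lambda>n. norm (coef a n * cis (of_int n * s))) summable_on UNIV"
    using wsum_imp_abs_summable[OF wsum_coef[of a]] by (simp add: norm_mult)
qed

lemma ev_add: "ev s (a + b) = ev s a + ev s b"
  unfolding ev_def by (simp add: distrib_right infsum_add ev_summable)

lemma ev_scaleR: "ev s (r *\<^sub>R a) = r *\<^sub>R ev s a"
proof -
  have "(\<Sum>\<^sub>\<infinity>n. coef (r *\<^sub>R a) n * cis (of_int n * s)) = (\<Sum>\<^sub>\<infinity>n. of_real r * (coef a n * cis (of_int n * s)))"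
    unfolding coef_scaleR by (simp add: scaleR_conv_of_real mult.assoc)
  then show ?thesis by (simp add: ev_def scaleR_conv_of_real infsum_cmult_right')
qed

lemma norm_ev_le: "cmod (ev s a) \<le> norm a"
proof -
  have "cmod (ev s a) \<le> (\<Sum>\<^sub>\<infinity>n. cmod (coef a n * cis (of_int n * s)))"
    unfolding ev_def
    by (rule norm_infsum_bound) (use wsum_imp_abs_summable[OF wsum_coef[of a]] in \<open>simp add: norm_mult\<close>)
  also have "\<dots> \<le> (\<Sum>\<^sub>\<infinity>n. cmod (coef a n) * wt n)"
    using wsum_imp_abs_summable[OF wsum_coef[of a]] mult_left_mono[OF wt_ge_1 norm_ge_zero]
    by (intro infsum_mono summable_coef) (auto simp: norm_mult)
  finally show ?thesis by (simp add: norm_wiener.rep_eq)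
qed

lemma bounded_linear_ev: "bounded_linear (ev s)"
  by (rule bounded_linear_intro[where K = 1]) (auto simp: ev_add ev_scaleR norm_ev_le)

text \<open>The rearrangement is the one for associativity, with the character \<open>n \<mapsto> e\<^sup>i\<^sup>n\<^sup>s\<close> in the role of
  the third factor.\<close>

lemma ev_mult: "ev s (a * b) = ev s a * ev s b"
proof -
  have "ev s (a * b) = (\<Sum>\<^sub>\<infinity>n. \<Sum>\<^sub>\<infinity>j. coef a j * coef b (n - j) * cis (of_int n * s))"
    unfolding ev_def by (simp add: times_wiener.rep_eq conv_def infsum_cmult_left')
  also have "\<dots> = (\<Sum>\<^sub>\<infinity>j. \<Sum>\<^sub>\<infinity>n. coef a j * coef b (n - j) * cis (of_int n * s))"
    by (rule infsum_swap_banach, rule shear_summable[where C = 1]) auto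
  also have "\<dots> = (\<Sum>\<^sub>\<infinity>j. coef a j * cis (of_int j * s) * ev s b)"
  proof (rule infsum_cong)
    fix j
    have "(\<Sum>\<^sub>\<infinity>n. coef b (n - j) * cis (of_int (n - j) * s)) = ev s b"
      unfolding ev_def
      by (rule infsum_reindex_bij_witness[where i = "\<lambda>k. k + j" and j = "\<lambda>k. k - j"]) auto
    then have "(\<Sum>\<^sub>\<infinity>n. coef a j * cis (of_int j * s) * (coef b (n - j) * cis (of_int (n - j) * s)))
      = coef a j * cis (of_int j * s) * ev s b"
      by (simp only: infsum_cmult_right')
    moreover have "coef a j * coef b (n - j) * cis (of_int n * s) =
        coef a j * cis (of_int j * s) * (coef b (n - j) * cis (of_int (n - j) * s))" for n
    proof -
      have "cis (of_int j * s) * cis (of_int (n - j) * s) = cis (of_int n * s)"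
        unfolding cis_mult by (simp add: algebra_simps)
      then show ?thesis by (simp add: ac_simps)
    qed
    ultimately show "(\<Sum>\<^sub>\<infinity>n. coef a j * coef b (n - j) * cis (of_int n * s))
      = coef a j * cis (of_int j * s) * ev s b"
      by (simp only:)
  qed
  also have "\<dots> = ev s a * ev s b" by (simp add: ev_def infsum_cmult_left')
  finally show ?thesis .
qed

lemma ev_laurent_monom: "ev s (laurent_monom k c) = c * cis (of_int k * s)"
proof -
  have "ev s (laurent_monom k c) = (\<Sum>\<^sub>\<infinity>n\<in>{k}. coef (laurent_monom k c) n * cis (of_int n * s))"
    unfolding ev_def by (rule infsum_cong_neutral) auto
  then show ?thesis by simp
qed

lemma one_eq_laurent_monom: "(1::wiener) = laurent_monom 0 1"
  by (rule wiener_eqI) simp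

lemma ev_1 [simp]: "ev s 1 = 1"
  by (simp add: one_eq_laurent_monom ev_laurent_monom)

lemma ev_power: "ev s (a ^ n) = ev s a ^ n"
  by (induction n) (simp_all add: ev_mult)

lemma ev_exp: "ev s (exp a) = exp (ev s a)"
proof -
  interpret bounded_linear "ev s" by (rule bounded_linear_ev)
  have "ev s (exp a) = (\<Sum>n. ev s (a ^ n /\<^sub>R fact n))"
    unfolding exp_def by (rule suminf[symmetric, OF summable_exp_generic, symmetric])
  then show ?thesis by (simp add: exp_def scaleR ev_power)
qed

lemma ev_sum: "ev s (\<Sum>i\<in>I. f i) = (\<Sum>i\<in>I. ev s (f i))"
  using linear_sum bounded_linear.linear[OF bounded_linear_ev] by blast

lemma ev_diff: "ev s (a - b) = ev s a - ev s b"
  using bounded_linear_ev bounded_linear.linear linear_diff by blast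

subsection \<open>Conjugation and the analytic part\<close>

lemma infsum_neg_index: "(\<Sum>\<^sub>\<infinity>n::int. f (- n)) = (\<Sum>\<^sub>\<infinity>n. f n)"
  by (rule infsum_reindex_bij_witness[where i = uminus and j = uminus]) auto

lemma wsum_neg: "wsum a \<Longrightarrow> wsum (\<lambda>n. a (- n))"
  unfolding wsum_def
  by (rule iffD1[OF summable_on_reindex_bij_witness[where i = uminus and j = uminus], rotated -1])
     (auto simp: wt_def)

text \<open>On the unit circle this is complex conjugation of functions (lemma \<open>ev_star\<close> below).\<close>

lift_definition star :: "wiener \<Rightarrow> wiener" is "\<lambda>a n. cnj (a (- n))"
  using wsum_neg by (simp add: wsum_def)

lemma coef_star [simp]: "coef (star a) n = cnj (coef a (- n))"
  by transfer simp

lemma norm_star [simp]: "norm (star a) = norm a"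
  using infsum_neg_index[of "\<lambda>n. cmod (coef a n) * wt n"]
  by (simp add: norm_wiener.rep_eq wt_def)

lemma star_add: "star (a + b) = star a + star b"
  by (rule wiener_eqI) simp

lemma star_diff: "star (a - b) = star a - star b"
  by (rule wiener_eqI) simp

lemma ev_star: "ev s (star a) = cnj (ev s a)"
proof -
  have "ev s (star a) = (\<Sum>\<^sub>\<infinity>n. cnj (coef a (- n) * cis (of_int (- n) * s)))"
    unfolding ev_def by (simp add: cis_cnj)
  also have "\<dots> = (\<Sum>\<^sub>\<infinity>n. cnj (coef a n * cis (of_int n * s)))"
    by (rule infsum_neg_index[of "\<lambda>n. cnj (coef a n * cis (of_int n * s))"])
  also have "\<dots> = cnj (ev s a)" unfolding ev_def by (rule infsum_cnj)
  finally show ?thesis .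
qed

text \<open>A left inverse of \<open>p \<mapsto> p + star p\<close> on power series with real constant term that reads only the
  coefficients of index at most \<open>0\<close>, and of the constant one only the real part. Its kernel is thus
  exactly the space in which the boundary function has to lie, up to an imaginary constant.\<close>

lift_definition analytic_fold :: "wiener \<Rightarrow> wiener" is
  "\<lambda>a n. if n > 0 then cnj (a (- n)) else if n = 0 then of_real (Re (a 0) / 2) else 0"
proof -
  fix a assume "wsum a"
  then have "wsum (\<lambda>n. a (- n))" by (rule wsum_neg)
  then show "wsum (\<lambda>n. if n > 0 then cnj (a (- n)) else if n = 0 then of_real (Re (a 0) / 2) else 0)"
  proof (rule wsum_comparison)
    fix n
    have "cmod (of_real (Re (a 0) / 2)) \<le> cmod (a 0)"
      using abs_Re_le_cmod[of "a 0"] by simp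
    then show "cmod (if n > 0 then cnj (a (- n)) else if n = 0 then of_real (Re (a 0) / 2) else 0) \<le> cmod (a (- n))"
      by auto
  qed
qed

lemma coef_analytic_fold: "coef (analytic_fold a) n =
    (if n > 0 then cnj (coef a (- n)) else if n = 0 then of_real (Re (coef a 0) / 2) else 0)"
  by transfer simp

lemma norm_analytic_fold_le: "norm (analytic_fold a) \<le> norm a"
proof -
  have "norm (analytic_fold a) \<le> norm (star a)"
    unfolding norm_wiener.rep_eq
  proof (intro infsum_mono summable_coef mult_right_mono)
    fix n
    show "cmod (coef (analytic_fold a) n) \<le> cmod (coef (star a) n)"
      using abs_Re_le_cmod[of "coef a 0"] norm_ge_zero[of "coef a 0"]
      by (auto simp: coef_analytic_fold simp del: norm_ge_zero) (auto intro: order.trans)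
  qed (simp add: less_imp_le[OF wt_pos])
  then show ?thesis by simp
qed

lemma analytic_fold_diff: "analytic_fold (a - b) = analytic_fold a - analytic_fold b"
  by (rule wiener_eqI) (simp add: coef_analytic_fold diff_divide_distrib)

lemma analytic_fold_scaleR: "analytic_fold (r *\<^sub>R a) = r *\<^sub>R analytic_fold a"
  by (rule wiener_eqI) (simp add: coef_analytic_fold, simp add: scaleR_conv_of_real)

text \<open>Fixed points of maps of the form \<open>analytic_fold o \<dots>\<close> are power series with real constant term; this
  identity then removes \<open>p + star p\<close> from a fixed-point equation.\<close>

lemma analytic_fold_self_plus_star: "analytic_fold (analytic_fold a + star (analytic_fold a)) = analytic_fold a"
  by (rule wiener_eqI) (simp add: coef_analytic_fold)

lemma analytic_fold_eq_0D:
  assumes "analytic_fold a = 0"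
  shows "n < 0 \<Longrightarrow> coef a n = 0" and "Re (coef a 0) = 0"
proof -
  have *: "coef (analytic_fold a) m = 0" for m using assms by simp
  show "coef a n = 0" if "n < 0" using *[of "- n"] that by (simp add: coef_analytic_fold)
  show "Re (coef a 0) = 0" using *[of 0] by (simp add: coef_analytic_fold)
qed

section \<open>The boundary equation and its solution by contraction\<close>

subsection \<open>Estimates for the exponential\<close>

lemma norm_laurent_monom: "norm (laurent_monom k c) = cmod c * wt k"
proof -
  have "norm (laurent_monom k c) = (\<Sum>\<^sub>\<infinity>n\<in>{k}. cmod (coef (laurent_monom k c) n) * wt n)"
    unfolding norm_wiener.rep_eq by (rule infsum_cong_neutral) auto
  then show ?thesis by simp
qed

text \<open>The exponential series is dominated termwise by the real one; dropping the first one or two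
  terms on both sides keeps the domination.\<close>

lemma norm_exp_minus_one_minus_le:
  fixes x :: "'a::{real_normed_algebra_1,banach}"
  shows "norm (exp x - 1) \<le> exp (norm x) - 1" and "norm (exp x - 1 - x) \<le> exp (norm x) - 1 - norm x"
proof -
  define f where "f n = x ^ n /\<^sub>R fact n" for n
  define g where "g n = norm x ^ n /\<^sub>R fact n" for n
  have f: "f sums exp x" and g: "g sums exp (norm x)"
    unfolding f_def g_def by (rule exp_converges)+
  have le: "norm (f n) \<le> g n" for n
    by (simp add: f_def g_def divide_right_mono norm_power_ineq)
  have shift: "norm (exp x - (\<Sum>i<k. f i)) \<le> exp (norm x) - (\<Sum>i<k. g i)" for k
  proof -
    have "(\<lambda>n. f (n + k)) sums (exp x - (\<Sum>i<k. f i))"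
      and G: "(\<lambda>n. g (n + k)) sums (exp (norm x) - (\<Sum>i<k. g i))"
      using sums_split_initial_segment f g by blast+
    then show ?thesis
      using norm_suminf_le[of "\<lambda>n. f (n + k)" "\<lambda>n. g (n + k)"] le by (simp add: sums_iff)
  qed
  show "norm (exp x - 1) \<le> exp (norm x) - 1"
    using shift[of 1] by (simp add: f_def g_def)
  have "(\<Sum>i<2. f i) = 1 + x" "(\<Sum>i<2. g i) = 1 + norm x"
    by (simp_all add: f_def g_def numeral_2_eq_2)
  then show "norm (exp x - 1 - x) \<le> exp (norm x) - 1 - norm x"
    using shift[of 2] by (simp only: diff_diff_eq)
qed

lemma real_exp_minus_one_le: "0 \<le> x \<Longrightarrow> exp x - 1 \<le> x * exp (x::real)"
  using exp_ge_add_one_self[of "- x"] mult_left_mono[of "1 + - x" "exp (- x)" "exp x"]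
  by (simp add: exp_minus field_simps)

lemma real_exp_minus_one_minus_le:
  assumes "0 \<le> (x::real)" shows "exp x - 1 - x \<le> x * (exp x - 1)"
  using real_exp_minus_one_le[OF assms] by (simp add: algebra_simps)

subsection \<open>Lipschitz continuity near the origin\<close>

text \<open>This class is closed under all operations of the algebra, which yields Lipschitz bounds for the
  perturbing terms of the boundary equation without computing their derivatives.\<close>

definition lip0 :: "('a::real_normed_vector \<Rightarrow> 'b::real_normed_vector) \<Rightarrow> bool" where
  "lip0 f \<longleftrightarrow> (\<exists>L d. 0 < d \<and> 0 \<le> L \<and>
     (\<forall>x y. norm x \<le> d \<longrightarrow> norm y \<le> d \<longrightarrow> norm (f x - f y) \<le> L * norm (x - y)))"

lemma lip0_E:
  assumes "lip0 f"
  obtains L d B where "0 < d" "0 \<le> L" "0 \<le> B"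
    "\<And>x y. norm x \<le> d \<Longrightarrow> norm y \<le> d \<Longrightarrow> norm (f x - f y) \<le> L * norm (x - y)"
    "\<And>x. norm x \<le> d \<Longrightarrow> norm (f x) \<le> B"
proof -
  obtain L d where Ld: "0 < d" "0 \<le> L"
    "\<And>x y. norm x \<le> d \<Longrightarrow> norm y \<le> d \<Longrightarrow> norm (f x - f y) \<le> L * norm (x - y)"
    using assms unfolding lip0_def by blast
  have "norm (f x) \<le> norm (f 0) + L * d" if "norm x \<le> d" for x
  proof -
    have "norm (f x - f 0) \<le> L * norm x" using Ld(3)[of x 0] Ld(1) that by simp
    also have "\<dots> \<le> L * d" using that Ld(2) by (rule mult_left_mono)
    finally show ?thesis using norm_triangle_sub[of "f x" "f 0"] by linarith
  qed
  with Ld that[of d L "norm (f 0) + L * d"] show ?thesis by auto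
qed

lemma lip0_const: "lip0 (\<lambda>x. c)"
  unfolding lip0_def by (intro exI[of _ 0] exI[of _ 1]) auto

lemma lip0_linear:
  assumes "bounded_linear f"
  shows "lip0 f"
proof -
  interpret bounded_linear f by fact
  obtain K where K: "0 \<le> K" "\<And>x. norm (f x) \<le> norm x * K" using nonneg_bounded by blast
  show ?thesis unfolding lip0_def
    by (intro exI[of _ K] exI[of _ 1]) (use K in \<open>auto simp: diff[symmetric] mult.commute\<close>)
qed

lemma lip0_add:
  assumes "lip0 f" "lip0 g" shows "lip0 (\<lambda>x. f x + g x)"
proof -
  obtain L d B where f: "0 < d" "0 \<le> L" "0 \<le> B"
    "\<And>x y. norm x \<le> d \<Longrightarrow> norm y \<le> d \<Longrightarrow> norm (f x - f y) \<le> L * norm (x - y)"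
    "\<And>x. norm x \<le> d \<Longrightarrow> norm (f x) \<le> B"
    using lip0_E[OF assms(1)] by metis
  obtain L' d' B' where g: "0 < d'" "0 \<le> L'" "0 \<le> B'"
    "\<And>x y. norm x \<le> d' \<Longrightarrow> norm y \<le> d' \<Longrightarrow> norm (g x - g y) \<le> L' * norm (x - y)"
    "\<And>x. norm x \<le> d' \<Longrightarrow> norm (g x) \<le> B'"
    using lip0_E[OF assms(2)] by metis
  have "norm (f x + g x - (f y + g y)) \<le> (L + L') * norm (x - y)"
    if "norm x \<le> min d d'" "norm y \<le> min d d'" for x y
    using f(4)[of x y] g(4)[of x y] that norm_diff_triangle_ineq[of "f x" "g x" "f y" "g y"]
    by (simp add: distrib_right)
  then show ?thesis unfolding lip0_def
    using f g by (intro exI[of _ "L + L'"] exI[of _ "min d d'"]) auto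
qed

lemma lip0_mult:
  fixes f g :: "'a::real_normed_vector \<Rightarrow> 'b::real_normed_algebra"
  assumes "lip0 f" "lip0 g" shows "lip0 (\<lambda>x. f x * g x)"
proof -
  obtain L d B where f: "0 < d" "0 \<le> L" "0 \<le> B"
    "\<And>x y. norm x \<le> d \<Longrightarrow> norm y \<le> d \<Longrightarrow> norm (f x - f y) \<le> L * norm (x - y)"
    "\<And>x. norm x \<le> d \<Longrightarrow> norm (f x) \<le> B"
    using lip0_E[OF assms(1)] by metis
  obtain L' d' B' where g: "0 < d'" "0 \<le> L'" "0 \<le> B'"
    "\<And>x y. norm x \<le> d' \<Longrightarrow> norm y \<le> d' \<Longrightarrow> norm (g x - g y) \<le> L' * norm (x - y)"
    "\<And>x. norm x \<le> d' \<Longrightarrow> norm (g x) \<le> B'"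
    using lip0_E[OF assms(2)] by metis
  have "norm (f x * g x - f y * g y) \<le> (L * B' + B * L') * norm (x - y)"
    if "norm x \<le> min d d'" "norm y \<le> min d d'" for x y
  proof -
    have "f x * g x - f y * g y = (f x - f y) * g x + f y * (g x - g y)"
      by (simp add: algebra_simps)
    also have "norm \<dots> \<le> norm (f x - f y) * norm (g x) + norm (f y) * norm (g x - g y)"
      by (intro norm_triangle_le add_mono norm_mult_ineq)
    also have "\<dots> \<le> (L * norm (x - y)) * B' + B * (L' * norm (x - y))"
      using that f g by (intro add_mono mult_mono) auto
    finally show ?thesis by (simp add: algebra_simps)
  qed
  then show ?thesis unfolding lip0_def
    using f g by (intro exI[of _ "L * B' + B * L'"] exI[of _ "min d d'"]) auto
qed

lemma lip0_exp:
  fixes f :: "'a::real_normed_vector \<Rightarrow> 'b::{comm_ring_1,real_normed_algebra_1,banach}"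
  assumes "lip0 f" shows "lip0 (\<lambda>x. exp (f x))"
proof -
  obtain L d B where f: "0 < d" "0 \<le> L" "0 \<le> B"
    "\<And>x y. norm x \<le> d \<Longrightarrow> norm y \<le> d \<Longrightarrow> norm (f x - f y) \<le> L * norm (x - y)"
    "\<And>x. norm x \<le> d \<Longrightarrow> norm (f x) \<le> B"
    using lip0_E[OF assms(1)] by metis
  have "norm (exp (f x) - exp (f y)) \<le> (exp B * (exp (2 * B) * L)) * norm (x - y)"
    if "norm x \<le> d" "norm y \<le> d" for x y
  proof -
    define e where "e = f x - f y"
    have e: "norm e \<le> 2 * B"
      using f(5)[OF that(1)] f(5)[OF that(2)] norm_triangle_ineq4[of "f x" "f y"] by (simp add: e_def)
    have "exp (f x) = exp (f y) * exp e"
      by (simp add: e_def exp_add_commuting[symmetric] mult.commute)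
    then have "norm (exp (f x) - exp (f y)) = norm (exp (f y) * (exp e - 1))"
      by (simp add: algebra_simps)
    also have "\<dots> \<le> norm (exp (f y)) * norm (exp e - 1)" by (rule norm_mult_ineq)
    also have "\<dots> \<le> exp B * (exp (2 * B) * (L * norm (x - y)))"
    proof (rule mult_mono)
      show "norm (exp (f y)) \<le> exp B"
        using norm_exp[of "f y"] f(5)[OF that(2)] by (meson exp_le_cancel_iff order_trans)
      have "norm (exp e - 1) \<le> norm e * exp (norm e)"
        using norm_exp_minus_one_minus_le(1)[of e] real_exp_minus_one_le[of "norm e"] by simp
      also have "\<dots> \<le> (L * norm (x - y)) * exp (2 * B)"
        using e f that by (intro mult_mono) (auto simp: e_def)
      finally show "norm (exp e - 1) \<le> exp (2 * B) * (L * norm (x - y))" by (simp add: mult.commute)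
    qed auto
    finally show ?thesis by (simp add: mult.assoc)
  qed
  then show ?thesis unfolding lip0_def
    using f by (intro exI[of _ "exp B * (exp (2 * B) * L)"] exI[of _ d]) auto
qed

lemma lip0_sum:
  assumes "finite I" "\<And>i. i \<in> I \<Longrightarrow> lip0 (f i)"
  shows "lip0 (\<lambda>x. \<Sum>i\<in>I. f i x)"
  using assms by (induction I) (auto intro: lip0_const lip0_add)

lemma lip0_power:
  fixes f :: "'a::real_normed_vector \<Rightarrow> 'b::real_normed_algebra_1"
  assumes "lip0 f" shows "lip0 (\<lambda>x. f x ^ n)"
  by (induction n) (auto intro: lip0_const lip0_mult assms)

lemma lip0_scaleR: "lip0 f \<Longrightarrow> lip0 (\<lambda>x. c *\<^sub>R f x)"
  unfolding lip0_def
proof (elim exE conjE)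
  fix L d
  assume "0 < d" "0 \<le> L"
    and *: "\<forall>x y. norm x \<le> d \<longrightarrow> norm y \<le> d \<longrightarrow> norm (f x - f y) \<le> L * norm (x - y)"
  then show "\<exists>L d. 0 < d \<and> 0 \<le> L \<and>
     (\<forall>x y. norm x \<le> d \<longrightarrow> norm y \<le> d \<longrightarrow> norm (c *\<^sub>R f x - c *\<^sub>R f y) \<le> L * norm (x - y))"
    by (intro exI[of _ "\<bar>c\<bar> * L"] exI[of _ d])
       (auto simp: scaleR_diff_right[symmetric] mult.assoc intro!: mult_left_mono)
qed

lemma lip0_minus: "lip0 f \<Longrightarrow> lip0 (\<lambda>x. - f x)"
  using lip0_scaleR[of f "- 1"] by simp

lemma lip0_diff: "lip0 f \<Longrightarrow> lip0 g \<Longrightarrow> lip0 (\<lambda>x. f x - g x)"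
  using lip0_add[of f "\<lambda>x. - g x"] lip0_minus[of g] by simp

subsection \<open>Strict differentiability\<close>

text \<open>Strict differentiability at the origin with the identity as derivative: the comparison of two
  arbitrary points near \<open>0\<close>, and not only of a point with \<open>0\<close>, is what a contraction estimate uses.\<close>

definition strict_id0 :: "('a::real_normed_vector \<Rightarrow> 'a) \<Rightarrow> bool" where
  "strict_id0 f \<longleftrightarrow> f 0 = 0 \<and> (\<forall>e>0. \<exists>d>0. \<forall>x y. norm x \<le> d \<longrightarrow> norm y \<le> d \<longrightarrow>
     norm (f x - f y - (x - y)) \<le> e * norm (x - y))"

text \<open>With \<open>h = x - y\<close>, the error equals \<open>e\<^sup>y (e\<^sup>h - 1 - h) + (e\<^sup>y - 1) h\<close>, and both
  terms are small multiples of \<open>h\<close>.\<close>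

lemma strict_id0_exp: "strict_id0 (\<lambda>x::'a::{comm_ring_1,real_normed_algebra_1,banach}. exp x - 1)"
  unfolding strict_id0_def
proof (intro conjI allI impI)
  fix e :: real assume e: "0 < e"
  have "((\<lambda>d. exp d * (exp (2 * d) - 1) + (exp d - 1)) \<longlongrightarrow> exp 0 * (exp (2 * 0) - 1) + (exp 0 - 1)) (at_right (0::real))"
    by (intro tendsto_intros)
  then have "\<forall>\<^sub>F d in at_right (0::real). exp d * (exp (2 * d) - 1) + (exp d - 1) < e"
    using e by (intro order_tendstoD(2)) auto
  then have "\<forall>\<^sub>F d in at_right (0::real). exp d * (exp (2 * d) - 1) + (exp d - 1) < e \<and> 0 < d"
    using eventually_at_right_less by (rule eventually_conj)
  then obtain d where d: "0 < d" "exp d * (exp (2 * d) - 1) + (exp d - 1) < e"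
    using eventually_happens'[OF trivial_limit_at_right_real] by blast
  show "\<exists>d>0. \<forall>x y::'a. norm x \<le> d \<longrightarrow> norm y \<le> d \<longrightarrow>
     norm (exp x - 1 - (exp y - 1) - (x - y)) \<le> e * norm (x - y)"
  proof (intro exI[of _ d] conjI allI impI)
    fix x y :: 'a assume xy: "norm x \<le> d" "norm y \<le> d"
    define h where "h = x - y"
    have h: "norm h \<le> 2 * d" using xy norm_triangle_ineq4[of x y] by (simp add: h_def)
    have "exp x = exp y * exp h"
      by (simp add: h_def exp_add_commuting[symmetric] mult.commute)
    then have "exp x - 1 - (exp y - 1) - (x - y) = exp y * (exp h - 1 - h) + (exp y - 1) * h"
      by (simp add: algebra_simps h_def)
    also have "norm \<dots> \<le> norm (exp y) * norm (exp h - 1 - h) + norm (exp y - 1) * norm h"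
      by (intro norm_triangle_le add_mono norm_mult_ineq)
    also have "\<dots> \<le> exp d * (norm h * (exp (2 * d) - 1)) + (exp d - 1) * norm h"
    proof (intro add_mono mult_mono)
      have *: "exp (norm y) \<le> exp d" using xy by simp
      show "norm (exp y) \<le> exp d" using norm_exp[of y] * by linarith
      show "norm (exp y - 1) \<le> exp d - 1" using norm_exp_minus_one_minus_le(1)[of y] * by linarith
      have "norm h * (exp (norm h) - 1) \<le> norm h * (exp (2 * d) - 1)"
        using h by (intro mult_left_mono) auto
      then show "norm (exp h - 1 - h) \<le> norm h * (exp (2 * d) - 1)"
        using norm_exp_minus_one_minus_le(2)[of h] real_exp_minus_one_minus_le[of "norm h"] by simp
    qed (use d in auto)
    also have "\<dots> = (exp d * (exp (2 * d) - 1) + (exp d - 1)) * norm h" by (simp add: algebra_simps)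
    also have "\<dots> \<le> e * norm h" using d by (intro mult_right_mono) auto
    finally show "norm (exp x - 1 - (exp y - 1) - (x - y)) \<le> e * norm (x - y)" by (simp add: h_def)
  qed (use d in auto)
qed auto

lemma strict_id0_rescale:
  assumes "strict_id0 f" "t \<noteq> 0"
  shows "strict_id0 (\<lambda>x. (1 / t) *\<^sub>R f (t *\<^sub>R x))"
  unfolding strict_id0_def
proof (intro conjI allI impI)
  show "(1 / t) *\<^sub>R f (t *\<^sub>R 0) = 0" using assms by (simp add: strict_id0_def)
  fix e :: real assume "0 < e"
  then obtain d where d: "0 < d" "\<And>x y. norm x \<le> d \<Longrightarrow> norm y \<le> d \<Longrightarrow>
     norm (f x - f y - (x - y)) \<le> e * norm (x - y)"
    using assms(1) unfolding strict_id0_def by meson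
  show "\<exists>d>0. \<forall>x y. norm x \<le> d \<longrightarrow> norm y \<le> d \<longrightarrow>
     norm ((1 / t) *\<^sub>R f (t *\<^sub>R x) - (1 / t) *\<^sub>R f (t *\<^sub>R y) - (x - y)) \<le> e * norm (x - y)"
  proof (intro exI[of _ "d / \<bar>t\<bar>"] conjI allI impI)
    fix x y :: 'a assume xy: "norm x \<le> d / \<bar>t\<bar>" "norm y \<le> d / \<bar>t\<bar>"
    have "(1 / t) *\<^sub>R f (t *\<^sub>R x) - (1 / t) *\<^sub>R f (t *\<^sub>R y) - (x - y)
      = (1 / t) *\<^sub>R (f (t *\<^sub>R x) - f (t *\<^sub>R y) - (t *\<^sub>R x - t *\<^sub>R y))"
      using assms(2) by (simp add: algebra_simps)
    also have "norm \<dots> = (1 / \<bar>t\<bar>) * norm (f (t *\<^sub>R x) - f (t *\<^sub>R y) - (t *\<^sub>R x - t *\<^sub>R y))"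
      by simp
    also have "\<dots> \<le> (1 / \<bar>t\<bar>) * (e * norm (t *\<^sub>R x - t *\<^sub>R y))"
      using xy assms(2) by (intro mult_left_mono d(2)) (auto simp: field_simps)
    also have "\<dots> = e * norm (x - y)"
      using assms(2) by (simp add: scaleR_diff_right[symmetric])
    finally show "norm ((1 / t) *\<^sub>R f (t *\<^sub>R x) - (1 / t) *\<^sub>R f (t *\<^sub>R y) - (x - y)) \<le> e * norm (x - y)" .
  qed (use d assms in auto)
qed

lemma strict_id0_compose:
  assumes "strict_id0 f" "strict_id0 g"
  shows "strict_id0 (\<lambda>x. f (g x))"
  unfolding strict_id0_def
proof (intro conjI allI impI)
  show "f (g 0) = 0" using assms by (simp add: strict_id0_def)
  fix e :: real assume e: "0 < e"
  \<comment> \<open>Composing two maps with relative error \<open>a \<le> 1\<close> gives at most \<open>2 a + a\<close>.\<close>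
  define a where "a = min 1 (e / 3)"
  have a: "0 < a" "a \<le> 1" "3 * a \<le> e" using e by (auto simp: a_def)
  obtain d where d: "0 < d" "\<And>x y. norm x \<le> d \<Longrightarrow> norm y \<le> d \<Longrightarrow>
     norm (f x - f y - (x - y)) \<le> a * norm (x - y)"
    using assms(1) a unfolding strict_id0_def by meson
  obtain d' where d': "0 < d'" "\<And>x y. norm x \<le> d' \<Longrightarrow> norm y \<le> d' \<Longrightarrow>
     norm (g x - g y - (x - y)) \<le> a * norm (x - y)"
    using assms(2) a unfolding strict_id0_def by meson
  have g2: "norm (g x - g y) \<le> 2 * norm (x - y)" if "norm x \<le> d'" "norm y \<le> d'" for x y
  proof -
    have "norm (g x - g y) \<le> norm (x - y) + norm (g x - g y - (x - y))" by (rule norm_triangle_sub)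
    also have "\<dots> \<le> norm (x - y) + 1 * norm (x - y)"
      using d'(2)[OF that] mult_right_mono[OF a(2), of "norm (x - y)"] by simp
    finally show ?thesis by simp
  qed
  show "\<exists>d>0. \<forall>x y. norm x \<le> d \<longrightarrow> norm y \<le> d \<longrightarrow>
     norm (f (g x) - f (g y) - (x - y)) \<le> e * norm (x - y)"
  proof (intro exI[of _ "min d' (d / 2)"] conjI allI impI)
    fix x y :: 'a assume xy: "norm x \<le> min d' (d / 2)" "norm y \<le> min d' (d / 2)"
    have g0: "g 0 = 0" using assms by (simp add: strict_id0_def)
    have gb: "norm (g x) \<le> d" "norm (g y) \<le> d"
      using g2[of x 0] g2[of y 0] xy d' by (auto simp: g0)
    have "norm (f (g x) - f (g y) - (x - y)) =
       norm ((f (g x) - f (g y) - (g x - g y)) + (g x - g y - (x - y)))" by (simp add: algebra_simps)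
    also have "\<dots> \<le> a * norm (g x - g y) + a * norm (x - y)"
      using xy by (intro norm_triangle_le add_mono d gb d') auto
    also have "\<dots> \<le> a * (2 * norm (x - y)) + a * norm (x - y)"
      using a xy by (intro add_mono mult_left_mono g2) auto
    also have "\<dots> = (3 * a) * norm (x - y)" by simp
    also have "\<dots> \<le> e * norm (x - y)" using a by (intro mult_right_mono) auto
    finally show "norm (f (g x) - f (g y) - (x - y)) \<le> e * norm (x - y)" .
  qed (use d d' in auto)
qed

subsection \<open>Solving the boundary equation\<close>

text \<open>The closed form of the integral of \<open>s\<^sup>k exp (- pi s)\<close> over \<open>[0, x]\<close>, minus \<open>lam\<close> times the
  integral over the half-line. In this form it makes sense in every Banach algebra.\<close>

definition inc_gamma :: "real \<Rightarrow> nat \<Rightarrow> 'a \<Rightarrow> 'a::{real_normed_algebra_1,banach}" where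
  "inc_gamma lam k x = (fact k / pi ^ (k + 1)) *\<^sub>R
     ((1 - lam) *\<^sub>R 1 - exp (- (pi *\<^sub>R x)) * (\<Sum>j\<le>k. (pi ^ j / fact j) *\<^sub>R x ^ j))"

text \<open>The sum over \<open>k\<close> of \<open>F k z\<^sup>-\<^sup>k (\<gamma>\<^sub>k (\<bar>z\<bar>\<^sup>2) - lam k! / pi\<^sup>k\<^sup>+\<^sup>1)\<close> on the curve \<open>z = r w exp (p w)\<close>,
  \<open>\<bar>w\<bar> = 1\<close>, as an element of the algebra; \<open>\<gamma>\<^sub>k\<close> is the incomplete Gamma integral.\<close>

definition boundary_fun :: "real \<Rightarrow> nat \<Rightarrow> real \<Rightarrow> (nat \<Rightarrow> complex) \<Rightarrow> wiener \<Rightarrow> wiener" where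
  "boundary_fun lam N r F p = (\<Sum>k\<le>N. laurent_monom (- int k) (F k / of_real r ^ k) * exp (- (real k *\<^sub>R p)) *
     inc_gamma lam k (r\<^sup>2 *\<^sub>R exp (p + star p)))"

lemma bounded_linear_star: "bounded_linear star"
proof (rule bounded_linear_intro[where K = 1])
  show "star (r *\<^sub>R a) = r *\<^sub>R star a" for r a
    by (rule wiener_eqI) simp
qed (simp_all add: star_add)

text \<open>Write \<open>u = p + star p\<close>. For \<open>F = 1\<close> the boundary function depends on \<open>u\<close> alone, vanishes at
  \<open>u = 0\<close> by the choice of \<open>r\<close>, and has there the derivative \<open>c u\<close> with \<open>c = r\<^sup>2 exp (- pi r\<^sup>2) > 0\<close>.
  Hence \<open>T p = analytic_fold (u - boundary_fun p / c)\<close> has Lipschitz constant at most \<open>1/4\<close> near \<open>0\<close>, and the terms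
  with \<open>k \<ge> 1\<close> contribute at most another \<open>1/4\<close> when the coefficients \<open>F k\<close> are small. A fixed point
  satisfies \<open>p = analytic_fold (p + star p)\<close>, so that \<open>analytic_fold (boundary_fun p) = 0\<close>.\<close>

lemma boundary_fun_solution:
  assumes r: "0 < r" "1 - exp (- pi * r\<^sup>2) = lam" and \<eta>: "0 < \<eta>"
  shows "\<exists>\<epsilon>>0. \<forall>F. F 0 = 1 \<longrightarrow> (\<forall>k\<in>{1..N}. cmod (F k) < \<epsilon>) \<longrightarrow>
    (\<exists>p. norm p \<le> \<eta> \<and> (\<forall>n<0. coef p n = 0) \<and>
       (\<forall>n<0. coef (boundary_fun lam N r F p) n = 0) \<and> Re (coef (boundary_fun lam N r F p) 0) = 0)"
proof -
  define c where "c = r\<^sup>2 * exp (- pi * r\<^sup>2)"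
  define b where "b = pi * r\<^sup>2"
  have c: "0 < c" and b: "0 < b" using r by (auto simp: c_def b_def)
  define B where "B k p = exp (- (real k *\<^sub>R p)) * inc_gamma lam k (r\<^sup>2 *\<^sub>R exp (p + star p))" for k p
  \<comment> \<open>The boundary function for \<open>F = 1\<close>, scaled to have derivative \<open>1\<close>; it is a composition of two maps \<open>exp - 1\<close>.\<close>
  define g where "g u = (1 / c) *\<^sub>R (inc_gamma lam 0 (r\<^sup>2 *\<^sub>R exp u) :: wiener)" for u
  have g_eq: "g u = (1 / - b) *\<^sub>R (exp (- b *\<^sub>R (exp u - 1)) - 1)" for u
  proof -
    have "exp (- (pi *\<^sub>R r\<^sup>2 *\<^sub>R exp u)) = exp (- b *\<^sub>R (exp u - 1) + of_real (- b))"
      by (simp add: b_def algebra_simps of_real_def)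
    also have "\<dots> = exp (- b *\<^sub>R (exp u - 1)) * exp (of_real (- b))"
      by (rule exp_add_commuting) (simp add: mult.commute)
    also have "exp (of_real (- b)) = of_real (exp (- b))"
      by (rule exp_of_real)
    finally have "exp (- (pi *\<^sub>R r\<^sup>2 *\<^sub>R exp u)) = exp (- b) *\<^sub>R exp (- b *\<^sub>R (exp u - 1))"
      by (simp add: of_real_def)
    moreover have "1 - lam = exp (- b)" using r by (simp add: b_def)
    moreover have "(1 / c) * (1 / pi) * exp (- b) = 1 / b"
      using r by (simp add: c_def b_def)
    ultimately have "g u = (1 / c) *\<^sub>R (1 / pi) *\<^sub>R (exp (- b) *\<^sub>R 1 - exp (- b) *\<^sub>R exp (- b *\<^sub>R (exp u - 1)))"
      unfolding g_def inc_gamma_def by simp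
    also have "\<dots> = ((1 / c) * (1 / pi) * exp (- b)) *\<^sub>R (1 - exp (- b *\<^sub>R (exp u - 1)))"
      by (simp only: scaleR_diff_right scaleR_scaleR mult.assoc)
    also have "\<dots> = (1 / b) *\<^sub>R (1 - exp (- b *\<^sub>R (exp u - 1)))"
      by (simp only: \<open>(1 / c) * (1 / pi) * exp (- b) = 1 / b\<close>)
    finally show ?thesis by (simp add: scaleR_diff_right)
  qed
  have g0: "strict_id0 g"
    using strict_id0_compose[OF strict_id0_rescale[OF strict_id0_exp, of "- b"] strict_id0_exp[where 'a = wiener]] b
    unfolding g_eq[abs_def] by simp
  have lipB: "lip0 (B k)" for k
  proof -
    have 1: "lip0 (\<lambda>p. exp (- (real k *\<^sub>R p)) :: wiener)"
      unfolding scaleR_minus_left[symmetric]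
      by (intro lip0_exp lip0_linear bounded_linear_scaleR_right)
    have 2: "lip0 (\<lambda>p. r\<^sup>2 *\<^sub>R exp (p + star p))"
      by (intro lip0_scaleR lip0_exp lip0_add lip0_linear bounded_linear_star bounded_linear_ident)
    have 3: "lip0 (\<lambda>p. inc_gamma lam k (r\<^sup>2 *\<^sub>R exp (p + star p)))"
      unfolding inc_gamma_def
      by (intro lip0_scaleR lip0_diff lip0_minus lip0_const lip0_mult lip0_exp lip0_sum lip0_power 2 finite_atMost)
    show ?thesis unfolding B_def[abs_def] by (rule lip0_mult[OF 1 3])
  qed
  have "\<exists>L d. 0 < d \<and> 0 \<le> L \<and> (\<forall>x y. norm x \<le> d \<longrightarrow> norm y \<le> d \<longrightarrow>
      norm (B k x - B k y) \<le> L * norm (x - y))" for k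
    using lipB unfolding lip0_def by blast
  then obtain L D where LD: "\<And>k. 0 < D k" "\<And>k. 0 \<le> L k"
    "\<And>k x y. norm x \<le> D k \<Longrightarrow> norm y \<le> D k \<Longrightarrow> norm (B k x - B k y) \<le> L k * norm (x - y)"
    by metis
  obtain d0 where d0: "0 < d0" "\<And>x y. norm x \<le> d0 \<Longrightarrow> norm y \<le> d0 \<Longrightarrow>
     norm (g x - g y - (x - y)) \<le> (1/8) * norm (x - y)"
    using g0 unfolding strict_id0_def by (meson zero_less_divide_1_iff zero_less_numeral)
  \<comment> \<open>The ball on which all the local estimates hold.\<close>
  define dl where "dl = Min (insert \<eta> (insert (d0 / 2) (D ` {..N})))"
  have dl: "0 < dl" "dl \<le> \<eta>" "2 * dl \<le> d0" "\<And>k. k \<le> N \<Longrightarrow> dl \<le> D k"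
  proof -
    show "0 < dl" using \<eta> d0(1) LD(1) by (auto simp: dl_def)
    show "dl \<le> \<eta>" unfolding dl_def by (intro Min_le) auto
    show "dl \<le> D k" if "k \<le> N" for k
      unfolding dl_def using that by (intro Min_le) auto
    have "dl \<le> d0 / 2" unfolding dl_def by (intro Min_le) auto
    then show "2 * dl \<le> d0" by simp
  qed
  \<comment> \<open>The norm of the coefficient of \<open>B k\<close>, divided by \<open>c\<close>, per unit of \<open>F k\<close>; \<open>2 ^ k\<close> is the weight of \<open>w\<^sup>-\<^sup>k\<close>.\<close>
  define q where "q k = (2 / r) ^ k / c" for k
  have q: "0 < q k" for k using r c by (simp add: q_def)
  define K where "K = (\<Sum>k\<in>{1..N}. q k * L k) + (\<Sum>k\<in>{1..N}. q k * norm (B k 0)) + 1"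
  have K: "1 \<le> K" "(\<Sum>k\<in>{1..N}. q k * L k) \<le> K" "(\<Sum>k\<in>{1..N}. q k * norm (B k 0)) \<le> K"
  proof -
    have "0 \<le> (\<Sum>k\<in>{1..N}. q k * L k)" "0 \<le> (\<Sum>k\<in>{1..N}. q k * norm (B k 0))"
      using q LD(2) by (auto intro!: sum_nonneg mult_nonneg_nonneg simp: less_imp_le)
    then show "1 \<le> K" "(\<Sum>k\<in>{1..N}. q k * L k) \<le> K" "(\<Sum>k\<in>{1..N}. q k * norm (B k 0)) \<le> K"
      by (auto simp: K_def)
  qed
  define \<epsilon> where "\<epsilon> = min (1/4) (dl / 2) / K"
  have \<epsilon>: "0 < \<epsilon>" "\<epsilon> * K \<le> 1/4" "\<epsilon> * K \<le> dl / 2" using dl(1) K(1) by (auto simp: \<epsilon>_def)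
  show ?thesis
  proof (intro exI[of _ \<epsilon>] conjI allI impI)
    show "0 < \<epsilon>" by fact
    fix F assume F0: "F 0 = 1" and F: "\<forall>k\<in>{1..N}. cmod (F k) < \<epsilon>"
    define C where "C k = laurent_monom (- int k) (F k / of_real r ^ k)" for k
    have normC: "(1 / c) * norm (C k) \<le> \<epsilon> * q k" if "k \<in> {1..N}" for k
    proof -
      have "(1 / c) * norm (C k) = cmod (F k) * q k"
        using r by (simp add: C_def norm_laurent_monom wt_def q_def norm_divide norm_power power_divide)
      then show ?thesis using F that q[of k] by (simp add: less_imp_le)
    qed
    have boundary_fun_eq: "(1 / c) *\<^sub>R boundary_fun lam N r F p = g (p + star p) + (\<Sum>k\<in>{1..N}. (1 / c) *\<^sub>R (C k * B k p))" for p
    proof -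
      have "{..N} = insert 0 {1..N}" by auto
      then have "boundary_fun lam N r F p = C 0 * B 0 p + (\<Sum>k\<in>{1..N}. C k * B k p)"
        by (simp add: boundary_fun_def C_def B_def mult.assoc)
      moreover have "C 0 = 1" by (simp add: C_def F0 one_eq_laurent_monom)
      ultimately show ?thesis
        by (simp add: B_def g_def scaleR_add_right scaleR_sum_right)
    qed
    \<comment> \<open>Fixed points of \<open>T\<close> are the solutions.\<close>
    define T where "T p = analytic_fold (p + star p - (1 / c) *\<^sub>R boundary_fun lam N r F p)" for p
    have lipT: "norm (T x - T y) \<le> (1/2) * norm (x - y)" if xy: "norm x \<le> dl" "norm y \<le> dl" for x y
    proof -
      define u v where "u = x + star x" and "v = y + star y"
      have uv: "norm u \<le> d0" "norm v \<le> d0" "norm (u - v) \<le> 2 * norm (x - y)"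
      proof -
        show "norm u \<le> d0" "norm v \<le> d0"
          using norm_triangle_ineq[of x "star x"] norm_triangle_ineq[of y "star y"] xy dl
          by (auto simp: u_def v_def)
        have "u - v = (x - y) + star (x - y)" by (simp add: u_def v_def star_diff)
        then show "norm (u - v) \<le> 2 * norm (x - y)"
          using norm_triangle_ineq[of "x - y" "star (x - y)"] by simp
      qed
      have "T x - T y = analytic_fold (- (g u - g v - (u - v)) - (\<Sum>k\<in>{1..N}. (1 / c) *\<^sub>R (C k * (B k x - B k y))))"
      proof -
        define S where "S z = (\<Sum>k\<in>{1..N}. (1 / c) *\<^sub>R (C k * B k z))" for z
        have S: "(\<Sum>k\<in>{1..N}. (1 / c) *\<^sub>R (C k * (B k x - B k y))) = S x - S y"
          by (simp only: S_def sum_subtractf scaleR_diff_right right_diff_distrib)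
        have "T x - T y = analytic_fold ((u - (g u + S x)) - (v - (g v + S y)))"
          by (simp only: T_def boundary_fun_eq analytic_fold_diff u_def v_def S_def)
        also have "(u - (g u + S x)) - (v - (g v + S y)) = - (g u - g v - (u - v)) - (S x - S y)"
          by simp
        finally show ?thesis by (simp only: S)
      qed
      also have "norm \<dots> \<le> norm (- (g u - g v - (u - v)) - (\<Sum>k\<in>{1..N}. (1 / c) *\<^sub>R (C k * (B k x - B k y))))"
        by (rule norm_analytic_fold_le)
      also have "\<dots> \<le> norm (g u - g v - (u - v)) + norm (\<Sum>k\<in>{1..N}. (1 / c) *\<^sub>R (C k * (B k x - B k y)))"
        by (rule order.trans[OF norm_triangle_ineq4]) (simp only: norm_minus_cancel order.refl)
      also have "\<dots> \<le> (1/8) * (2 * norm (x - y)) + (1/4) * norm (x - y)"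
      proof (rule add_mono)
        show "norm (g u - g v - (u - v)) \<le> (1/8) * (2 * norm (x - y))"
          using d0(2)[OF uv(1,2)] uv(3) by simp
        have "norm (\<Sum>k\<in>{1..N}. (1 / c) *\<^sub>R (C k * (B k x - B k y)))
          \<le> (\<Sum>k\<in>{1..N}. (\<epsilon> * q k) * (L k * norm (x - y)))"
        proof (rule sum_norm_le)
          fix k assume k: "k \<in> {1..N}"
          have "norm ((1 / c) *\<^sub>R (C k * (B k x - B k y))) \<le> (1 / c) * (norm (C k) * norm (B k x - B k y))"
            using c norm_mult_ineq[of "C k" "B k x - B k y"] by (simp add: divide_right_mono)
          also have "\<dots> = ((1 / c) * norm (C k)) * norm (B k x - B k y)" by simp
          also have "\<dots> \<le> (\<epsilon> * q k) * (L k * norm (x - y))"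
            using LD(3)[of x k y] xy dl(4)[of k] k \<epsilon>(1) q[of k]
            by (intro mult_mono normC) (auto simp: less_imp_le)
          finally show "norm ((1 / c) *\<^sub>R (C k * (B k x - B k y))) \<le> (\<epsilon> * q k) * (L k * norm (x - y))" .
        qed
        also have "\<dots> = \<epsilon> * (\<Sum>k\<in>{1..N}. q k * L k) * norm (x - y)"
          by (simp add: sum_distrib_left sum_distrib_right mult.assoc)
        also have "\<dots> \<le> \<epsilon> * K * norm (x - y)"
          using \<epsilon>(1) K(2) by (intro mult_right_mono mult_left_mono) auto
        also have "\<dots> \<le> (1/4) * norm (x - y)"
          using \<epsilon>(2) by (intro mult_right_mono) auto
        finally show "norm (\<Sum>k\<in>{1..N}. (1 / c) *\<^sub>R (C k * (B k x - B k y))) \<le> (1/4) * norm (x - y)" .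
      qed
      finally show ?thesis by simp
    qed
    have T0: "norm (T 0) \<le> dl / 2"
    proof -
      have "star 0 = 0" by (rule wiener_eqI) simp
      moreover have "g 0 = 0" using g0 by (simp add: strict_id0_def)
      ultimately have "T 0 = analytic_fold (- (\<Sum>k\<in>{1..N}. (1 / c) *\<^sub>R (C k * B k 0)))"
        unfolding T_def boundary_fun_eq by simp
      also have "norm \<dots> \<le> norm (\<Sum>k\<in>{1..N}. (1 / c) *\<^sub>R (C k * B k 0))"
        by (rule order.trans[OF norm_analytic_fold_le]) (simp only: norm_minus_cancel order.refl)
      also have "\<dots> \<le> (\<Sum>k\<in>{1..N}. (\<epsilon> * q k) * norm (B k 0))"
      proof (rule sum_norm_le)
        fix k assume k: "k \<in> {1..N}"
        have "norm ((1 / c) *\<^sub>R (C k * B k 0)) \<le> (1 / c) * (norm (C k) * norm (B k 0))"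
          using c norm_mult_ineq[of "C k" "B k 0"] by (simp add: divide_right_mono)
        also have "\<dots> = ((1 / c) * norm (C k)) * norm (B k 0)" by simp
        also have "\<dots> \<le> (\<epsilon> * q k) * norm (B k 0)"
          using k by (intro mult_right_mono normC) auto
        finally show "norm ((1 / c) *\<^sub>R (C k * B k 0)) \<le> (\<epsilon> * q k) * norm (B k 0)" .
      qed
      also have "\<dots> = \<epsilon> * (\<Sum>k\<in>{1..N}. q k * norm (B k 0))"
        by (simp add: sum_distrib_left mult.assoc)
      also have "\<dots> \<le> \<epsilon> * K" using \<epsilon>(1) K(3) by (intro mult_left_mono) auto
      finally show ?thesis using \<epsilon>(3) by simp
    qed
    have "\<exists>!p\<in>cball 0 dl. T p = p"
    proof (rule Banach_fix[OF complete_eq_closed[THEN iffD2, OF closed_cball], where c = "1/2"])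
      show "T ` cball 0 dl \<subseteq> cball 0 dl"
      proof clarify
        fix x :: wiener assume "x \<in> cball 0 dl"
        then have x: "norm x \<le> dl" by simp
        have "norm (T x) \<le> norm (T x - T 0) + norm (T 0)"
          using norm_triangle_ineq[of "T x - T 0" "T 0"] by simp
        also have "\<dots> \<le> (1/2) * dl + dl / 2"
          using lipT[of x 0] x T0 dl(1) by (intro add_mono) auto
        finally show "T x \<in> cball 0 dl" by simp
      qed
      show "dist (T x) (T y) \<le> 1/2 * dist x y" if "x \<in> cball 0 dl" "y \<in> cball 0 dl" for x y
        using lipT[of x y] that by (simp add: dist_norm)
    qed (use dl in auto)
    then obtain p where p: "norm p \<le> dl" "T p = p" by auto
    have self: "analytic_fold (p + star p) = p"
      using analytic_fold_self_plus_star[of "p + star p - (1 / c) *\<^sub>R boundary_fun lam N r F p"] p(2)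
      unfolding T_def by simp
    then have "analytic_fold (boundary_fun lam N r F p) = 0"
      using p(2) c unfolding T_def analytic_fold_diff analytic_fold_scaleR by simp
    note B0 = analytic_fold_eq_0D[OF this]
    have neg: "\<forall>n<0. coef p n = 0"
      using coef_analytic_fold[of "p + star p"] unfolding self by simp
    show "\<exists>p. norm p \<le> \<eta> \<and> (\<forall>n<0. coef p n = 0) \<and>
       (\<forall>n<0. coef (boundary_fun lam N r F p) n = 0) \<and> Re (coef (boundary_fun lam N r F p) 0) = 0"
      using p(1) dl(2) B0 neg by (intro exI[of _ p]) simp
  qed
qed

section \<open>Green's formula on star-shaped domains\<close>

text \<open>Differentiating the exponential and the truncated exponential series gives two sums that cancel
  except for the top term.\<close>

lemma inc_gamma_has_field_derivative:
  fixes u :: complex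
  shows "(inc_gamma lam k has_field_derivative u ^ k * exp (- (pi * u))) (at u)"
proof -
  have S: "((\<lambda>u::complex. \<Sum>j\<le>k. (pi ^ j / fact j) *\<^sub>R u ^ j) has_field_derivative
      (\<Sum>j<k. pi * ((pi ^ j / fact j) *\<^sub>R u ^ j))) (at u)" for k
  proof (induction k)
    case 0
    show ?case by (auto intro!: derivative_eq_intros)
  next
    case (Suc k)
    have "((\<lambda>u::complex. (pi ^ Suc k / fact (Suc k)) *\<^sub>R u ^ Suc k) has_field_derivative
        (pi ^ Suc k / fact (Suc k)) *\<^sub>R (of_nat (Suc k) * u ^ k)) (at u)"
      unfolding scaleR_conv_of_real
      by (rule DERIV_cmult, rule DERIV_cong[OF DERIV_power[OF DERIV_ident]]) simp
    moreover have "(pi ^ Suc k / fact (Suc k)) *\<^sub>R (of_nat (Suc k) * u ^ k) = pi * ((pi ^ k / fact k) *\<^sub>R u ^ k)"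
      unfolding scaleR_conv_of_real by (simp add: field_simps del: of_nat_Suc)
    ultimately show ?case using DERIV_add[OF Suc] by simp
  qed
  have e: "((\<lambda>u::complex. exp (- (pi *\<^sub>R u))) has_field_derivative - (pi * exp (- (pi *\<^sub>R u)))) (at u)"
    unfolding scaleR_conv_of_real by (auto intro!: derivative_eq_intros)
  have c: "(\<Sum>j\<le>k. (pi ^ j / fact j) *\<^sub>R u ^ j) = (\<Sum>j<k. (pi ^ j / fact j) *\<^sub>R u ^ j) + (pi ^ k / fact k) *\<^sub>R u ^ k"
    by (simp add: lessThan_Suc_atMost[symmetric])
  have "(inc_gamma lam k has_field_derivative
     (fact k / pi ^ (k + 1)) *\<^sub>R (0 - (- (pi * exp (- (pi *\<^sub>R u))) * (\<Sum>j\<le>k. (pi ^ j / fact j) *\<^sub>R u ^ j)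
        + (\<Sum>j<k. pi * ((pi ^ j / fact j) *\<^sub>R u ^ j)) * exp (- (pi *\<^sub>R u))))) (at u)"
    unfolding inc_gamma_def[abs_def] scaleR_conv_of_real[of "fact k / pi ^ (k + 1)"]
    by (intro DERIV_cmult DERIV_diff DERIV_const DERIV_mult[OF e S, THEN DERIV_cong]) (simp add: mult.commute)
  moreover have "(fact k / pi ^ (k + 1)) *\<^sub>R (0 - (- (pi * exp (- (pi *\<^sub>R u))) * (\<Sum>j\<le>k. (pi ^ j / fact j) *\<^sub>R u ^ j)
        + (\<Sum>j<k. pi * ((pi ^ j / fact j) *\<^sub>R u ^ j)) * exp (- (pi *\<^sub>R u)))) = u ^ k * exp (- (pi * u))"
    unfolding c unfolding sum_distrib_left[symmetric] scaleR_conv_of_real by (simp add: field_simps)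
  ultimately show ?thesis by simp
qed

lemma continuous_on_inc_gamma:
  fixes f :: "'a::topological_space \<Rightarrow> complex"
  assumes "continuous_on A f"
  shows "continuous_on A (\<lambda>x. inc_gamma lam k (f x))"
proof (rule continuous_on_compose2[OF _ assms])
  show "continuous_on UNIV (inc_gamma lam k :: complex \<Rightarrow> complex)"
    by (rule continuous_at_imp_continuous_on) (auto intro: DERIV_isCont inc_gamma_has_field_derivative)
qed auto

lemma inc_gamma_0: "inc_gamma 0 k (0::complex) = 0"
proof -
  have "{..k} = insert 0 {1..k}" by auto
  moreover have "(\<Sum>j\<in>{1..k}. (pi ^ j / fact j) *\<^sub>R (0::complex) ^ j) = 0"
    by (rule sum.neutral) auto
  ultimately show ?thesis by (simp add: inc_gamma_def)
qed

lemma inc_gamma_shift: "inc_gamma 0 k x = inc_gamma lam k x + of_real (lam * fact k / pi ^ (k + 1))"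
  for x :: complex
  by (simp add: inc_gamma_def scaleR_conv_of_real algebra_simps)

text \<open>A zero of order \<open>k + 1\<close> at the origin, which outweighs the pole of order \<open>k\<close> in Green's formula
  when the inner boundary curve shrinks to a point.\<close>

lemma inc_gamma_of_real_bound:
  assumes "0 \<le> u"
  shows "cmod (inc_gamma 0 k (of_real u)) \<le> u ^ Suc k"
proof -
  have "cmod (inc_gamma 0 k (of_real u) - inc_gamma 0 k 0) \<le> u ^ k * cmod (of_real u - 0)"
  proof (rule field_differentiable_bound[where S = "closed_segment 0 (of_real u)"])
    fix z :: complex assume z: "z \<in> closed_segment 0 (of_real u)"
    then obtain v where v: "z = v *\<^sub>R of_real u" "0 \<le> v" "v \<le> 1"
      by (auto simp: in_segment)
    define t where "t = v * u"
    have t: "z = of_real t" "0 \<le> t" "t \<le> u"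
      using v assms by (auto simp: t_def scaleR_conv_of_real mult_left_le_one_le)
    show "(inc_gamma 0 k has_field_derivative z ^ k * exp (- (pi * z))) (at z within closed_segment 0 (of_real u))"
      by (rule has_field_derivative_at_within[OF inc_gamma_has_field_derivative])
    have "cmod (z ^ k * exp (- (pi * z))) = t ^ k * exp (- (pi * t))"
      using t by (simp add: norm_mult norm_power)
    also have "\<dots> \<le> u ^ k * 1" using t by (intro mult_mono power_mono) auto
    finally show "cmod (z ^ k * exp (- (pi * z))) \<le> u ^ k" by simp
  qed auto
  then show ?thesis using assms by (simp add: inc_gamma_0 mult.commute)
qed

text \<open>The dilations of a closed curve that avoids the origin sweep out the region that it encloses
  in the coordinates \<open>(\<tau>, s) \<mapsto> \<tau> \<zeta> s\<close>.\<close>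

locale star_curve =
  fixes \<zeta> \<zeta>' :: "real \<Rightarrow> complex"
  assumes der: "\<And>s. (\<zeta> has_vector_derivative \<zeta>' s) (at s)"
    and cont': "continuous_on UNIV \<zeta>'"
    and nz: "\<And>s. \<zeta> s \<noteq> 0"
    and closed: "\<zeta> (2 * pi) = \<zeta> 0"
begin

text \<open>The Jacobian of \<open>(\<tau>, s) \<mapsto> \<tau> \<zeta> s\<close> is \<open>\<tau> * jac s\<close>.\<close>

definition jac :: "real \<Rightarrow> real" where
  "jac s = Im (cnj (\<zeta> s) * \<zeta>' s)"

lemma cont: "continuous_on A \<zeta>"
  using der has_vector_derivative_continuous continuous_at_imp_continuous_on by metis

lemma cont'_on: "continuous_on A \<zeta>'"
  using cont' continuous_on_subset by blast

lemma two_i_jac: "2 * \<i> * of_real (jac s) = cnj (\<zeta> s) * \<zeta>' s - \<zeta> s * cnj (\<zeta>' s)"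
  by (rule complex_eqI) (simp_all add: jac_def algebra_simps)

lemma cont_jac: "continuous_on A jac"
  unfolding jac_def[abs_def] by (intro continuous_intros cont cont'_on)

text \<open>The function \<open>\<Phi> = \<gamma>\<^sub>k (z cnj z) E z / z\<^sup>k\<^sup>+\<^sup>1\<close> has the antiholomorphic derivative
  \<open>cnj z\<^sup>k E z exp (- pi z cnj z)\<close>. Along \<open>z = \<tau> \<zeta> s\<close> the \<open>\<tau>\<close>-derivative \<open>D\<close> of \<open>\<Phi> \<tau> \<zeta>'\<close> and the
  \<open>s\<close>-derivative \<open>C\<close> of \<open>\<Phi> \<zeta>\<close> differ by \<open>2 \<i> h\<close>. The integral of \<open>C\<close> over the closed curve
  vanishes, and that of \<open>D\<close> over \<open>\<tau>\<close> gives the two boundary curves.\<close>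

lemma green_annulus:
  fixes k :: nat and E :: "complex \<Rightarrow> complex"
  assumes E: "E holomorphic_on UNIV" and \<delta>: "0 < \<delta>" "\<delta> < 1"
  defines "h \<equiv> \<lambda>(\<tau>::real) s. cnj (\<tau> * \<zeta> s) ^ k * E (\<tau> * \<zeta> s) * exp (- (pi * ((of_real \<tau>)\<^sup>2 * (\<zeta> s * cnj (\<zeta> s))))) * (\<tau> * jac s)"
  defines "a \<equiv> \<lambda>(\<tau>::real) s. inc_gamma 0 k ((of_real \<tau>)\<^sup>2 * (\<zeta> s * cnj (\<zeta> s))) * E (\<tau> * \<zeta> s) / (\<tau> * \<zeta> s) ^ k * (\<zeta>' s / \<zeta> s)"
  shows "2 * \<i> * integral {\<delta>..1} (\<lambda>\<tau>. integral {0..2 * pi} (h \<tau>))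
    = integral {0..2 * pi} (a 1) - integral {0..2 * pi} (a \<delta>)"
proof -
  define q where "q s = \<zeta> s * cnj (\<zeta> s)" for s
  define q' where "q' s = \<zeta>' s * cnj (\<zeta> s) + \<zeta> s * cnj (\<zeta>' s)" for s
  define e where "e z = E z / z ^ Suc k" for z
  define g where "g u = inc_gamma 0 k u" for u :: complex
  define g' where "g' u = u ^ k * exp (- (pi * u))" for u :: complex
  have g: "(g has_field_derivative g' u) (at u)" for u
    unfolding g_def[abs_def] g'_def by (rule inc_gamma_has_field_derivative)
  have e_hol: "e holomorphic_on - {0}"
    unfolding e_def[abs_def] by (intro holomorphic_intros holomorphic_on_subset[OF E]) auto
  then have e: "(e has_field_derivative deriv e z) (at z)" if "z \<noteq> 0" for z
    using that by (intro holomorphic_derivI[OF e_hol]) auto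
  have e'_cont: "continuous_on (- {0}) (deriv e)"
    by (intro holomorphic_on_imp_continuous_on holomorphic_deriv e_hol) auto
  have q_der: "(q has_vector_derivative q' s) (at s)" for s
    unfolding q_def[abs_def] q'_def
    by (rule derivative_eq_intros der has_vector_derivative_cnj refl)+ (simp add: algebra_simps)
  have g_cont: "continuous_on UNIV g"
    using g by (meson DERIV_isCont continuous_at_imp_continuous_on)
  define D where "D \<tau> s = (g' (\<tau>\<^sup>2 * q s) * (2 * \<tau> * q s) * e (\<tau> * \<zeta> s) + g (\<tau>\<^sup>2 * q s) * (deriv e (\<tau> * \<zeta> s) * \<zeta> s)) * (\<tau> * \<zeta>' s)
      + g (\<tau>\<^sup>2 * q s) * e (\<tau> * \<zeta> s) * \<zeta>' s" for \<tau> s :: real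
  define C where "C \<tau> s = (g' (\<tau>\<^sup>2 * q s) * (\<tau>\<^sup>2 * q' s) * e (\<tau> * \<zeta> s) + g (\<tau>\<^sup>2 * q s) * (deriv e (\<tau> * \<zeta> s) * (\<tau> * \<zeta>' s))) * \<zeta> s
      + g (\<tau>\<^sup>2 * q s) * e (\<tau> * \<zeta> s) * \<zeta>' s" for \<tau> s :: real
  have a_eq: "a \<tau> s = g (\<tau>\<^sup>2 * q s) * e (\<tau> * \<zeta> s) * (\<tau> * \<zeta>' s)" if "\<tau> \<noteq> 0" for \<tau> s
    using nz[of s] that by (simp add: a_def g_def q_def e_def field_simps)
  have d\<tau>: "((\<lambda>\<tau>. g (\<tau>\<^sup>2 * q s) * e (\<tau> * \<zeta> s) * (\<tau> * \<zeta>' s)) has_vector_derivative D \<tau> s) (at \<tau>)" if "\<tau> \<noteq> 0" for \<tau> s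
  proof -
    have "((\<lambda>w. g (w\<^sup>2 * q s) * e (w * \<zeta> s) * (w * \<zeta>' s)) has_field_derivative
        (g' (w\<^sup>2 * q s) * (2 * w * q s) * e (w * \<zeta> s) + g (w\<^sup>2 * q s) * (deriv e (w * \<zeta> s) * \<zeta> s)) * (w * \<zeta>' s)
      + g (w\<^sup>2 * q s) * e (w * \<zeta> s) * \<zeta>' s) (at w)" if "w \<noteq> 0" for w
      using that nz[of s]
      by (auto intro!: derivative_eq_intros DERIV_chain2[OF g] DERIV_chain2[OF e] simp: algebra_simps)
    from has_vector_derivative_real_field[OF this, of "of_real \<tau>"] show ?thesis
      using that unfolding D_def by simp
  qed
  have ds: "((\<lambda>s. g (\<tau>\<^sup>2 * q s) * e (\<tau> * \<zeta> s) * \<zeta> s) has_vector_derivative C \<tau> s) (at s)" if "\<tau> \<noteq> 0" for \<tau> s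
  proof -
    have 1: "((\<lambda>s. g (\<tau>\<^sup>2 * q s)) has_vector_derivative (of_real (\<tau>\<^sup>2) * q' s) * g' (\<tau>\<^sup>2 * q s)) (at s)"
      using field_vector_diff_chain_at[OF has_vector_derivative_mult_right[OF q_der[of s], of "of_real (\<tau>\<^sup>2)"] g]
      by (simp add: o_def)
    have 2: "((\<lambda>s. e (\<tau> * \<zeta> s)) has_vector_derivative (of_real \<tau> * \<zeta>' s) * deriv e (\<tau> * \<zeta> s)) (at s)"
      using field_vector_diff_chain_at[OF has_vector_derivative_mult_right[OF der[of s], of "of_real \<tau>"] e] that nz[of s]
      by (simp add: o_def)
    show ?thesis
      using has_vector_derivative_mult[OF has_vector_derivative_mult[OF 1 2] der[of s]]
      unfolding of_real_power by (rule has_vector_derivative_eq_rhs) (simp add: C_def algebra_simps)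
  qed
  have DC: "D \<tau> s - C \<tau> s = 2 * \<i> * h \<tau> s" if "\<tau> \<noteq> 0" for \<tau> s
  proof -
    have "D \<tau> s - C \<tau> s = g' (\<tau>\<^sup>2 * q s) * e (\<tau> * \<zeta> s) * \<tau>\<^sup>2 * (2 * q s * \<zeta>' s - q' s * \<zeta> s)"
      by (simp add: D_def C_def algebra_simps power2_eq_square)
    also have "2 * q s * \<zeta>' s - q' s * \<zeta> s = \<zeta> s * (2 * \<i> * of_real (jac s))"
      unfolding two_i_jac by (simp add: q_def q'_def algebra_simps)
    also have "g' (\<tau>\<^sup>2 * q s) * e (\<tau> * \<zeta> s) * \<tau>\<^sup>2 * (\<zeta> s * (2 * \<i> * of_real (jac s))) =
       ((\<tau>\<^sup>2 * q s) ^ k * \<tau>\<^sup>2 * \<zeta> s / (\<tau> * \<zeta> s) ^ Suc k) * E (\<tau> * \<zeta> s) * exp (- (pi * (\<tau>\<^sup>2 * q s))) * (2 * \<i> * of_real (jac s))"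
      by (simp add: g'_def e_def)
    also have "(\<tau>\<^sup>2 * q s) ^ k * \<tau>\<^sup>2 * \<zeta> s / (\<tau> * \<zeta> s) ^ Suc k = cnj (\<tau> * \<zeta> s) ^ k * \<tau>"
      using nz[of s] that by (simp add: q_def field_simps power_mult_distrib power2_eq_square)
    finally show ?thesis by (simp add: h_def q_def algebra_simps)
  qed
  let ?R = "{\<delta>..1} \<times> {0..2 * pi}"
  have c1: "continuous_on ?R (\<lambda>p. \<zeta> (snd p))"
    by (rule continuous_on_compose2[OF cont continuous_on_snd[OF continuous_on_id]]) auto
  have c2: "continuous_on ?R (\<lambda>p. \<zeta>' (snd p))"
    by (rule continuous_on_compose2[OF cont' continuous_on_snd[OF continuous_on_id]]) auto
  have c3: "continuous_on ?R (\<lambda>p. q (snd p))"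
    unfolding q_def by (intro continuous_on_mult continuous_on_cnj c1)
  have c4: "continuous_on ?R (\<lambda>p. of_real (fst p) :: complex)"
    by (intro continuous_intros)
  have c5: "continuous_on ?R (\<lambda>p. (of_real (fst p))\<^sup>2 * q (snd p))"
    by (intro continuous_on_mult continuous_on_power c3 c4)
  have c6: "continuous_on ?R (\<lambda>p. of_real (fst p) * \<zeta> (snd p))"
    by (intro continuous_on_mult c1 c4)
  have c7: "continuous_on ?R (\<lambda>p. g ((of_real (fst p))\<^sup>2 * q (snd p)))"
    by (rule continuous_on_compose2[OF g_cont c5]) auto
  have c8: "continuous_on ?R (\<lambda>p. g' ((of_real (fst p))\<^sup>2 * q (snd p)))"
    unfolding g'_def by (intro continuous_on_mult continuous_on_power continuous_on_exp continuous_on_minus continuous_on_const c5)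
  have im: "(\<lambda>p. complex_of_real (fst p) * \<zeta> (snd p)) ` ?R \<subseteq> - {0}"
    using \<delta> nz by auto
  have c9: "continuous_on ?R (\<lambda>p. e (of_real (fst p) * \<zeta> (snd p)))"
    by (rule continuous_on_compose2[OF holomorphic_on_imp_continuous_on[OF e_hol] c6 im])
  have c10: "continuous_on ?R (\<lambda>p. deriv e (of_real (fst p) * \<zeta> (snd p)))"
    by (rule continuous_on_compose2[OF e'_cont c6 im])
  have contD: "continuous_on ?R (\<lambda>(\<tau>, s). D \<tau> s)"
    unfolding D_def case_prod_beta of_real_power of_real_mult of_real_numeral
    by (intro continuous_on_add continuous_on_mult continuous_on_const c1 c2 c3 c4 c7 c8 c9 c10)
  have "integral {\<delta>..1} (\<lambda>\<tau>. integral {0..2 * pi} (D \<tau>)) = integral {0..2 * pi} (\<lambda>s. integral {\<delta>..1} (\<lambda>\<tau>. D \<tau> s))"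
    using integral_swap_continuous[of \<delta> 0 1 "2 * pi" D] contD by (simp add: cbox_Pair_eq)
  also have "\<dots> = integral {0..2 * pi} (\<lambda>s. a 1 s - a \<delta> s)"
  proof (rule integral_cong)
    fix s
    define A where "A \<tau> = g (\<tau>\<^sup>2 * q s) * e (\<tau> * \<zeta> s) * (\<tau> * \<zeta>' s)" for \<tau> :: real
    have dA: "(A has_vector_derivative D \<tau> s) (at \<tau>)" if "\<tau> \<noteq> 0" for \<tau>
      using d\<tau>[OF that, of s] by (simp add: A_def[abs_def])
    have "((\<lambda>\<tau>. D \<tau> s) has_integral (A 1 - A \<delta>)) {\<delta>..1}"
      using \<delta> by (intro fundamental_theorem_of_calculus has_vector_derivative_at_within[OF dA]) auto
    then show "integral {\<delta>..1} (\<lambda>\<tau>. D \<tau> s) = a 1 s - a \<delta> s"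
      using a_eq[of 1 s] a_eq[of \<delta> s] \<delta> by (simp add: integral_unique A_def)
  qed
  also have "\<dots> = integral {0..2 * pi} (a 1) - integral {0..2 * pi} (a \<delta>)"
  proof (rule Henstock_Kurzweil_Integration.integral_diff)
    have "continuous_on {0..2 * pi} (a \<tau>)" if "\<tau> \<noteq> 0" for \<tau>
      unfolding a_def using nz that
      by (intro continuous_intros continuous_on_compose2[OF g_cont[unfolded g_def[abs_def]]]
          continuous_on_compose2[OF holomorphic_on_imp_continuous_on[OF E]] cont cont'_on) auto
    then show "a 1 integrable_on {0..2 * pi}" "a \<delta> integrable_on {0..2 * pi}"
      using \<delta> by (auto intro!: integrable_continuous_interval)
  qed
  finally have 1: "integral {\<delta>..1} (\<lambda>\<tau>. integral {0..2 * pi} (D \<tau>)) = integral {0..2 * pi} (a 1) - integral {0..2 * pi} (a \<delta>)" .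
  have "integral {\<delta>..1} (\<lambda>\<tau>. integral {0..2 * pi} (D \<tau>)) = integral {\<delta>..1} (\<lambda>\<tau>. 2 * \<i> * integral {0..2 * pi} (h \<tau>))"
  proof (rule integral_cong)
    fix \<tau> assume "\<tau> \<in> {\<delta>..1}"
    then have \<tau>: "\<tau> \<noteq> 0" using \<delta> by auto
    define B where "B s = g (\<tau>\<^sup>2 * q s) * e (\<tau> * \<zeta> s) * \<zeta> s" for s
    have dB: "(B has_vector_derivative C \<tau> s) (at s)" for s
      using ds[OF \<tau>, of s] by (simp add: B_def[abs_def])
    have "(C \<tau> has_integral (B (2 * pi) - B 0)) {0..2 * pi}"
      by (intro fundamental_theorem_of_calculus has_vector_derivative_at_within[OF dB]) auto
    then have C: "(C \<tau> has_integral 0) {0..2 * pi}" by (simp add: B_def q_def closed)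
    have "continuous_on {0..2 * pi} (h \<tau>)"
      unfolding h_def
      by (intro continuous_intros continuous_on_compose2[OF holomorphic_on_imp_continuous_on[OF E]] cont cont_jac) auto
    then have "(h \<tau> has_integral integral {0..2 * pi} (h \<tau>)) {0..2 * pi}"
      by (intro integrable_integral integrable_continuous_interval)
    then have "((\<lambda>s. 2 * \<i> * h \<tau> s) has_integral 2 * \<i> * integral {0..2 * pi} (h \<tau>)) {0..2 * pi}"
      by (rule has_integral_mult_right)
    from has_integral_add[OF this C] have "((\<lambda>s. 2 * \<i> * h \<tau> s + C \<tau> s) has_integral 2 * \<i> * integral {0..2 * pi} (h \<tau>)) {0..2 * pi}"
      by simp
    moreover have "(\<lambda>s. 2 * \<i> * h \<tau> s + C \<tau> s) = D \<tau>"
      using DC[OF \<tau>] by (simp add: fun_eq_iff diff_eq_eq)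
    ultimately show "integral {0..2 * pi} (D \<tau>) = 2 * \<i> * integral {0..2 * pi} (h \<tau>)"
      by (simp add: integral_unique)
  qed
  also have "\<dots> = 2 * \<i> * integral {\<delta>..1} (\<lambda>\<tau>. integral {0..2 * pi} (h \<tau>))"
    by (rule Henstock_Kurzweil_Integration.integral_mult_right)
  finally show ?thesis using 1 by simp
qed

text \<open>The inner boundary curve of the preceding formula contributes at most a multiple of \<open>\<delta>\<close>, and so
  does the part of the area integral with \<open>\<tau> \<le> \<delta>\<close>.\<close>

lemma green_star:
  fixes k :: nat and E :: "complex \<Rightarrow> complex"
  assumes E: "E holomorphic_on UNIV"
  defines "h \<equiv> \<lambda>(\<tau>::real) s. cnj (\<tau> * \<zeta> s) ^ k * E (\<tau> * \<zeta> s) * exp (- (pi * ((of_real \<tau>)\<^sup>2 * (\<zeta> s * cnj (\<zeta> s))))) * (\<tau> * jac s)"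
  shows "continuous_on ({0..1} \<times> {0..2 * pi}) (\<lambda>(\<tau>, s). h \<tau> s)"
    and "2 * \<i> * integral {0..1} (\<lambda>\<tau>. integral {0..2 * pi} (h \<tau>))
    = integral {0..2 * pi} (\<lambda>s. inc_gamma 0 k (\<zeta> s * cnj (\<zeta> s)) * E (\<zeta> s) / \<zeta> s ^ k * (\<zeta>' s / \<zeta> s))"
proof -
  define a where "a \<tau> s = inc_gamma 0 k ((of_real \<tau>)\<^sup>2 * (\<zeta> s * cnj (\<zeta> s))) * E (\<tau> * \<zeta> s) / (\<tau> * \<zeta> s) ^ k * (\<zeta>' s / \<zeta> s)" for \<tau> s :: real
  define G where "G \<tau> = integral {0..2 * pi} (h \<tau>)" for \<tau>
  have E_cont: "continuous_on UNIV E" using E by (rule holomorphic_on_imp_continuous_on)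
  have E_curve: "continuous_on ({0..1} \<times> {0..2 * pi}) (\<lambda>p. E (of_real (fst p) * \<zeta> (snd p)))"
    by (intro continuous_on_compose2[OF E_cont] continuous_intros continuous_on_compose2[OF cont, of _ snd]) auto
  show cont_h: "continuous_on ({0..1} \<times> {0..2 * pi}) (\<lambda>(\<tau>, s). h \<tau> s)"
    unfolding h_def case_prod_beta
    by (intro continuous_intros E_curve continuous_on_compose2[OF cont, of _ snd] continuous_on_compose2[OF cont_jac, of _ snd]) auto
  have G_cont: "continuous_on {0..1} G"
    using integral_continuous_on_param[of "{0..1}" 0 "2 * pi" h] cont_h by (simp add: G_def[abs_def])
  then have "bounded (G ` {0..1})"
    by (intro compact_imp_bounded compact_continuous_image) auto
  then obtain C where "\<forall>v\<in>G ` {0..1}. cmod v \<le> C" unfolding bounded_iff by (rule exE)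
  then have C: "cmod (G \<tau>) \<le> C" if "\<tau> \<in> {0..1}" for \<tau> :: real using that by blast
  have "bounded ((\<lambda>p. E (of_real (fst p) * \<zeta> (snd p))) ` ({0..1} \<times> {0..2 * pi}))"
    by (intro compact_imp_bounded compact_continuous_image E_curve compact_Times) auto
  then obtain K1 where K1': "\<forall>v\<in>(\<lambda>p. E (of_real (fst p) * \<zeta> (snd p))) ` ({0..1} \<times> {0..2 * pi}). cmod v \<le> K1"
    unfolding bounded_iff by (rule exE)
  have K1: "cmod (E (\<tau> * \<zeta> s)) \<le> K1" if "\<tau> \<in> {0..1}" "s \<in> {0..2 * pi}" for \<tau> s :: real
    using bspec[OF K1' imageI, of "(\<tau>, s)"] that by simp
  have K1_0: "0 \<le> K1" using order.trans[OF norm_ge_zero K1[of 0 0]] by simp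
  have "bounded ((\<lambda>s. of_real (cmod (\<zeta> s) ^ (k + 2)) * (\<zeta>' s / \<zeta> s)) ` {0..2 * pi})"
    by (intro compact_imp_bounded compact_continuous_image continuous_intros cont cont'_on) (auto simp: nz)
  then obtain K2 where "\<forall>v\<in>(\<lambda>s. of_real (cmod (\<zeta> s) ^ (k + 2)) * (\<zeta>' s / \<zeta> s)) ` {0..2 * pi}. cmod v \<le> K2"
    unfolding bounded_iff by (rule exE)
  then have "cmod (of_real (cmod (\<zeta> s) ^ (k + 2)) * (\<zeta>' s / \<zeta> s)) \<le> K2" if "s \<in> {0..2 * pi}" for s
    using that by blast
  then have K2: "cmod (\<zeta> s) ^ (k + 2) * cmod (\<zeta>' s / \<zeta> s) \<le> K2" if "s \<in> {0..2 * pi}" for s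
    using that by (simp only: norm_mult norm_of_real abs_of_nonneg[OF zero_le_power[OF norm_ge_zero]])
  have a_bound: "cmod (a \<delta> s) \<le> \<delta> * (K1 * K2)" if \<delta>: "0 < \<delta>" "\<delta> < 1" and s: "s \<in> {0..2 * pi}" for \<delta> s
  proof -
    define x where "x = cmod (\<zeta> s)"
    have x: "0 < x" using nz by (simp add: x_def)
    have "of_real \<delta> ^ 2 * (\<zeta> s * cnj (\<zeta> s)) = complex_of_real (\<delta>\<^sup>2 * x\<^sup>2)"
      by (simp add: x_def complex_norm_square[symmetric])
    then have g: "cmod (inc_gamma 0 k (of_real \<delta> ^ 2 * (\<zeta> s * cnj (\<zeta> s)))) \<le> (\<delta>\<^sup>2 * x\<^sup>2) ^ Suc k"
      using inc_gamma_of_real_bound[of "\<delta>\<^sup>2 * x\<^sup>2" k] by (simp only:) simp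
    have "cmod (a \<delta> s) = cmod (inc_gamma 0 k (of_real \<delta> ^ 2 * (\<zeta> s * cnj (\<zeta> s)))) * cmod (E (\<delta> * \<zeta> s)) / (\<delta> * x) ^ k * cmod (\<zeta>' s / \<zeta> s)"
      using \<delta> by (simp add: a_def norm_mult norm_divide norm_power x_def)
    also have "\<dots> \<le> (\<delta>\<^sup>2 * x\<^sup>2) ^ Suc k * K1 / (\<delta> * x) ^ k * cmod (\<zeta>' s / \<zeta> s)"
      using \<delta> x K1[of \<delta> s] s g by (intro mult_right_mono divide_right_mono mult_mono) auto
    also have "\<dots> = \<delta> ^ (k + 1) * \<delta> * (K1 * (x ^ (k + 2) * cmod (\<zeta>' s / \<zeta> s)))"
      using \<delta> x by (simp add: field_simps power2_eq_square power_mult_distrib)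
    also have "\<dots> \<le> 1 * \<delta> * (K1 * K2)"
      using \<delta> K1_0 K2[OF s] x power_le_one[of \<delta> "Suc k"] by (intro mult_mono) (auto simp: x_def)
    finally show ?thesis by simp
  qed
  define I0 where "I0 = integral {0..1} G"
  define A1 where "A1 = integral {0..2 * pi} (a 1)"
  have "cmod (2 * \<i> * I0 - A1) \<le> \<delta> * (2 * C + K1 * K2 * (2 * pi))" if \<delta>: "0 < \<delta>" "\<delta> < 1" for \<delta>
  proof -
    have comb: "integral {0..\<delta>} G + integral {\<delta>..1} G = I0"
      unfolding I0_def using \<delta> G_cont
      by (intro Henstock_Kurzweil_Integration.integral_combine integrable_continuous_interval) auto
    have ann: "2 * \<i> * integral {\<delta>..1} G = A1 - integral {0..2 * pi} (a \<delta>)"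
      using green_annulus[OF E \<delta>, of k] unfolding G_def[abs_def] h_def A1_def a_def[abs_def] .
    have "2 * \<i> * I0 - A1 = 2 * \<i> * integral {0..\<delta>} G - integral {0..2 * pi} (a \<delta>)"
      unfolding comb[symmetric] distrib_left ann by simp
    also have "cmod \<dots> \<le> cmod (2 * \<i> * integral {0..\<delta>} G) + cmod (integral {0..2 * pi} (a \<delta>))"
      by (rule norm_triangle_ineq4)
    also have "\<dots> \<le> 2 * (C * (\<delta> - 0)) + (\<delta> * (K1 * K2)) * (2 * pi - 0)"
    proof (rule add_mono)
      have "cmod (integral {0..\<delta>} G) \<le> C * (\<delta> - 0)"
        using \<delta> C by (intro integral_bound continuous_on_subset[OF G_cont]) auto
      then show "cmod (2 * \<i> * integral {0..\<delta>} G) \<le> 2 * (C * (\<delta> - 0))" by (simp add: norm_mult)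
      have "continuous_on {0..2 * pi} (\<lambda>s. inc_gamma 0 k (of_real \<delta> ^ 2 * (\<zeta> s * cnj (\<zeta> s))))"
        by (intro continuous_on_inc_gamma continuous_intros cont)
      then have "continuous_on {0..2 * pi} (a \<delta>)"
        unfolding a_def using nz \<delta>
        by (intro continuous_intros continuous_on_compose2[OF E_cont] cont cont'_on) auto
      then show "cmod (integral {0..2 * pi} (a \<delta>)) \<le> (\<delta> * (K1 * K2)) * (2 * pi - 0)"
        using a_bound[OF \<delta>] by (intro integral_bound) auto
    qed
    finally show ?thesis by (simp add: algebra_simps)
  qed
  note key = this
  have "2 * \<i> * I0 = A1"
  proof (rule ccontr)
    assume ne: "2 * \<i> * I0 \<noteq> A1"
    define x where "x = cmod (2 * \<i> * I0 - A1)"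
    define K where "K = \<bar>2 * C + K1 * K2 * (2 * pi)\<bar>"
    have x: "0 < x" and K: "0 \<le> K" using ne by (auto simp: x_def K_def)
    \<comment> \<open>Small enough to contradict the bound \<open>x \<le> \<delta> K\<close>.\<close>
    define \<delta> where "\<delta> = min (1/2) (x / (2 * (K + 1)))"
    have \<delta>: "0 < \<delta>" "\<delta> < 1" using x K by (auto simp: \<delta>_def)
    have "x \<le> \<delta> * K"
      unfolding x_def K_def
      by (rule order.trans[OF key[OF \<delta>] mult_left_mono[OF abs_ge_self less_imp_le[OF \<delta>(1)]]])
    also have "\<dots> \<le> x / (2 * (K + 1)) * K" using K by (intro mult_right_mono) (auto simp: \<delta>_def)
    also have "\<dots> < x"
    proof -
      have "0 \<le> K * x" using x K by simp
      then have "0 < K * x + x * 2" using x by linarith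
      then show ?thesis using x K by (simp add: field_simps)
    qed
    finally show False by simp
  qed
  then show "2 * \<i> * integral {0..1} (\<lambda>\<tau>. integral {0..2 * pi} (h \<tau>))
    = integral {0..2 * pi} (\<lambda>s. inc_gamma 0 k (\<zeta> s * cnj (\<zeta> s)) * E (\<zeta> s) / \<zeta> s ^ k * (\<zeta>' s / \<zeta> s))"
    by (simp add: I0_def A1_def G_def[abs_def] a_def[abs_def])
qed

end

subsection \<open>Boundary integrals over conformally parametrised curves\<close>

locale disc_curve =
  fixes r :: real and P :: "complex \<Rightarrow> complex"
  assumes r: "0 < r" and P: "P holomorphic_on ball 0 2"
begin

definition \<psi> :: "complex \<Rightarrow> complex" where "\<psi> w = of_real r * w * exp (P w)"

definition \<zeta> :: "real \<Rightarrow> complex" where "\<zeta> s = \<psi> (cis s)"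

text \<open>The logarithmic derivative of \<open>\<zeta>\<close>.\<close>

definition L' :: "real \<Rightarrow> complex" where "L' s = \<i> * (1 + cis s * deriv P (cis s))"

lemma cis_in_ball: "cis s \<in> ball 0 2"
  by simp

lemma \<psi>_holomorphic: "\<psi> holomorphic_on ball 0 2"
  unfolding \<psi>_def[abs_def] by (intro holomorphic_intros P)

lemma \<zeta>_nz: "\<zeta> s \<noteq> 0"
  using r by (simp add: \<zeta>_def \<psi>_def)

lemma \<psi>_deriv: "(\<psi> has_field_derivative of_real r * exp (P w) * (1 + w * deriv P w)) (at w)" if "w \<in> ball 0 2"
proof -
  have "(P has_field_derivative deriv P w) (at w)"
    using P that by (intro holomorphic_derivI[of _ "ball 0 2"]) auto
  then show ?thesis unfolding \<psi>_def[abs_def]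
    by (auto intro!: derivative_eq_intros simp: algebra_simps)
qed

lemma cis_has_vector_derivative: "(cis has_vector_derivative \<i> * cis s) (at s)"
  unfolding cis_conv_exp by (auto intro!: derivative_eq_intros has_vector_derivative_real_field)

lemma \<zeta>_deriv: "(\<zeta> has_vector_derivative \<zeta> s * L' s) (at s)"
proof -
  have "((\<psi> \<circ> cis) has_vector_derivative (\<i> * cis s) * (of_real r * exp (P (cis s)) * (1 + cis s * deriv P (cis s)))) (at s)"
    by (rule field_vector_diff_chain_at[OF cis_has_vector_derivative \<psi>_deriv[OF cis_in_ball]])
  then show ?thesis by (simp add: \<zeta>_def[abs_def] \<psi>_def L'_def comp_def mult_ac)
qed

lemma cont_compose_cis: "continuous_on A (\<lambda>s. H (cis s))" if "H holomorphic_on ball 0 2"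
  by (rule continuous_on_compose2[OF holomorphic_on_imp_continuous_on[OF that]])
     (auto intro!: continuous_intros)

lemma L'_cont: "continuous_on A L'"
  unfolding L'_def[abs_def]
  by (intro continuous_intros cont_compose_cis holomorphic_deriv P) auto

sublocale star_curve \<zeta> "\<lambda>s. \<zeta> s * L' s"
proof
  show "(\<zeta> has_vector_derivative \<zeta> s * L' s) (at s)" for s by (rule \<zeta>_deriv)
  show "continuous_on UNIV (\<lambda>s. \<zeta> s * L' s)"
    unfolding \<zeta>_def by (intro continuous_intros L'_cont cont_compose_cis \<psi>_holomorphic)
  show "\<zeta> s \<noteq> 0" for s by (rule \<zeta>_nz)
  show "\<zeta> (2 * pi) = \<zeta> 0" by (simp add: \<zeta>_def)
qed

lemma circle_mean:
  fixes H :: "complex \<Rightarrow> complex"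
  assumes "H holomorphic_on ball 0 2"
  shows "((\<lambda>s. H (cis s)) has_integral 2 * pi * H 0) {0..2 * pi}"
proof -
  have "((\<lambda>u. H u / (u - 0)) has_contour_integral (2 * of_real pi * \<i> * H 0)) (circlepath 0 1)"
    by (rule Cauchy_integral_circlepath_simple) (auto intro: holomorphic_on_subset[OF assms])
  then have "((\<lambda>t. H (cis t) / cis t * \<i> * cis t) has_integral (2 * of_real pi * \<i> * H 0)) {0..2 * pi}"
    unfolding circlepath_def by (subst (asm) has_contour_integral_part_circlepath_iff) auto
  from has_integral_mult_right[OF this, of "- \<i>"]
  show ?thesis by (simp add: mult_ac)
qed

text \<open>On the unit circle \<open>L' s\<close> is \<open>\<i>\<close> times a holomorphic function of \<open>w = cis s\<close> with value \<open>1\<close> at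
  \<open>w = 0\<close>, so the mean value property evaluates the integral at the centre, where \<open>\<psi>\<close> vanishes.\<close>

lemma boundary_integral_holomorphic:
  fixes m E :: "complex \<Rightarrow> complex"
  assumes m: "m holomorphic_on ball 0 2" and E: "E holomorphic_on UNIV"
  shows "((\<lambda>s. m (cis s) * E (\<zeta> s) * L' s) has_integral 2 * pi * \<i> * (m 0 * E 0)) {0..2 * pi}"
proof -
  have "(\<lambda>w. m w * E (\<psi> w) * (\<i> * (1 + w * deriv P w))) holomorphic_on ball 0 2"
    by (intro holomorphic_intros m holomorphic_on_compose_gen[OF \<psi>_holomorphic E, unfolded comp_def] P) auto
  from circle_mean[OF this] show ?thesis
    by (simp add: \<zeta>_def L'_def \<psi>_def mult_ac)
qed

text \<open>Integration by parts over the closed curve exchanges one power of \<open>1 / \<zeta>\<close> for a derivative of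
  \<open>E\<close>; after \<open>k\<close> steps the mean value property applies.\<close>

lemma boundary_integral_power:
  fixes E :: "complex \<Rightarrow> complex"
  assumes "E holomorphic_on UNIV"
  shows "((\<lambda>s. E (\<zeta> s) / \<zeta> s ^ k * L' s) has_integral 2 * pi * \<i> * ((deriv ^^ k) E 0 / fact k)) {0..2 * pi}"
  using assms
proof (induction k arbitrary: E)
  case 0
  then show ?case using boundary_integral_holomorphic[of "\<lambda>_. 1" E] by simp
next
  case (Suc k)
  have E': "deriv E holomorphic_on UNIV" by (rule holomorphic_deriv[OF Suc.prems]) auto
  have d: "((\<lambda>s. E (\<zeta> s) / \<zeta> s ^ Suc k) has_vector_derivative
      deriv E (\<zeta> s) / \<zeta> s ^ k * L' s - of_nat (Suc k) * (E (\<zeta> s) / \<zeta> s ^ Suc k * L' s)) (at s)" for s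
  proof -
    have "((\<lambda>z. E z / z ^ Suc k) has_field_derivative
        (deriv E (\<zeta> s) * \<zeta> s ^ Suc k - E (\<zeta> s) * (of_nat (Suc k) * \<zeta> s ^ k)) / (\<zeta> s ^ Suc k * \<zeta> s ^ Suc k)) (at (\<zeta> s))"
      using \<zeta>_nz[of s]
      by (intro DERIV_divide holomorphic_derivI[OF Suc.prems] DERIV_cong[OF DERIV_power[OF DERIV_ident, where n = "Suc k"]]) auto
    from field_vector_diff_chain_at[OF \<zeta>_deriv this]
    show ?thesis unfolding comp_def
      by (rule has_vector_derivative_eq_rhs) (use \<zeta>_nz[of s] in \<open>simp add: field_simps\<close>)
  qed
  have "((\<lambda>s. deriv E (\<zeta> s) / \<zeta> s ^ k * L' s - of_nat (Suc k) * (E (\<zeta> s) / \<zeta> s ^ Suc k * L' s)) has_integral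
      (E (\<zeta> (2 * pi)) / \<zeta> (2 * pi) ^ Suc k - E (\<zeta> 0) / \<zeta> 0 ^ Suc k)) {0..2 * pi}"
    by (intro fundamental_theorem_of_calculus has_vector_derivative_at_within[OF d]) auto
  then have z: "((\<lambda>s. deriv E (\<zeta> s) / \<zeta> s ^ k * L' s - of_nat (Suc k) * (E (\<zeta> s) / \<zeta> s ^ Suc k * L' s)) has_integral 0) {0..2 * pi}"
    by (simp add: closed)
  from has_integral_diff[OF Suc.IH[OF E'] z]
  have "((\<lambda>s. of_nat (Suc k) * (E (\<zeta> s) / \<zeta> s ^ Suc k * L' s)) has_integral
      2 * pi * \<i> * ((deriv ^^ k) (deriv E) 0 / fact k)) {0..2 * pi}" by simp
  from has_integral_mult_right[OF this, of "1 / of_nat (Suc k)"]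
  show ?case
    by (simp add: funpow_Suc_right field_simps del: of_nat_Suc funpow.simps)
qed

end

subsection \<open>Analytic elements of the Wiener algebra\<close>

definition disc_eval :: "wiener \<Rightarrow> complex \<Rightarrow> complex" where
  "disc_eval a w = (\<Sum>n. coef a (int n) * w ^ n)"

lemma disc_eval_sums:
  assumes "cmod w \<le> 2"
  shows "(\<lambda>n. coef a (int n) * w ^ n) sums disc_eval a w"
proof -
  have "(\<lambda>n. cmod (coef a n) * wt n) summable_on range int"
    by (rule summable_on_subset[OF summable_coef]) auto
  then have "(\<lambda>n. cmod (coef a (int n)) * wt (int n)) summable_on UNIV"
    by (subst (asm) summable_on_reindex) (auto simp: comp_def)
  then have "summable (\<lambda>n. cmod (coef a (int n)) * wt (int n))"
    by (rule summable_on_imp_summable)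
  then have "summable (\<lambda>n. coef a (int n) * w ^ n)"
  proof (rule summable_comparison_test')
    show "norm (coef a (int n) * w ^ n) \<le> cmod (coef a (int n)) * wt (int n)" if "n \<ge> 0" for n
      using assms by (simp add: norm_mult norm_power wt_def mult_left_mono power_mono)
  qed
  then show ?thesis unfolding disc_eval_def by (rule summable_sums)
qed

lemma disc_eval_holomorphic: "disc_eval a holomorphic_on ball 0 2"
  by (rule power_series_holomorphic[where a = "\<lambda>n. coef a (int n)"]) (simp add: disc_eval_sums)

lemma disc_eval_0: "disc_eval a 0 = coef a 0"
  using disc_eval_sums[of 0 a] sums_unique2[OF _ powser_sums_zero[of "\<lambda>n. coef a (int n)"]] by simp

text \<open>Without coefficients of negative index the Laurent series on the circle is the boundary value of
  a power series on the disc of radius \<open>2\<close>.\<close>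

lemma ev_eq_disc_eval:
  assumes "\<And>n. n < 0 \<Longrightarrow> coef a n = 0"
  shows "ev s a = disc_eval a (cis s)"
proof -
  have "((\<lambda>n. coef a n * cis (of_int n * s)) has_sum ev s a) UNIV"
    unfolding ev_def by (rule has_sum_infsum[OF ev_summable])
  then have "((\<lambda>n. coef a n * cis (of_int n * s)) has_sum ev s a) (range int)"
  proof (rule iffD1[OF has_sum_cong_neutral, rotated -1])
    fix n :: int assume "n \<in> UNIV - range int"
    then have "n < 0" by (metis Diff_iff nonneg_int_cases not_le rangeI)
    then show "coef a n * cis (of_int n * s) = 0" by (simp add: assms)
  qed auto
  then have "((\<lambda>n. coef a (int n) * cis s ^ n) has_sum ev s a) UNIV"
    by (subst (asm) has_sum_reindex) (auto simp: comp_def Complex.DeMoivre[symmetric])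
  then have "(\<lambda>n. coef a (int n) * cis s ^ n) sums ev s a" by (rule has_sum_imp_sums)
  then show ?thesis using disc_eval_sums[of "cis s" a] sums_unique2 by simp
qed

lemma ev_minus: "ev s (- a) = - ev s a"
  using ev_scaleR[of s "- 1" a] by simp

lemma ev_inc_gamma: "ev s (inc_gamma lam k x) = inc_gamma lam k (ev s x)"
  by (simp add: inc_gamma_def ev_scaleR ev_diff ev_mult ev_exp ev_sum ev_power ev_minus)

subsection \<open>Area integrals over the solution domain\<close>

text \<open>Green's formula for each \<open>k\<close> expresses the area integral by \<open>\<gamma>\<^sub>k\<close> on the curve. Subtracting
  \<open>lam k! / pi\<^sup>k\<^sup>+\<^sup>1\<close> from \<open>\<gamma>\<^sub>k\<close> produces the boundary function, which extends holomorphically into the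
  disc and contributes only through its value at the centre; the subtracted powers \<open>z\<^sup>-\<^sup>k\<close> contribute
  the Taylor coefficients of \<open>E\<close>, which is \<open>lam\<close> times the integral over the whole plane.\<close>

lemma solution_area_identity:
  fixes F :: "nat \<Rightarrow> complex" and E :: "complex \<Rightarrow> complex"
  assumes r: "0 < r"
    and p: "\<And>n. n < 0 \<Longrightarrow> coef p n = 0"
    and M: "\<And>n. n < 0 \<Longrightarrow> coef (boundary_fun lam N r F p) n = 0"
    and E: "E holomorphic_on UNIV"
  defines "z \<equiv> disc_curve.\<zeta> r (disc_eval p)"
  defines "J \<equiv> star_curve.jac z (\<lambda>s. z s * disc_curve.L' (disc_eval p) s)"
  shows "integral {0..1} (\<lambda>\<tau>. integral {0..2 * pi} (\<lambda>s.
      (\<Sum>k\<le>N. F k * cnj (\<tau> * z s) ^ k) * E (\<tau> * z s) * exp (- (pi * ((of_real \<tau>)\<^sup>2 * (z s * cnj (z s))))) * (\<tau> * J s)))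
    = pi * (coef (boundary_fun lam N r F p) 0 * E 0) + lam * (\<Sum>k\<le>N. F k * (deriv ^^ k) E 0 / pi ^ k)"
proof -
  interpret disc_curve r "disc_eval p" by unfold_locales (use r disc_eval_holomorphic in auto)
  have z: "z = \<zeta>" and J: "J = jac" unfolding z_def J_def by auto
  define m where "m = disc_eval (boundary_fun lam N r F p)"
  define h where "h k \<tau> s = cnj (\<tau> * \<zeta> s) ^ k * E (\<tau> * \<zeta> s) * exp (- (pi * ((of_real \<tau>)\<^sup>2 * (\<zeta> s * cnj (\<zeta> s))))) * (\<tau> * jac s)" for k and \<tau> s :: real
  define b where "b k s = inc_gamma 0 k (\<zeta> s * cnj (\<zeta> s)) * E (\<zeta> s) / \<zeta> s ^ k * L' s" for k s
  have h_cont: "continuous_on ({0..1} \<times> {0..2 * pi}) (\<lambda>(\<tau>, s). h k \<tau> s)" for k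
    unfolding h_def by (rule green_star(1)[OF E])
  have green: "2 * \<i> * integral {0..1} (\<lambda>\<tau>. integral {0..2 * pi} (h k \<tau>)) = integral {0..2 * pi} (b k)" for k
    using green_star(2)[OF E, of k] \<zeta>_nz unfolding h_def[abs_def] b_def[abs_def] by simp
  have zeta_eq: "\<zeta> s = of_real r * cis s * exp (ev s p)" for s
    using ev_eq_disc_eval[OF p] by (simp add: \<zeta>_def \<psi>_def)
  have mod_eq: "\<zeta> s * cnj (\<zeta> s) = r\<^sup>2 * exp (ev s p + cnj (ev s p))" for s
    unfolding zeta_eq exp_add by (simp add: exp_cnj power2_eq_square cis_mult cis_cnj algebra_simps)
  have m_cis: "m (cis s) = (\<Sum>k\<le>N. F k / \<zeta> s ^ k * inc_gamma lam k (\<zeta> s * cnj (\<zeta> s)))" for s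
  proof -
    have "m (cis s) = ev s (boundary_fun lam N r F p)"
      unfolding m_def using ev_eq_disc_eval[OF M] by simp
    also have "\<dots> = (\<Sum>k\<le>N. F k / r ^ k * cis (of_int (- int k) * s) * exp (- (real k *\<^sub>R ev s p)) *
        inc_gamma lam k (r\<^sup>2 *\<^sub>R exp (ev s p + cnj (ev s p))))"
      unfolding boundary_fun_def
      by (simp add: ev_sum ev_mult ev_laurent_monom ev_exp ev_inc_gamma ev_scaleR ev_add ev_star ev_minus)
    also have "\<dots> = (\<Sum>k\<le>N. F k / \<zeta> s ^ k * inc_gamma lam k (\<zeta> s * cnj (\<zeta> s)))"
    proof (rule sum.cong[OF refl])
      fix k
      have "\<zeta> s ^ k = r ^ k * cis (of_nat k * s) * exp (of_nat k * ev s p)"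
        unfolding zeta_eq by (simp add: power_mult_distrib Complex.DeMoivre exp_of_nat_mult)
      moreover have "cis (of_int (- int k) * s) = inverse (cis (of_nat k * s))"
        by (simp add: cis_inverse)
      ultimately have "F k / r ^ k * cis (of_int (- int k) * s) * exp (- (real k *\<^sub>R ev s p)) = F k / \<zeta> s ^ k"
        by (simp only: scaleR_conv_of_real of_real_of_nat_eq exp_minus divide_inverse inverse_mult_distrib mult.assoc)
      then show "F k / r ^ k * cis (of_int (- int k) * s) * exp (- (real k *\<^sub>R ev s p)) * inc_gamma lam k (r\<^sup>2 *\<^sub>R exp (ev s p + cnj (ev s p)))
        = F k / \<zeta> s ^ k * inc_gamma lam k (\<zeta> s * cnj (\<zeta> s))"
        unfolding mod_eq by (simp only: scaleR_conv_of_real of_real_power)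
    qed
    finally show ?thesis .
  qed
  have "((\<lambda>s. m (cis s) * E (\<zeta> s) * L' s + (\<Sum>k\<le>N. F k * of_real (lam * fact k / pi ^ (k + 1)) * (E (\<zeta> s) / \<zeta> s ^ k * L' s)))
     has_integral (2 * pi * \<i> * (m 0 * E 0) + (\<Sum>k\<le>N. F k * of_real (lam * fact k / pi ^ (k + 1)) * (2 * pi * \<i> * ((deriv ^^ k) E 0 / fact k))))) {0..2 * pi}"
    unfolding m_def
    by (intro has_integral_add has_integral_sum has_integral_mult_right boundary_integral_holomorphic boundary_integral_power disc_eval_holomorphic E) auto
  moreover have "m (cis s) * E (\<zeta> s) * L' s + (\<Sum>k\<le>N. F k * of_real (lam * fact k / pi ^ (k + 1)) * (E (\<zeta> s) / \<zeta> s ^ k * L' s))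
    = (\<Sum>k\<le>N. F k * b k s)" for s
    unfolding m_cis b_def inc_gamma_shift[of _ _ lam] sum_distrib_right sum.distrib[symmetric]
    by (intro sum.cong refl) (simp add: distrib_right add_divide_distrib distrib_left mult_ac)
  ultimately have B: "((\<lambda>s. \<Sum>k\<le>N. F k * b k s) has_integral
     (2 * pi * \<i> * (m 0 * E 0) + (\<Sum>k\<le>N. F k * of_real (lam * fact k / pi ^ (k + 1)) * (2 * pi * \<i> * ((deriv ^^ k) E 0 / fact k))))) {0..2 * pi}"
    by simp
  have b_cont: "continuous_on {0..2 * pi} (b k)" for k
  proof -
    have "continuous_on {0..2 * pi} (\<lambda>s. inc_gamma 0 k (\<zeta> s * cnj (\<zeta> s)))"
      by (intro continuous_on_inc_gamma continuous_intros cont)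
    moreover have "continuous_on {0..2 * pi} (\<lambda>s. E (\<zeta> s))"
      by (rule continuous_on_compose2[OF holomorphic_on_imp_continuous_on[OF E] cont]) auto
    ultimately show ?thesis unfolding b_def[abs_def]
      using \<zeta>_nz by (intro continuous_intros L'_cont cont) auto
  qed
  have "(\<Sum>k\<le>N. F k * integral {0..2 * pi} (b k)) = integral {0..2 * pi} (\<lambda>s. \<Sum>k\<le>N. F k * b k s)"
    by (subst Henstock_Kurzweil_Integration.integral_sum)
       (auto intro!: integrable_continuous_interval continuous_intros b_cont)
  also have "\<dots> = 2 * pi * \<i> * (m 0 * E 0) + (\<Sum>k\<le>N. F k * of_real (lam * fact k / pi ^ (k + 1)) * (2 * pi * \<i> * ((deriv ^^ k) E 0 / fact k)))"
    using B by (rule integral_unique)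
  also have "\<dots> = 2 * \<i> * (pi * (m 0 * E 0) + lam * (\<Sum>k\<le>N. F k * (deriv ^^ k) E 0 / pi ^ k))"
    by (simp add: distrib_left sum_distrib_left sum_divide_distrib mult_ac)
  finally have "2 * \<i> * (\<Sum>k\<le>N. F k * integral {0..1} (\<lambda>\<tau>. integral {0..2 * pi} (h k \<tau>))) =
      2 * \<i> * (pi * (m 0 * E 0) + lam * (\<Sum>k\<le>N. F k * (deriv ^^ k) E 0 / pi ^ k))"
    unfolding green[symmetric] by (simp add: sum_distrib_left mult_ac)
  then have "(\<Sum>k\<le>N. F k * integral {0..1} (\<lambda>\<tau>. integral {0..2 * pi} (h k \<tau>))) =
      pi * (m 0 * E 0) + lam * (\<Sum>k\<le>N. F k * (deriv ^^ k) E 0 / pi ^ k)" by simp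
  moreover have "integral {0..1} (\<lambda>\<tau>. integral {0..2 * pi} (\<lambda>s. \<Sum>k\<le>N. F k * h k \<tau> s))
    = (\<Sum>k\<le>N. F k * integral {0..1} (\<lambda>\<tau>. integral {0..2 * pi} (h k \<tau>)))"
  proof -
    have inner: "integral {0..2 * pi} (\<lambda>s. \<Sum>k\<le>N. F k * h k \<tau> s) = (\<Sum>k\<le>N. F k * integral {0..2 * pi} (h k \<tau>))"
      if "\<tau> \<in> {0..1}" for \<tau>
    proof -
      have "continuous_on {0..2 * pi} (h k \<tau>)" for k
      proof -
        have "continuous_on {0..2 * pi} (\<lambda>s. (\<lambda>(\<tau>, s). h k \<tau> s) (\<tau>, s))"
          by (rule continuous_on_compose2[OF h_cont[of k] continuous_on_Pair[OF continuous_on_const continuous_on_id]])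
             (use that in auto)
        then show ?thesis by simp
      qed
      then show ?thesis
        by (subst Henstock_Kurzweil_Integration.integral_sum)
           (auto intro!: integrable_continuous_interval continuous_intros)
    qed
    have "continuous_on {0..1} (\<lambda>\<tau>. integral {0..2 * pi} (h k \<tau>))" for k
      using integral_continuous_on_param[of "{0..1}" 0 "2 * pi" "h k"] h_cont[of k] by simp
    then have "integral {0..1} (\<lambda>\<tau>. \<Sum>k\<le>N. F k * integral {0..2 * pi} (h k \<tau>)) =
        (\<Sum>k\<le>N. F k * integral {0..1} (\<lambda>\<tau>. integral {0..2 * pi} (h k \<tau>)))"
      by (subst Henstock_Kurzweil_Integration.integral_sum)
         (auto intro!: integrable_continuous_interval continuous_intros)
    moreover have "integral {0..1} (\<lambda>\<tau>. integral {0..2 * pi} (\<lambda>s. \<Sum>k\<le>N. F k * h k \<tau> s)) =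
        integral {0..1} (\<lambda>\<tau>. \<Sum>k\<le>N. F k * integral {0..2 * pi} (h k \<tau>))"
      by (rule integral_cong) (rule inner)
    ultimately show ?thesis by (rule trans[rotated])
  qed
  ultimately have "integral {0..1} (\<lambda>\<tau>. integral {0..2 * pi} (\<lambda>s. \<Sum>k\<le>N. F k * h k \<tau> s)) =
      pi * (m 0 * E 0) + lam * (\<Sum>k\<le>N. F k * (deriv ^^ k) E 0 / pi ^ k)" by simp
  then show ?thesis
    unfolding z J h_def by (simp add: m_def disc_eval_0 sum_distrib_right mult.assoc)
qed

section \<open>Change of variables in the plane\<close>

text \<open>The change of variables theorem is stated for \<open>real ^ 2\<close>, the phase plane is \<open>real \<times> real\<close>; the
  obvious isomorphism preserves Lebesgue measure and transports the theorem.\<close>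

abbreviation vpair :: "real ^ 2 \<Rightarrow> real \<times> real" where "vpair v \<equiv> (v $ 1, v $ 2)"

abbreviation pvec :: "real \<times> real \<Rightarrow> real ^ 2" where "pvec p \<equiv> vector [fst p, snd p]"

lemma vpair_pvec [simp]: "vpair (pvec p) = p" "pvec (vpair v) = v"
  by (simp_all add: vec_eq_iff forall_2)

lemma vpair_measurable [measurable]: "vpair \<in> borel_measurable borel"
  by (intro borel_measurable_continuous_onI continuous_intros)

lemma lborel_vpair: "distr lborel borel vpair = lborel"
proof (rule lborel_eqI[symmetric])
  fix l u :: "real \<times> real"
  assume le: "\<And>b. b \<in> Basis \<Longrightarrow> l \<bullet> b \<le> u \<bullet> b"
  have l12: "fst l \<le> fst u" "snd l \<le> snd u"
    using le[of "(1, 0)"] le[of "(0, 1)"] by (auto simp: Basis_prod_def inner_prod_def)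
  have B2: "(Basis :: (real ^ 2) set) = {axis 1 1, axis 2 1}"
    by (auto simp: Basis_vec_def UNIV_2)
  have Bp: "(Basis :: (real \<times> real) set) = {(1, 0), (0, 1)}"
    by (auto simp: Basis_prod_def)
  have ne: "axis 1 1 \<noteq> (axis 2 1 :: real ^ 2)" by (simp add: axis_eq_axis)
  have "vpair -` box l u = box (pvec l) (pvec u)"
    by (auto simp: box_def B2 Bp inner_axis inner_prod_def)
  then have "emeasure (distr lborel borel vpair) (box l u) = emeasure lborel (box (pvec l) (pvec u))"
    by (subst emeasure_distr) auto
  also have "\<dots> = ennreal (\<Prod>b\<in>Basis. (pvec u - pvec l) \<bullet> b)"
    by (rule emeasure_lborel_box) (auto simp: B2 inner_axis l12)
  also have "(\<Prod>b\<in>Basis. (pvec u - pvec l) \<bullet> b) = (\<Prod>b\<in>Basis. (u - l) \<bullet> b)"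
    by (simp add: B2 Bp ne inner_axis inner_prod_def)
  finally show "emeasure (distr lborel borel vpair) (box l u) = ennreal (\<Prod>b\<in>Basis. (u - l) \<bullet> b)" .
qed simp

lemma set_integrable_vpair:
  fixes g :: "real \<times> real \<Rightarrow> real"
  assumes m: "(\<lambda>q. indicator A q *\<^sub>R g q) \<in> borel_measurable borel"
  shows "set_integrable lborel A g \<longleftrightarrow> (\<lambda>v. g (vpair v)) absolutely_integrable_on (vpair -` A)"
    and "set_integrable lborel A g \<Longrightarrow> set_lebesgue_integral lborel A g = integral (vpair -` A) (\<lambda>v. g (vpair v))"
proof -
  let ?h = "\<lambda>q. indicator A q *\<^sub>R g q"
  have ind: "indicator (vpair -` A) v *\<^sub>R g (vpair v) = ?h (vpair v)" for v
    by (simp add: indicator_def)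
  have m2: "(\<lambda>v. ?h (vpair v)) \<in> borel_measurable lborel"
    using measurable_compose[OF vpair_measurable m] by simp
  have "integrable lborel ?h \<longleftrightarrow> integrable (distr lborel borel vpair) ?h"
    unfolding lborel_vpair ..
  also have "\<dots> \<longleftrightarrow> integrable lborel (\<lambda>v. ?h (vpair v))"
    by (rule integrable_distr_eq) (use m in auto)
  also have "\<dots> \<longleftrightarrow> integrable lebesgue (\<lambda>v. ?h (vpair v))"
    by (rule integrable_completion[OF m2, symmetric])
  finally show iff: "set_integrable lborel A g \<longleftrightarrow> (\<lambda>v. g (vpair v)) absolutely_integrable_on (vpair -` A)"
    unfolding set_integrable_def ind .
  assume "set_integrable lborel A g"
  then have abs: "(\<lambda>v. g (vpair v)) absolutely_integrable_on (vpair -` A)" using iff by simp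
  have "integral\<^sup>L lborel ?h = integral\<^sup>L (distr lborel borel vpair) ?h"
    unfolding lborel_vpair ..
  also have "\<dots> = (LINT v|lborel. ?h (vpair v))"
    by (rule integral_distr) (use m in auto)
  also have "\<dots> = (LINT v|lebesgue. ?h (vpair v))"
    by (rule integral_completion[OF m2, symmetric])
  also have "\<dots> = integral (vpair -` A) (\<lambda>v. g (vpair v))"
    using set_lebesgue_integral_eq_integral(2)[OF abs] unfolding set_lebesgue_integral_def ind .
  finally show "set_lebesgue_integral lborel A g = integral (vpair -` A) (\<lambda>v. g (vpair v))"
    unfolding set_lebesgue_integral_def .
qed

lemma vpair_has_derivative: "(vpair has_derivative vpair) F"
  by (rule bounded_linear_imp_has_derivative) (intro bounded_linear_Pair bounded_linear_vec_nth)

lemma bounded_linear_pvec: "bounded_linear pvec"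
proof (rule linear_conv_bounded_linear[THEN iffD1], rule linearI)
  fix p q :: "real \<times> real" and r :: real
  show "pvec (p + q) = pvec p + pvec q" by (simp add: vec_eq_iff forall_2)
  show "pvec (r *\<^sub>R p) = r *\<^sub>R pvec p" by (simp add: vec_eq_iff forall_2)
qed

lemma change_of_variables_plane_real:
  fixes \<Gamma> :: "real \<times> real \<Rightarrow> real \<times> real" and f :: "real \<times> real \<Rightarrow> real"
  assumes S: "S \<in> sets borel"
    and der: "\<And>q. q \<in> S \<Longrightarrow> (\<Gamma> has_derivative \<Gamma>' q) (at q within S)"
    and inj: "inj_on \<Gamma> S"
    and J: "\<And>q. q \<in> S \<Longrightarrow> J q = \<bar>fst (\<Gamma>' q (1, 0)) * snd (\<Gamma>' q (0, 1)) - fst (\<Gamma>' q (0, 1)) * snd (\<Gamma>' q (1, 0))\<bar>"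
    and img: "\<Gamma> ` S \<in> sets borel"
    and f: "f \<in> borel_measurable borel"
    and int: "set_integrable lborel S (\<lambda>q. J q * f (\<Gamma> q))"
  shows "set_integrable lborel (\<Gamma> ` S) f"
    and "set_lebesgue_integral lborel (\<Gamma> ` S) f = set_lebesgue_integral lborel S (\<lambda>q. J q * f (\<Gamma> q))"
proof -
  define S2 where "S2 = vpair -` S"
  define G where "G v = pvec (\<Gamma> (vpair v))" for v
  define G' where "G' v h = pvec (\<Gamma>' (vpair v) (vpair h))" for v h
  have S2: "S2 \<in> sets lebesgue"
  proof -
    have "vpair -` S \<inter> space borel \<in> sets borel" using S by (intro measurable_sets[OF vpair_measurable])
    then show ?thesis by (simp add: S2_def sets_completionI_sets)
  qed
  have derG: "(G has_derivative G' v) (at v within S2)" if "v \<in> S2" for v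
  proof -
    have v: "vpair v \<in> S" using that by (simp add: S2_def)
    have "vpair ` S2 \<subseteq> S" by (auto simp: S2_def)
    from has_derivative_subset[OF der[OF v] this]
    have "((\<lambda>v. \<Gamma> (vpair v)) has_derivative (\<lambda>h. \<Gamma>' (vpair v) (vpair h))) (at v within S2)"
      using diff_chain_within[OF vpair_has_derivative] by (simp add: comp_def)
    then show ?thesis
      unfolding G_def[abs_def] G'_def[abs_def] by (rule bounded_linear.has_derivative[OF bounded_linear_pvec])
  qed
  have injG: "inj_on G S2"
    unfolding inj_on_def G_def
  proof (intro ballI impI)
    fix v w assume vw: "v \<in> S2" "w \<in> S2" "pvec (\<Gamma> (vpair v)) = pvec (\<Gamma> (vpair w))"
    then have "\<Gamma> (vpair v) = \<Gamma> (vpair w)" by (metis vpair_pvec(1))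
    then have "vpair v = vpair w" using inj vw by (auto simp: S2_def dest: inj_onD)
    then show "v = w" by (metis vpair_pvec(2))
  qed
  have detG: "\<bar>det (matrix (G' v))\<bar> = J (vpair v)" if "v \<in> S2" for v
  proof -
    have a: "axis 1 1 $ (2::2) = (0::real)" "axis 2 1 $ (1::2) = (0::real)" by (simp_all add: axis_def)
    show ?thesis
      using that unfolding det_2 matrix_def by (subst J) (auto simp: S2_def G'_def a)
  qed
  have imgG: "G ` S2 = vpair -` (\<Gamma> ` S)"
  proof (intro equalityI subsetI)
    fix w assume "w \<in> vpair -` (\<Gamma> ` S)"
    then obtain q where q: "q \<in> S" "vpair w = \<Gamma> q" by auto
    have "pvec q \<in> S2" using q by (simp add: S2_def)
    moreover have "G (pvec q) = w" unfolding G_def vpair_pvec q(2)[symmetric] ..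
    ultimately show "w \<in> G ` S2" by blast
  qed (auto simp: G_def S2_def)
  have m1: "(\<lambda>q. indicator S q *\<^sub>R (J q * f (\<Gamma> q))) \<in> borel_measurable borel"
    using borel_measurable_integrable[OF int[unfolded set_integrable_def]] by simp
  have m2: "(\<lambda>q. indicator (\<Gamma> ` S) q *\<^sub>R f q) \<in> borel_measurable borel"
    using img f by (intro borel_measurable_scaleR borel_measurable_indicator)
  have A: "(\<lambda>v. J (vpair v) * f (\<Gamma> (vpair v))) absolutely_integrable_on S2"
    using set_integrable_vpair(1)[OF m1] int by (simp add: S2_def)
  let ?b = "integral S2 (\<lambda>v. J (vpair v) * f (\<Gamma> (vpair v)))"
  let ?f2 = "\<lambda>v. vec (f (vpair v)) :: real ^ 1"
  have eq: "\<bar>det (matrix (G' v))\<bar> *\<^sub>R ?f2 (G v) = vec (J (vpair v) * f (\<Gamma> (vpair v)))" if "v \<in> S2" for v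
    using detG[OF that] by (simp add: G_def vec_eq_iff)
  have "(\<lambda>v. \<bar>det (matrix (G' v))\<bar> *\<^sub>R ?f2 (G v)) absolutely_integrable_on S2 \<and>
      integral S2 (\<lambda>v. \<bar>det (matrix (G' v))\<bar> *\<^sub>R ?f2 (G v)) = vec ?b"
  proof
    have "(\<lambda>v. vec (J (vpair v) * f (\<Gamma> (vpair v))) :: real ^ 1) absolutely_integrable_on S2"
      using A by (simp add: absolutely_integrable_on_1_iff)
    then show "(\<lambda>v. \<bar>det (matrix (G' v))\<bar> *\<^sub>R ?f2 (G v)) absolutely_integrable_on S2"
      using absolutely_integrable_spike_eq[of "{}" S2] eq by (smt (verit) DiffE negligible_empty set_integrable_cong)
    have "integral S2 (\<lambda>v. \<bar>det (matrix (G' v))\<bar> *\<^sub>R ?f2 (G v)) = integral S2 (\<lambda>v. vec (J (vpair v) * f (\<Gamma> (vpair v))) :: real ^ 1)"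
      by (rule integral_cong) (rule eq)
    then show "integral S2 (\<lambda>v. \<bar>det (matrix (G' v))\<bar> *\<^sub>R ?f2 (G v)) = vec ?b"
      by (simp add: integral_on_1_eq)
  qed
  then have "?f2 absolutely_integrable_on (G ` S2) \<and> integral (G ` S2) ?f2 = vec ?b"
    using has_absolute_integral_change_of_variables[OF S2 derG injG] by blast
  then have B: "(\<lambda>v. f (vpair v)) absolutely_integrable_on (vpair -` (\<Gamma> ` S))"
      "integral (vpair -` (\<Gamma> ` S)) (\<lambda>v. f (vpair v)) = ?b"
    unfolding imgG by (simp_all add: absolutely_integrable_on_1_iff integral_on_1_eq vec_eq_iff)
  show int': "set_integrable lborel (\<Gamma> ` S) f"
    using set_integrable_vpair(1)[OF m2] B(1) by simp
  show "set_lebesgue_integral lborel (\<Gamma> ` S) f = set_lebesgue_integral lborel S (\<lambda>q. J q * f (\<Gamma> q))"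
    using set_integrable_vpair(2)[OF m2 int'] set_integrable_vpair(2)[OF m1 int] B(2) by (simp add: S2_def)
qed

lemma change_of_variables_plane:
  fixes \<Gamma> :: "real \<times> real \<Rightarrow> real \<times> real" and f :: "real \<times> real \<Rightarrow> complex"
  assumes S: "S \<in> sets borel"
    and der: "\<And>q. q \<in> S \<Longrightarrow> (\<Gamma> has_derivative \<Gamma>' q) (at q within S)"
    and inj: "inj_on \<Gamma> S"
    and J: "\<And>q. q \<in> S \<Longrightarrow> J q = \<bar>fst (\<Gamma>' q (1, 0)) * snd (\<Gamma>' q (0, 1)) - fst (\<Gamma>' q (0, 1)) * snd (\<Gamma>' q (1, 0))\<bar>"
    and img: "\<Gamma> ` S \<in> sets borel"
    and f: "f \<in> borel_measurable borel"
    and int: "set_integrable lborel S (\<lambda>q. of_real (J q) * f (\<Gamma> q))"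
  shows "set_lebesgue_integral lborel (\<Gamma> ` S) f = set_lebesgue_integral lborel S (\<lambda>q. of_real (J q) * f (\<Gamma> q))"
proof -
  let ?g = "\<lambda>q. indicator S q *\<^sub>R (of_real (J q) * f (\<Gamma> q))"
  let ?h = "\<lambda>q. indicator (\<Gamma> ` S) q *\<^sub>R f q"
  have gi: "integrable lborel ?g" using int by (simp add: set_integrable_def)
  have re: "set_integrable lborel S (\<lambda>q. J q * Re (f (\<Gamma> q)))"
    and im: "set_integrable lborel S (\<lambda>q. J q * Im (f (\<Gamma> q)))"
    using integrable_Re[OF gi] integrable_Im[OF gi] by (simp_all add: set_integrable_def)
  have fm: "(\<lambda>q. Re (f q)) \<in> borel_measurable borel" "(\<lambda>q. Im (f q)) \<in> borel_measurable borel"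
    using f by (auto intro: borel_measurable_Re borel_measurable_Im)
  note R = change_of_variables_plane_real[OF S der inj J img fm(1) re]
  note I = change_of_variables_plane_real[OF S der inj J img fm(2) im]
  have hi: "integrable lborel ?h"
  proof -
    have "integrable lborel (\<lambda>q. complex_of_real (indicator (\<Gamma> ` S) q *\<^sub>R Re (f q)) + \<i> * complex_of_real (indicator (\<Gamma> ` S) q *\<^sub>R Im (f q)))"
      using R(1) I(1) unfolding set_integrable_def
      by (intro Bochner_Integration.integrable_add integrable_mult_right integrable_of_real)
    moreover have "complex_of_real (indicator (\<Gamma> ` S) q *\<^sub>R Re (f q)) + \<i> * complex_of_real (indicator (\<Gamma> ` S) q *\<^sub>R Im (f q)) = ?h q" for q
      by (rule complex_eqI) simp_all
    ultimately show ?thesis by simp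
  qed
  show ?thesis
  proof (rule complex_eqI)
    show "Re (set_lebesgue_integral lborel (\<Gamma> ` S) f) = Re (set_lebesgue_integral lborel S (\<lambda>q. of_real (J q) * f (\<Gamma> q)))"
      using R(2) integral_Re[OF hi] integral_Re[OF gi] by (simp add: set_lebesgue_integral_def)
    show "Im (set_lebesgue_integral lborel (\<Gamma> ` S) f) = Im (set_lebesgue_integral lborel S (\<lambda>q. of_real (J q) * f (\<Gamma> q)))"
      using I(2) integral_Im[OF hi] integral_Im[OF gi] by (simp add: set_lebesgue_integral_def)
  qed
qed

section \<open>Hermite functions and the short-time Fourier transform\<close>

text \<open>The polynomial factor in the derivatives of \<open>exp (- 2 pi t\<^sup>2)\<close>. The type is left open because the
  generating function of the Hermite functions evaluates it at complex points.\<close>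

primrec hermite_poly :: "nat \<Rightarrow> 'a::real_normed_field poly" where
  "hermite_poly 0 = 1"
| "hermite_poly (Suc k) = pderiv (hermite_poly k) - [:0, of_real (4 * pi):] * hermite_poly k"

definition gauss_deriv :: "nat \<Rightarrow> 'a \<Rightarrow> 'a::{real_normed_field,banach}" where
  "gauss_deriv k t = poly (hermite_poly k) t * exp (- (of_real (2 * pi) * t\<^sup>2))"

lemma gauss_deriv_has_field_derivative: "(gauss_deriv k has_field_derivative gauss_deriv (Suc k) t) (at t)"
  unfolding gauss_deriv_def[abs_def]
  by (rule derivative_eq_intros refl poly_DERIV)+ (simp add: algebra_simps)

lemma hermite_poly_of_real: "hermite_poly k = map_poly complex_of_real (hermite_poly k)"
proof (induction k)
  case (Suc k)
  show ?case
  proof (rule poly_eqI)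
    fix n
    show "coeff (hermite_poly (Suc k)) n = coeff (map_poly complex_of_real (hermite_poly (Suc k))) n"
      by (cases n) (simp_all add: Suc coeff_map_poly coeff_pderiv)
  qed
qed simp

lemma poly_map_poly_of_real: "poly (map_poly complex_of_real p) (of_real t) = of_real (poly p t)"
  by (induction p) (simp_all add: map_poly_pCons)

lemma gauss_deriv_of_real: "gauss_deriv k (complex_of_real t) = of_real (gauss_deriv k t)"
  unfolding gauss_deriv_def hermite_poly_of_real
  by (simp add: poly_map_poly_of_real flip: exp_of_real)

lemma deriv_gauss: "(deriv ^^ k) (\<lambda>s. exp (- 2 * pi * s\<^sup>2)) = gauss_deriv k"
proof (induction k)
  case (Suc k)
  then show ?case
    by (auto intro!: DERIV_imp_deriv gauss_deriv_has_field_derivative)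
qed (simp add: gauss_deriv_def fun_eq_iff)

lemma hermite_raw_eq: "hermite_raw k t = (-1) ^ k * exp (pi * t\<^sup>2) * gauss_deriv k t"
  unfolding hermite_raw_def deriv_gauss ..

lemma hermite_raw_poly: "hermite_raw k t = (-1) ^ k * poly (hermite_poly k) t * exp (- (pi * t\<^sup>2))"
proof -
  have "exp (pi * t\<^sup>2) * exp (- (2 * pi * t\<^sup>2)) = exp (- (pi * t\<^sup>2))"
    unfolding exp_add[symmetric] by (simp add: algebra_simps)
  then show ?thesis by (simp add: hermite_raw_eq gauss_deriv_def)
qed

lemma poly_exp_bound:
  fixes p :: "real poly"
  shows "\<exists>C m. 0 \<le> C \<and> (\<forall>t. \<bar>poly p t\<bar> \<le> C * exp (real m * \<bar>t\<bar>))"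
proof (induction p)
  case 0
  show ?case by (intro exI[of _ 0]) simp
next
  case (pCons a p)
  then obtain C m where C: "0 \<le> C" "\<And>t. \<bar>poly p t\<bar> \<le> C * exp (real m * \<bar>t\<bar>)" by blast
  have "\<bar>poly (pCons a p) t\<bar> \<le> (\<bar>a\<bar> + C) * exp (real (Suc m) * \<bar>t\<bar>)" for t
  proof -
    have t: "\<bar>t\<bar> \<le> exp \<bar>t\<bar>" using exp_ge_add_one_self[of "\<bar>t\<bar>"] by linarith
    have "\<bar>poly (pCons a p) t\<bar> \<le> \<bar>a\<bar> + \<bar>t\<bar> * \<bar>poly p t\<bar>"
      by (simp add: abs_mult[symmetric] abs_triangle_ineq)
    also have "\<dots> \<le> \<bar>a\<bar> * exp (real (Suc m) * \<bar>t\<bar>) + exp \<bar>t\<bar> * (C * exp (real m * \<bar>t\<bar>))"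
      using C t by (intro add_mono mult_mono) (auto simp: mult_le_cancel_left1)
    also have "\<dots> = (\<bar>a\<bar> + C) * exp (real (Suc m) * \<bar>t\<bar>)"
      by (simp add: algebra_simps exp_add)
    finally show ?thesis .
  qed
  then show ?case using C(1) by (intro exI[of _ "\<bar>a\<bar> + C"] exI[of _ "Suc m"]) auto
qed

text \<open>A polynomial grows at most exponentially, and \<open>a \<bar>t\<bar> \<le> pi t\<^sup>2 + a\<^sup>2 / (4 pi)\<close> absorbs every
  exponential factor into half of the Gaussian exponent.\<close>

lemma poly_gauss_bound:
  fixes p :: "real poly" and c :: real
  shows "\<exists>C\<ge>0. \<forall>t. \<bar>poly p t\<bar> * exp (c * \<bar>t\<bar>) * exp (- (2 * pi * t\<^sup>2)) \<le> C * exp (- (pi * t\<^sup>2))"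
proof -
  obtain C m where C: "0 \<le> C" "\<And>t. \<bar>poly p t\<bar> \<le> C * exp (real m * \<bar>t\<bar>)"
    using poly_exp_bound by blast
  define a where "a = real m + c"
  have "\<bar>poly p t\<bar> * exp (c * \<bar>t\<bar>) * exp (- (2 * pi * t\<^sup>2)) \<le> (C * exp (a\<^sup>2 / (4 * pi))) * exp (- (pi * t\<^sup>2))" for t
  proof -
    have "0 \<le> (2 * pi * \<bar>t\<bar> - a)\<^sup>2" by simp
    then have "4 * pi * (a * \<bar>t\<bar>) \<le> 4 * pi * (pi * t\<^sup>2) + a\<^sup>2"
      by (simp add: power2_eq_square algebra_simps)
    then have le: "a * \<bar>t\<bar> \<le> pi * t\<^sup>2 + a\<^sup>2 / (4 * pi)"
      by (simp add: field_simps)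
    have "\<bar>poly p t\<bar> * exp (c * \<bar>t\<bar>) * exp (- (2 * pi * t\<^sup>2))
      \<le> (C * exp (real m * \<bar>t\<bar>)) * exp (c * \<bar>t\<bar>) * exp (- (2 * pi * t\<^sup>2))"
      using C(2) by (intro mult_right_mono) auto
    also have "\<dots> = C * exp (a * \<bar>t\<bar> - 2 * pi * t\<^sup>2)"
      by (simp add: a_def exp_add[symmetric] mult.assoc algebra_simps)
    also have "\<dots> \<le> C * exp (a\<^sup>2 / (4 * pi) - pi * t\<^sup>2)"
      using le C(1) by (intro mult_left_mono) auto
    also have "\<dots> = (C * exp (a\<^sup>2 / (4 * pi))) * exp (- (pi * t\<^sup>2))"
      by (simp add: mult.assoc flip: exp_add)
    finally show ?thesis .
  qed
  then show ?thesis using C(1) by (intro exI[of _ "C * exp (a\<^sup>2 / (4 * pi))"]) auto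
qed

lemma integrable_gauss: "0 < c \<Longrightarrow> integrable lborel (\<lambda>t::real. exp (- (c * t\<^sup>2)))"
proof -
  assume c: "0 < c"
  define \<sigma> where "\<sigma> = 1 / sqrt (2 * c)"
  have \<sigma>: "0 < \<sigma>" "2 * \<sigma>\<^sup>2 = 1 / c" using c by (auto simp: \<sigma>_def power_divide)
  have "integrable lborel (\<lambda>x. sqrt (2 * pi * \<sigma>\<^sup>2) * (normal_density 0 \<sigma> x * (x - 0) ^ 0))"
    using \<sigma> by (intro integrable_mult_right integrable_normal_moment)
  moreover have "sqrt (2 * pi * \<sigma>\<^sup>2) * (normal_density 0 \<sigma> x * (x - 0) ^ 0) = exp (- (c * x\<^sup>2))" for x
  proof -
    have "sqrt (2 * pi * \<sigma>\<^sup>2) \<noteq> 0" using \<sigma>(1) by simp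
    then show ?thesis unfolding normal_density_def using \<sigma> c by (simp add: divide_simps mult.commute)
  qed
  ultimately show ?thesis by (simp only:)
qed

text \<open>The integrand of the two-sided Laplace transform of a derivative of the Gaussian. The short-time
  Fourier transform of a Hermite function is this transform at \<open>\<zeta> = x - \<i> \<omega>\<close>.\<close>

definition gauss_exp :: "nat \<Rightarrow> complex \<Rightarrow> real \<Rightarrow> complex" where
  "gauss_exp k \<zeta> t = of_real (gauss_deriv k t) * exp (of_real (2 * pi * t) * \<zeta>)"

lemma gauss_exp_bound: "\<exists>C\<ge>0. \<forall>t. cmod (gauss_exp k \<zeta> t) \<le> C * exp (- (pi * t\<^sup>2))"
proof -
  obtain C where C: "0 \<le> C" "\<And>t. \<bar>poly (hermite_poly k) t\<bar> * exp ((2 * pi * \<bar>Re \<zeta>\<bar>) * \<bar>t\<bar>) * exp (- (2 * pi * t\<^sup>2)) \<le> C * exp (- (pi * t\<^sup>2))"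
    using poly_gauss_bound by meson
  have "cmod (gauss_exp k \<zeta> t) \<le> C * exp (- (pi * t\<^sup>2))" for t
  proof -
    have "2 * pi * t * Re \<zeta> \<le> (2 * pi * \<bar>Re \<zeta>\<bar>) * \<bar>t\<bar>"
      using abs_ge_self[of "t * Re \<zeta>"] by (simp add: abs_mult mult.commute mult.left_commute)
    then have "exp (2 * pi * t * Re \<zeta>) \<le> exp ((2 * pi * \<bar>Re \<zeta>\<bar>) * \<bar>t\<bar>)" by simp
    then have "cmod (gauss_exp k \<zeta> t) \<le> \<bar>poly (hermite_poly k) t\<bar> * exp (- (2 * pi * t\<^sup>2)) * exp ((2 * pi * \<bar>Re \<zeta>\<bar>) * \<bar>t\<bar>)"
      unfolding gauss_exp_def gauss_deriv_def by (simp add: norm_mult abs_mult mult_left_mono)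
    also have "\<dots> \<le> C * exp (- (pi * t\<^sup>2))" using C(2)[of t] by (simp add: ac_simps)
    finally show ?thesis .
  qed
  with C(1) show ?thesis by blast
qed

lemma gauss_exp_has_vector_derivative:
  fixes \<zeta> :: complex
  shows "(gauss_exp k \<zeta> has_vector_derivative gauss_exp (Suc k) \<zeta> t + 2 * pi * \<zeta> * gauss_exp k \<zeta> t) (at t)"
proof -
  have "((\<lambda>w. gauss_deriv k w * exp (2 * pi * w * \<zeta>)) has_field_derivative
      gauss_deriv (Suc k) (of_real t) * exp (2 * pi * of_real t * \<zeta>)
      + 2 * pi * \<zeta> * (gauss_deriv k (of_real t) * exp (2 * pi * of_real t * \<zeta>))) (at (complex_of_real t))"
    by (rule derivative_eq_intros refl gauss_deriv_has_field_derivative)+ (simp add: algebra_simps)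
  from has_vector_derivative_real_field[OF this]
  show ?thesis by (simp add: gauss_exp_def[abs_def] gauss_deriv_of_real comp_def)
qed

lemma continuous_gauss_exp: "continuous_on UNIV (gauss_exp k \<zeta>)"
  by (rule continuous_at_imp_continuous_on) (auto intro: has_vector_derivative_continuous[OF gauss_exp_has_vector_derivative])

lemma gauss_exp_measurable [measurable]: "gauss_exp k \<zeta> \<in> borel_measurable borel"
  by (rule borel_measurable_continuous_onI[OF continuous_gauss_exp])

lemma integrable_gauss_exp: "integrable lborel (gauss_exp k \<zeta>)"
proof -
  obtain C where C: "0 \<le> C" "\<And>t. cmod (gauss_exp k \<zeta> t) \<le> C * exp (- (pi * t\<^sup>2))"
    using gauss_exp_bound by meson
  show ?thesis
    by (rule Bochner_Integration.integrable_bound[OF integrable_mult_right[OF integrable_gauss[of pi], of C]])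
       (use C in \<open>auto simp: abs_mult\<close>)
qed

lemma gauss_tendsto_0: "((\<lambda>t::real. C * exp (- (pi * t\<^sup>2))) \<longlongrightarrow> 0) at_top" "((\<lambda>t::real. C * exp (- (pi * t\<^sup>2))) \<longlongrightarrow> 0) at_bot"
proof -
  have "((\<lambda>t::real. exp (- (pi * t\<^sup>2))) \<longlongrightarrow> 0) at_top" by real_asymp
  then show "((\<lambda>t::real. C * exp (- (pi * t\<^sup>2))) \<longlongrightarrow> 0) at_top" by (rule tendsto_mult_right_zero)
  have "((\<lambda>t::real. exp (- (pi * t\<^sup>2))) \<longlongrightarrow> 0) at_bot" by real_asymp
  then show "((\<lambda>t::real. C * exp (- (pi * t\<^sup>2))) \<longlongrightarrow> 0) at_bot" by (rule tendsto_mult_right_zero)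
qed

text \<open>Integration by parts; the boundary terms at infinity vanish by Gaussian decay.\<close>

lemma gauss_exp_integral_Suc:
  fixes \<zeta> :: complex
  shows "(LINT t|lborel. gauss_exp (Suc k) \<zeta> t) = - (2 * pi * \<zeta>) * (LINT t|lborel. gauss_exp k \<zeta> t)"
proof -
  let ?f = "\<lambda>t. gauss_exp (Suc k) \<zeta> t + 2 * pi * \<zeta> * gauss_exp k \<zeta> t"
  obtain C where C: "0 \<le> C" "\<And>t. cmod (gauss_exp k \<zeta> t) \<le> C * exp (- (pi * t\<^sup>2))"
    using gauss_exp_bound by meson
  have int: "integrable lborel ?f" by (intro Bochner_Integration.integrable_add integrable_mult_right integrable_gauss_exp)
  have "(LBINT t=-\<infinity>..\<infinity>. ?f t) = 0 - 0"
  proof (rule interval_integral_FTC_integrable)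
    show "(gauss_exp k \<zeta> has_vector_derivative ?f t) (at t)" for t by (rule gauss_exp_has_vector_derivative)
    show "isCont ?f t" for t
      using continuous_gauss_exp by (intro continuous_intros) (auto simp: continuous_on_eq_continuous_at)
    show "set_integrable lborel (einterval (-\<infinity>) \<infinity>) ?f"
      using int by (simp add: set_integrable_def)
    have *: "(gauss_exp k \<zeta> \<longlongrightarrow> 0) at_top" "(gauss_exp k \<zeta> \<longlongrightarrow> 0) at_bot"
      by (rule Lim_null_comparison[OF always_eventually gauss_tendsto_0(1)[of C]], use C in blast)
         (rule Lim_null_comparison[OF always_eventually gauss_tendsto_0(2)[of C]], use C in blast)
    show "((gauss_exp k \<zeta> \<circ> real_of_ereal) \<longlongrightarrow> 0) (at_right (-\<infinity>))"
      using *(2) by (simp add: ereal_tendsto_simps1)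
    show "((gauss_exp k \<zeta> \<circ> real_of_ereal) \<longlongrightarrow> 0) (at_left \<infinity>)"
      using *(1) by (simp add: ereal_tendsto_simps1)
  qed simp
  then have "(LINT t|lborel. ?f t) = 0"
    by (simp add: interval_lebesgue_integral_def set_lebesgue_integral_def)
  then have "(LINT t|lborel. gauss_exp (Suc k) \<zeta> t) + 2 * pi * \<zeta> * (LINT t|lborel. gauss_exp k \<zeta> t) = 0"
    using integrable_gauss_exp by (subst (asm) Bochner_Integration.integral_add) auto
  then show ?thesis by (simp add: eq_neg_iff_add_eq_0)
qed

text \<open>The substitution \<open>t = x / 2 + s / (2 sqrt pi)\<close> completes the square and leaves the characteristic
  function of the standard normal distribution.\<close>

lemma gauss_exp_integral_0: "(LINT t|lborel. gauss_exp 0 (Complex x (-\<omega>)) t) = exp (pi * (Complex x (-\<omega>))\<^sup>2 / 2) / sqrt 2"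
proof -
  define \<beta> where "\<beta> = 1 / (2 * sqrt pi)"
  have \<beta>: "0 < \<beta>" "pi * \<beta>\<^sup>2 = 1/4" "2 * pi * \<beta> = sqrt pi"
    by (auto simp: \<beta>_def power_divide field_simps)
  have "char std_normal_distribution (- \<omega> * sqrt pi) = (LINT s|lborel. std_normal_density s *\<^sub>R iexp (- \<omega> * sqrt pi * s))"
    unfolding char_def by (subst integral_density) auto
  then have ch: "(LINT s|lborel. std_normal_density s *\<^sub>R iexp (- \<omega> * sqrt pi * s)) = exp (- (pi * \<omega>\<^sup>2 / 2))"
  proof (rule trans[OF sym])
    have "(- \<omega> * sqrt pi)\<^sup>2 / 2 = pi * \<omega>\<^sup>2 / 2" by (simp add: power_mult_distrib)
    then show "char std_normal_distribution (- \<omega> * sqrt pi) = exp (- (pi * \<omega>\<^sup>2 / 2))"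
      unfolding char_std_normal_distribution by (metis minus_divide_left)
  qed
  define K where "K = exp (of_real (pi / 2) * (Complex x (-\<omega>))\<^sup>2 + of_real (pi * \<omega>\<^sup>2 / 2))"
  have pt: "gauss_exp 0 (Complex x (-\<omega>)) (x / 2 + \<beta> * s) = (sqrt (2 * pi) * K) * (std_normal_density s *\<^sub>R iexp (- \<omega> * sqrt pi * s))" for s
  proof -
    define t where "t = x / 2 + \<beta> * s"
    have re: "- (2 * pi * t\<^sup>2) + 2 * pi * t * x = - (s\<^sup>2 / 2) + (pi / 2 * (x\<^sup>2 - \<omega>\<^sup>2) + pi * \<omega>\<^sup>2 / 2)"
    proof -
      have "2 * pi * (\<beta> * s)\<^sup>2 = s\<^sup>2 / 2" using \<beta>(2) by (simp add: power_mult_distrib mult.assoc[symmetric])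
      then show ?thesis by (simp add: t_def power2_eq_square algebra_simps diff_divide_distrib)
    qed
    have im: "2 * pi * t * \<omega> = pi * x * \<omega> + sqrt pi * s * \<omega>"
    proof -
      have "2 * pi * t * \<omega> = pi * x * \<omega> + (2 * pi * \<beta>) * s * \<omega>" by (simp add: t_def algebra_simps)
      then show ?thesis by (simp only: \<beta>(3))
    qed
    have "of_real (- (2 * pi * t\<^sup>2)) + of_real (2 * pi * t) * Complex x (-\<omega>)
      = of_real (- (s\<^sup>2 / 2)) + (of_real (pi / 2) * (Complex x (-\<omega>))\<^sup>2 + of_real (pi * \<omega>\<^sup>2 / 2)) + \<i> * of_real (- \<omega> * sqrt pi * s)"
      by (rule complex_eqI) (use re im in \<open>simp_all add: Re_power2 Im_power2 mult.commute mult.left_commute\<close>)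
    then have "exp (of_real (- (2 * pi * t\<^sup>2))) * exp (of_real (2 * pi * t) * Complex x (-\<omega>))
      = exp (of_real (- (s\<^sup>2 / 2))) * K * iexp (- \<omega> * sqrt pi * s)"
      unfolding K_def exp_add[symmetric] by (simp only:)
    then have "of_real (exp (- (2 * pi * t\<^sup>2))) * exp (of_real (2 * pi * t) * Complex x (-\<omega>))
      = of_real (exp (- (s\<^sup>2 / 2))) * K * iexp (- \<omega> * sqrt pi * s)"
      unfolding exp_of_real .
    then show ?thesis
      unfolding t_def[symmetric]
      by (simp add: gauss_exp_def gauss_deriv_def std_normal_density_def scaleR_conv_of_real real_sqrt_mult)
  qed
  have "(LINT t|lborel. gauss_exp 0 (Complex x (-\<omega>)) t) = \<bar>\<beta>\<bar> *\<^sub>R (LINT s|lborel. gauss_exp 0 (Complex x (-\<omega>)) (x / 2 + \<beta> * s))"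
    using \<beta>(1) by (intro lborel_integral_real_affine) simp
  also have "\<dots> = \<beta> *\<^sub>R ((sqrt (2 * pi) * K) * exp (- (pi * \<omega>\<^sup>2 / 2)))"
    unfolding pt integral_mult_right_zero ch abs_of_pos[OF \<beta>(1)] ..
  also have "\<dots> = (\<beta> * sqrt (2 * pi)) * (K * exp (- (pi * \<omega>\<^sup>2 / 2)))"
    by (simp add: scaleR_conv_of_real)
  also have "\<beta> * sqrt (2 * pi) = 1 / sqrt 2"
    by (simp add: \<beta>_def real_sqrt_mult field_simps)
  also have "K * exp (- (pi * \<omega>\<^sup>2 / 2)) = exp (pi * (Complex x (-\<omega>))\<^sup>2 / 2)"
    unfolding K_def exp_of_real[symmetric] exp_add[symmetric] by simp
  finally show ?thesis by simp
qed

lemma gauss_exp_integral: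
  "(LINT t|lborel. gauss_exp k (Complex x (-\<omega>)) t) =
    (- (2 * pi * Complex x (-\<omega>))) ^ k * exp (pi * (Complex x (-\<omega>))\<^sup>2 / 2) / sqrt 2"
  by (induction k) (simp_all add: gauss_exp_integral_0 gauss_exp_integral_Suc)

text \<open>With \<open>z = x + \<i> \<omega>\<close> this equals \<open>exp (- pi \<i> x \<omega> - pi \<bar>z\<bar>\<^sup>2 / 2)\<close>, the factor by which the
  Gaussian short-time Fourier transform differs from a Bargmann transform.\<close>

definition bargmann_factor :: "real \<Rightarrow> real \<Rightarrow> complex" where
  "bargmann_factor x \<omega> = exp (- (pi * x\<^sup>2) + pi * (Complex x (-\<omega>))\<^sup>2 / 2)"

lemma STFT_integrand:
  "complex_of_real (hermite_raw k t) * cnj (gauss_window (t - x)) * exp (- 2 * pi * \<i> * t * \<omega>)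
   = of_real (2 powr (1/4) * (-1) ^ k * exp (- (pi * x\<^sup>2))) * gauss_exp k (Complex x (-\<omega>)) t"
proof -
  have "of_real (pi * t\<^sup>2) + of_real (- (pi * (t - x)\<^sup>2)) + (- 2 * pi * \<i> * t * \<omega>)
     = of_real (- (pi * x\<^sup>2)) + of_real (2 * pi * t) * Complex x (-\<omega>)"
    by (rule complex_eqI) (simp_all add: power2_eq_square algebra_simps)
  then have "exp (of_real (pi * t\<^sup>2)) * exp (of_real (- (pi * (t - x)\<^sup>2))) * exp (- 2 * pi * \<i> * t * \<omega>)
     = exp (of_real (- (pi * x\<^sup>2))) * exp (of_real (2 * pi * t) * Complex x (-\<omega>))"
    unfolding exp_add[symmetric] by (simp only:)
  then have "of_real (exp (pi * t\<^sup>2)) * of_real (exp (- (pi * (t - x)\<^sup>2))) * exp (- 2 * pi * \<i> * t * \<omega>)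
     = of_real (exp (- (pi * x\<^sup>2))) * exp (of_real (2 * pi * t) * Complex x (-\<omega>))"
    unfolding exp_of_real .
  then have "of_real (2 powr (1/4) * (-1) ^ k * gauss_deriv k t) *
      (of_real (exp (pi * t\<^sup>2)) * of_real (exp (- (pi * (t - x)\<^sup>2))) * exp (- 2 * pi * \<i> * t * \<omega>))
    = of_real (2 powr (1/4) * (-1) ^ k * gauss_deriv k t) *
      (of_real (exp (- (pi * x\<^sup>2))) * exp (of_real (2 * pi * t) * Complex x (-\<omega>)))"
    by (simp only:)
  then show ?thesis
    unfolding hermite_raw_eq gauss_window_def gauss_exp_def of_real_mult complex_cnj_mult complex_cnj_complex_of_real
      of_real_power of_real_minus of_real_1 mult_minus_left
    by (simp only: ac_simps)
qed

lemma STFT_hermite_raw: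
  "STFT (\<lambda>t. of_real (hermite_raw k t)) x \<omega> =
     2 powr (1/4) / sqrt 2 * (2 * pi * Complex x (-\<omega>)) ^ k * bargmann_factor x \<omega>"
proof -
  let ?c = "2 * pi * Complex x (-\<omega>)"
  have "STFT (\<lambda>t. of_real (hermite_raw k t)) x \<omega>
    = of_real (2 powr (1/4) * (-1) ^ k * exp (- (pi * x\<^sup>2))) * (LINT t|lborel. gauss_exp k (Complex x (-\<omega>)) t)"
    unfolding STFT_def STFT_integrand by (rule integral_mult_right_zero)
  also have "\<dots> = 2 powr (1/4) / sqrt 2 * ((-1) ^ k * (- ?c) ^ k) *
      (of_real (exp (- (pi * x\<^sup>2))) * exp (pi * (Complex x (-\<omega>))\<^sup>2 / 2))"
    unfolding gauss_exp_integral by simp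
  also have "(-1) ^ k * (- ?c) ^ k = ?c ^ k"
    unfolding power_mult_distrib[symmetric] by simp
  also have "of_real (exp (- (pi * x\<^sup>2))) * exp (pi * (Complex x (-\<omega>))\<^sup>2 / 2) = bargmann_factor x \<omega>"
    unfolding bargmann_factor_def exp_of_real[symmetric] exp_add[symmetric] by simp
  finally show ?thesis .
qed


subsection \<open>The generating function\<close>

text \<open>The kernel of the inverse Bargmann transform, and the generating function of the Hermite
  functions (lemma \<open>deriv_hermite_gen_0\<close> below).\<close>

definition hermite_gen :: "real \<Rightarrow> complex \<Rightarrow> complex" where
  "hermite_gen t z = of_real (2 powr (1/4)) * exp (of_real (- (pi * t\<^sup>2)) + of_real (2 * pi * t) * z - of_real (pi / 2) * z\<^sup>2)"

lemma hermite_gen_eq: "hermite_gen t z =  of_real (2 powr (1/4) * exp (pi * t\<^sup>2)) * gauss_deriv 0 (of_real t - z / 2)"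
proof -
  have e: "of_real (- (pi * t\<^sup>2)) + of_real (2 * pi * t) * z - of_real (pi / 2) * z\<^sup>2 = of_real (pi * t\<^sup>2) + - (of_real (2 * pi) * (of_real t - z / 2)\<^sup>2)"
    by (simp add: power2_eq_square field_simps)
  have "exp (of_real (- (pi * t\<^sup>2)) + of_real (2 * pi * t) * z - of_real (pi / 2) * z\<^sup>2) = of_real (exp (pi * t\<^sup>2)) * exp (- (of_real (2 * pi) * (of_real t - z / 2)\<^sup>2))"
    unfolding e by (simp only: exp_add exp_of_real)
  then show ?thesis by (simp only: hermite_gen_def gauss_deriv_def hermite_poly.simps poly_1 of_real_mult mult_1 mult.assoc)
qed

lemma deriv_hermite_gen: "(deriv ^^ k) (hermite_gen t) =
    (\<lambda>z. of_real (2 powr (1/4) * exp (pi * t\<^sup>2)) * (- (1 / 2)) ^ k * gauss_deriv k (of_real t - z / 2))"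
proof (induction k)
  case 0
  show ?case by (simp add: hermite_gen_eq fun_eq_iff)
next
  case (Suc k)
  let ?c = "of_real (2 powr (1/4) * exp (pi * t\<^sup>2)) :: complex"
  have "((\<lambda>z. gauss_deriv k (of_real t - z / 2)) has_field_derivative gauss_deriv (Suc k) (of_real t - z / 2) * (- (1 / 2))) (at z)" for z :: complex
    by (rule DERIV_chain2[OF gauss_deriv_has_field_derivative]) (auto intro!: derivative_eq_intros)
  then have "((\<lambda>z. ?c * (- (1 / 2)) ^ k * gauss_deriv k (of_real t - z / 2)) has_field_derivative
      ?c * (- (1 / 2)) ^ k * (gauss_deriv (Suc k) (of_real t - z / 2) * (- (1 / 2)))) (at z)" for z
    by (rule DERIV_cmult)
  then have "deriv (\<lambda>z. ?c * (- (1 / 2)) ^ k * gauss_deriv k (of_real t - z / 2)) z =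
      ?c * (- (1 / 2)) ^ k * (gauss_deriv (Suc k) (of_real t - z / 2) * (- (1 / 2)))" for z
    by (rule DERIV_imp_deriv)
  then show ?case
    unfolding funpow.simps(2) o_apply Suc fun_eq_iff by (simp del: of_real_mult)
qed

lemma deriv_hermite_gen_0: "(deriv ^^ k) (hermite_gen t) 0 = of_real (2 powr (1/4) * hermite_raw k t / 2 ^ k)"
proof -
  have "(- (1 / 2)) ^ k = ((- 1) ^ k / 2 ^ k :: complex)"
    by (simp add: power_minus[of "1 / 2"] power_one_over)
  then show ?thesis unfolding deriv_hermite_gen by (simp add: gauss_deriv_of_real hermite_raw_eq)
qed

lemma hermite_gen_holomorphic: "hermite_gen t holomorphic_on A"
  unfolding hermite_gen_def[abs_def] by (intro holomorphic_intros)

text \<open>The non-holomorphic phase of the window cancels against that of the transform: what remains is an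
  entire function of \<open>z\<close> and the rotation-invariant Gaussian weight.\<close>

lemma bargmann_kernel:
  "bargmann_factor x \<omega> * gauss_window (t - x) * exp (2 * pi * \<i> * t * \<omega>)
    = hermite_gen t (Complex x \<omega>) * of_real (exp (- (pi * (x\<^sup>2 + \<omega>\<^sup>2))))"
proof -
  have "(- (pi * x\<^sup>2) + pi * (Complex x (-\<omega>))\<^sup>2 / 2) + of_real (- (pi * (t - x)\<^sup>2)) + 2 * pi * \<i> * t * \<omega>
     = (of_real (- (pi * t\<^sup>2)) + of_real (2 * pi * t) * Complex x \<omega> - of_real (pi / 2) * (Complex x \<omega>)\<^sup>2) + of_real (- (pi * (x\<^sup>2 + \<omega>\<^sup>2)))"
    by (rule complex_eqI) (simp_all add: power2_eq_square algebra_simps diff_divide_distrib)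
  then have "bargmann_factor x \<omega> * of_real (exp (- (pi * (t - x)\<^sup>2))) * exp (2 * pi * \<i> * t * \<omega>)
     = exp (of_real (- (pi * t\<^sup>2)) + of_real (2 * pi * t) * Complex x \<omega> - of_real (pi / 2) * (Complex x \<omega>)\<^sup>2) * of_real (exp (- (pi * (x\<^sup>2 + \<omega>\<^sup>2))))"
    by (simp only: bargmann_factor_def exp_of_real[symmetric] exp_add[symmetric])
  then show ?thesis by (simp add: gauss_window_def hermite_gen_def mult.assoc)
qed

subsection \<open>Pointwise eigenvalue equation\<close>

definition hermite_comb :: "nat \<Rightarrow> (nat \<Rightarrow> complex) \<Rightarrow> real \<Rightarrow> complex" where
  "hermite_comb N \<alpha> t = (\<Sum>k\<le>N. \<alpha> k * of_real (hermite_raw k t))"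

lemma hermite_raw_bound: "\<exists>C\<ge>0. \<forall>t. (hermite_raw k t)\<^sup>2 \<le> C * exp (- (pi * t\<^sup>2))"
proof -
  obtain C where C: "0 \<le> C" "\<And>t. \<bar>poly (hermite_poly k * hermite_poly k) t\<bar> * exp (0 * \<bar>t\<bar>) * exp (- (2 * pi * t\<^sup>2)) \<le> C * exp (- (pi * t\<^sup>2))"
    using poly_gauss_bound by meson
  have "(hermite_raw k t)\<^sup>2 = \<bar>poly (hermite_poly k * hermite_poly k) t\<bar> * exp (0 * \<bar>t\<bar>) * exp (- (2 * pi * t\<^sup>2))" for t
  proof -
    have "(exp (- (pi * t\<^sup>2)))\<^sup>2 = exp (- (2 * pi * t\<^sup>2))"
      by (simp add: exp_double[symmetric] mult.assoc)
    moreover have "((-1) ^ k)\<^sup>2 = (1::real)" by (simp add: power_mult[symmetric] mult.commute)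
    ultimately show ?thesis
      by (simp add: hermite_raw_poly power_mult_distrib power2_eq_square[of "poly _ _"])
  qed
  then show ?thesis using C by auto
qed

lemma continuous_hermite_raw: "continuous_on A (hermite_raw k)"
  unfolding hermite_raw_poly[abs_def] by (intro continuous_intros)

lemma hermite_raw_measurable [measurable]: "hermite_raw k \<in> borel_measurable borel"
  by (rule borel_measurable_continuous_onI[OF continuous_hermite_raw])

lemma L2_cmult: "f \<in> L2 \<Longrightarrow> (\<lambda>t. c * f t) \<in> L2"
  by (auto simp: L2_def norm_mult power_mult_distrib)

lemma L2_add: "f \<in> L2 \<Longrightarrow> g \<in> L2 \<Longrightarrow> (\<lambda>t. f t + g t) \<in> L2"
  using L2_diff[of f "\<lambda>t. - 1 * g t"] L2_cmult[of g "- 1"] by simp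

lemma L2_sum:
  assumes "finite I" "\<And>i. i \<in> I \<Longrightarrow> f i \<in> L2"
  shows "(\<lambda>t. \<Sum>i\<in>I. f i t) \<in> L2"
  using assms
proof (induction I)
  case empty
  show ?case by (simp add: L2_def)
qed (simp add: L2_add)

lemma hermite_raw_square_integrable: "integrable lborel (\<lambda>t. (hermite_raw k t)\<^sup>2)"
proof -
  obtain C where C: "0 \<le> C" "\<And>t. (hermite_raw k t)\<^sup>2 \<le> C * exp (- (pi * t\<^sup>2))"
    using hermite_raw_bound by meson
  show ?thesis
    by (rule Bochner_Integration.integrable_bound[OF integrable_mult_right[OF integrable_gauss[of pi], of C]])
       (use C in \<open>auto simp: abs_mult\<close>)
qed

lemma L2_hermite_raw: "(\<lambda>t. of_real (hermite_raw k t)) \<in> L2"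
  unfolding L2_def using hermite_raw_square_integrable[of k] by simp

lemma L2_hermite_comb: "hermite_comb N \<alpha> \<in> L2"
  unfolding hermite_comb_def[abs_def] by (intro L2_sum L2_cmult L2_hermite_raw) auto

lemma STFT_hermite_comb:
  "STFT (hermite_comb N \<alpha>) x \<omega> =
    (\<Sum>k\<le>N. \<alpha> k * (2 powr (1/4) / sqrt 2 * (2 * pi) ^ k) * Complex x (-\<omega>) ^ k) * bargmann_factor x \<omega>"
proof -
  let ?f = "\<lambda>k t. complex_of_real (hermite_raw k t) * cnj (gauss_window (t - x)) * exp (- 2 * pi * \<i> * t * \<omega>)"
  have int: "integrable lborel (?f k)" for k
    unfolding STFT_integrand by (rule integrable_mult_right[OF integrable_gauss_exp])
  have "STFT (hermite_comb N \<alpha>) x \<omega> = (LINT t|lborel. (\<Sum>k\<le>N. \<alpha> k * ?f k t))"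
    unfolding STFT_def hermite_comb_def by (simp add: sum_distrib_right mult.assoc)
  also have "\<dots> = (\<Sum>k\<le>N. (LINT t|lborel. \<alpha> k * ?f k t))"
    by (rule Bochner_Integration.integral_sum) (intro integrable_mult_right int)
  also have "\<dots> = (\<Sum>k\<le>N. \<alpha> k * STFT (\<lambda>t. of_real (hermite_raw k t)) x \<omega>)"
    unfolding STFT_def by (simp only: integral_mult_right_zero)
  finally show ?thesis
    unfolding STFT_hermite_raw sum_distrib_right by (simp add: power_mult_distrib mult.assoc)
qed

lemma integrable_product:
  fixes f :: "'a::euclidean_space \<Rightarrow> real" and g :: "'b::euclidean_space \<Rightarrow> real"
  assumes "integrable lborel f" "integrable lborel g"
  shows "integrable (lborel \<Otimes>\<^sub>M lborel) (\<lambda>(x, y). f x * g y)"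
proof (rule lborel_pair.Fubini_integrable)
  have [measurable]: "f \<in> borel_measurable borel" "g \<in> borel_measurable borel"
    using assms[THEN borel_measurable_integrable] by auto
  show "(\<lambda>(x, y). f x * g y) \<in> borel_measurable (lborel \<Otimes>\<^sub>M lborel)" by measurable
  have "(\<lambda>x. LINT y|lborel. norm (case (x, y) of (x, y) \<Rightarrow> f x * g y)) = (\<lambda>x. norm (f x) * (LINT y|lborel. norm (g y)))"
    by (simp add: abs_mult)
  then show "integrable lborel (\<lambda>x. LINT y|lborel. norm (case (x, y) of (x, y) \<Rightarrow> f x * g y))"
    using assms(1) by simp
  show "AE x in lborel. integrable lborel (\<lambda>y. case (x, y) of (x, y) \<Rightarrow> f x * g y)"
    using assms(2) by simp
qed

lemma continuous_bargmann_factor: "continuous_on A (\<lambda>p. bargmann_factor (fst p) (snd p))"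
  unfolding bargmann_factor_def Complex_eq by (intro continuous_intros) auto

lemma continuous_STFT_hermite_comb: "continuous_on A (\<lambda>p. STFT (hermite_comb N \<alpha>) (fst p) (snd p))"
  unfolding STFT_hermite_comb Complex_eq by (intro continuous_intros continuous_bargmann_factor)

text \<open>Fubini's theorem moves the test function out of the integral over the phase plane, which reduces
  the weak definition of the operator to an equation at each point \<open>t\<close>. The antiholomorphic factor of
  the integrand comes from the function, the holomorphic one from the window.\<close>

lemma loc_op_eigenfunction:
  fixes \<alpha> :: "nat \<Rightarrow> complex"
  assumes U: "U \<in> sets borel" "bounded U"
  assumes eig: "\<And>t. set_lebesgue_integral lborel U (\<lambda>(x, \<omega>).
      (\<Sum>k\<le>N. \<alpha> k * (2 powr (1/4) / sqrt 2 * (2 * pi) ^ k) * Complex x (-\<omega>) ^ k) *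
      (hermite_gen t (Complex x \<omega>) * of_real (exp (- (pi * (x\<^sup>2 + \<omega>\<^sup>2))))))
      = of_real lam * hermite_comb N \<alpha> t"
  shows "AE t in lborel. loc_op U (hermite_comb N \<alpha>) t = of_real lam * hermite_comb N \<alpha> t"
proof -
  let ?V = "\<lambda>p. STFT (hermite_comb N \<alpha>) (fst p) (snd p)"
  define W where "W p t = gauss_window (t - fst p) * exp (2 * pi * \<i> * t * snd p)" for p :: "real \<times> real" and t :: real
  have eig': "(LINT p|lborel. indicator U p *\<^sub>R (?V p * W p t)) = of_real lam * hermite_comb N \<alpha> t" for t
    unfolding eig[symmetric] set_lebesgue_integral_def bargmann_kernel[symmetric]
    by (rule Bochner_Integration.integral_cong[OF refl])
       (simp add: W_def STFT_hermite_comb mult.assoc case_prod_beta)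
  have "is_loc_op_value U (hermite_comb N \<alpha>) (\<lambda>t. of_real lam * hermite_comb N \<alpha> t)"
    unfolding is_loc_op_value_def
  proof (intro conjI ballI)
    show "(\<lambda>t. of_real lam * hermite_comb N \<alpha> t) \<in> L2" by (intro L2_cmult L2_hermite_comb)
    fix g assume g: "g \<in> L2"
    have gm [measurable]: "g \<in> borel_measurable borel" using g by (simp add: L2_def)
    define H where "H p t = indicator U p *\<^sub>R (?V p * W p t) * cnj (g t)" for p :: "real \<times> real" and t
    obtain R where R: "0 < R" "\<And>p. p \<in> U \<Longrightarrow> norm p \<le> R"
      using U(2) by (auto simp: bounded_pos)
    have "bounded (?V ` cball 0 R)"
      by (intro compact_imp_bounded compact_continuous_image continuous_STFT_hermite_comb compact_cball)
    then obtain B where BB: "\<forall>v\<in>?V ` cball 0 R. cmod v \<le> B" unfolding bounded_iff by (rule exE)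
    have B: "cmod (?V p) \<le> B" if "p \<in> cball 0 R" for p
      using bspec[OF BB imageI[OF that]] .
    have B0: "0 \<le> B" using B[of 0] R(1) norm_ge_zero order.trans by (metis centre_in_cball less_imp_le)
    define C where "C = B * (2 powr (1/4) * exp (pi * R\<^sup>2))"
    have C0: "0 \<le> C" using B0 by (simp add: C_def)
    have Wb: "cmod (W p t) \<le> 2 powr (1/4) * exp (pi * R\<^sup>2) * exp (- (pi / 2 * t\<^sup>2))" if p: "norm p \<le> R" for p t
    proof -
      have x: "\<bar>fst p\<bar> \<le> R" using norm_fst_le[of "fst p" "snd p"] p by simp
      then have x2: "(fst p)\<^sup>2 \<le> R\<^sup>2" by (metis abs_ge_zero power2_abs power_mono)
      have "0 \<le> (t - 2 * fst p)\<^sup>2" by simp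
      then have "- ((t - fst p)\<^sup>2) \<le> R\<^sup>2 - t\<^sup>2 / 2" using x2 by (simp add: power2_eq_square algebra_simps)
      then have "pi * (- ((t - fst p)\<^sup>2)) \<le> pi * (R\<^sup>2 - t\<^sup>2 / 2)" by (intro mult_left_mono) auto
      then have "exp (- pi * (t - fst p)\<^sup>2) \<le> exp (pi * R\<^sup>2 + - (pi / 2 * t\<^sup>2))" by (simp add: algebra_simps)
      then have "2 powr (1/4) * exp (- pi * (t - fst p)\<^sup>2) \<le> 2 powr (1/4) * (exp (pi * R\<^sup>2) * exp (- (pi / 2 * t\<^sup>2)))"
        unfolding exp_add by (intro mult_left_mono) auto
      moreover have "cmod (W p t) = 2 powr (1/4) * exp (- pi * (t - fst p)\<^sup>2)"
      proof -
        have "cmod (exp (2 * pi * \<i> * t * snd p)) = 1" by simp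
        then show ?thesis unfolding W_def gauss_window_def norm_mult norm_of_real by simp
      qed
      ultimately show ?thesis by (simp only: mult.assoc)
    qed
    have gauss_L2: "(\<lambda>t. of_real (exp (- (pi / 2 * t\<^sup>2)))) \<in> L2"
    proof -
      have "(exp (- (pi / 2 * t\<^sup>2)))\<^sup>2 = exp (- (pi * t\<^sup>2))" for t :: real
        by (simp add: exp_double[symmetric])
      then show ?thesis unfolding L2_def using integrable_gauss[of pi] by simp
    qed
    have "emeasure lborel U < \<infinity>" using U(2) by (rule emeasure_bounded_finite)
    then have indU: "integrable lborel (indicator U :: real \<times> real \<Rightarrow> real)"
      using U(1) by simp
    have gi: "integrable lborel (\<lambda>t. exp (- (pi / 2 * t\<^sup>2)) * cmod (g t))"
      using integrable_norm[OF L2_mult_cnj_integrable[OF gauss_L2 g]] by (simp add: norm_mult)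
    have Vm [measurable]: "?V \<in> borel_measurable borel"
      by (rule borel_measurable_continuous_onI[OF continuous_STFT_hermite_comb])
    have "continuous_on UNIV (\<lambda>q. W (fst q) (snd q))"
      unfolding W_def gauss_window_def by (intro continuous_intros)
    then have Wm [measurable]: "(\<lambda>(p, t). W p t) \<in> borel_measurable (borel \<Otimes>\<^sub>M borel)"
      unfolding borel_prod case_prod_beta by (rule borel_measurable_continuous_onI)
    have cg [measurable]: "(\<lambda>t. cnj (g t)) \<in> borel_measurable borel"
      using gm by (rule measurable_compose) (intro borel_measurable_continuous_onI continuous_intros)
    have [measurable]: "U \<in> sets borel" by fact
    have Hm: "(\<lambda>(p, t). H p t) \<in> borel_measurable (lborel \<Otimes>\<^sub>M lborel)"
      unfolding H_def by measurable
    have Hint: "integrable (lborel \<Otimes>\<^sub>M lborel) (\<lambda>(p, t). H p t)"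
    proof (rule Bochner_Integration.integrable_bound)
      show "integrable (lborel \<Otimes>\<^sub>M lborel) (\<lambda>(p, t). (C * indicator U p) * (exp (- (pi / 2 * t\<^sup>2)) * cmod (g t)))"
        by (intro integrable_product integrable_mult_right indU gi)
      show "AE q in lborel \<Otimes>\<^sub>M lborel. norm (case q of (p, t) \<Rightarrow> H p t)
        \<le> norm (case q of (p, t) \<Rightarrow> (C * indicator U p) * (exp (- (pi / 2 * t\<^sup>2)) * cmod (g t)))"
      proof (rule AE_I2, clarify)
        fix p :: "real \<times> real" and t
        show "norm (H p t) \<le> norm ((C * indicator U p) * (exp (- (pi / 2 * t\<^sup>2)) * cmod (g t)))"
        proof (cases "p \<in> U")
          case True
          have "cmod (?V p) * cmod (W p t) \<le> B * (2 powr (1/4) * exp (pi * R\<^sup>2) * exp (- (pi / 2 * t\<^sup>2)))"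
            using R(2)[OF True] B0 by (intro mult_mono B Wb) auto
          then have "cmod (?V p) * cmod (W p t) * cmod (g t) \<le> C * exp (- (pi / 2 * t\<^sup>2)) * cmod (g t)"
            unfolding C_def by (intro mult_right_mono) (auto simp: mult.assoc)
          then show ?thesis using True C0 by (simp add: H_def norm_mult abs_mult mult.assoc)
        qed (simp add: H_def)
      qed
    qed (rule Hm)
    have cnjV: "cnj (STFT g (fst p) (snd p)) = (LINT t|lborel. W p t * cnj (g t))" for p
    proof -
      have "cnj (STFT g (fst p) (snd p)) = (LINT t|lborel. cnj (g t * cnj (gauss_window (t - fst p)) * exp (- 2 * pi * \<i> * t * snd p)))"
        unfolding STFT_def by (rule Bochner_Integration.integral_cnj[symmetric])
      also have "\<dots> = (LINT t|lborel. W p t * cnj (g t))"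
        by (rule Bochner_Integration.integral_cong) (simp_all add: W_def exp_cnj mult.commute mult.left_commute)
      finally show ?thesis .
    qed
    have "inner_L2 (\<lambda>t. of_real lam * hermite_comb N \<alpha> t) g = (LINT t|lborel. LINT p|lborel. H p t)"
      unfolding inner_L2_def H_def eig'[symmetric] by (simp only: integral_mult_left_zero)
    also have "\<dots> = (LINT p|lborel. LINT t|lborel. H p t)"
      by (rule lborel_pair.Fubini_integral[OF Hint])
    also have "\<dots> = set_lebesgue_integral lborel U (\<lambda>(x, \<omega>). STFT (hermite_comb N \<alpha>) x \<omega> * cnj (STFT g x \<omega>))"
      unfolding set_lebesgue_integral_def
    proof (rule Bochner_Integration.integral_cong[OF refl])
      fix p :: "real \<times> real"
      have "(LINT t|lborel. H p t) = (LINT t|lborel. (indicator U p *\<^sub>R ?V p) * (W p t * cnj (g t)))"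
        by (rule Bochner_Integration.integral_cong) (simp_all add: H_def)
      also have "\<dots> = (indicator U p *\<^sub>R ?V p) * cnj (STFT g (fst p) (snd p))"
        unfolding cnjV by (rule integral_mult_right_zero)
      finally show "(LINT t|lborel. H p t) = indicator U p *\<^sub>R (case p of (x, \<omega>) \<Rightarrow> STFT (hermite_comb N \<alpha>) x \<omega> * cnj (STFT g x \<omega>))"
        by (simp add: case_prod_beta)
    qed
    finally show "inner_L2 (\<lambda>t. of_real lam * hermite_comb N \<alpha> t) g =
      set_lebesgue_integral lborel U (\<lambda>(x, \<omega>). STFT (hermite_comb N \<alpha>) x \<omega> * cnj (STFT g x \<omega>))" .
  qed
  moreover from this have "is_loc_op_value U (hermite_comb N \<alpha>) (loc_op U (hermite_comb N \<alpha>))"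
    unfolding loc_op_def by (rule someI[of "is_loc_op_value U (hermite_comb N \<alpha>)"])
  ultimately show ?thesis using is_loc_op_value_unique by blast
qed

section \<open>The domain bounded by the solution curve\<close>

text \<open>The bound \<open>1/8\<close> keeps the radius within \<open>r/4\<close> of \<open>r\<close> and, through Cauchy's estimate for the
  derivative, makes the polar angle strictly increasing along the curve.\<close>

locale small_disc = disc_curve +
  assumes small: "\<And>w. cmod w < 2 \<Longrightarrow> cmod (P w) \<le> 1/8"
begin

definition ang :: "real \<Rightarrow> real" where "ang s = s + Im (P (cis s))"

definition rad :: "real \<Rightarrow> real" where "rad s = r * exp (Re (P (cis s)))"

lemma rad_pos: "0 < rad s"
  using r by (simp add: rad_def)

lemma \<zeta>_polar: "\<zeta> s = of_real (rad s) * cis (ang s)"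
proof -
  have "exp (P (cis s)) = of_real (exp (Re (P (cis s)))) * cis (Im (P (cis s)))"
    by (rule exp_eq_polar)
  then show ?thesis
    by (simp add: \<zeta>_def \<psi>_def rad_def ang_def cis_mult[symmetric])
qed

lemma deriv_P_bound: "cmod (deriv P (cis s)) \<le> 1/4"
proof -
  have "cmod ((deriv ^^ 1) P (cis s)) \<le> fact 1 * (1/8) / (1/2) ^ 1"
  proof (rule Cauchy_inequality)
    have sub: "cball (cis s) (1/2) \<subseteq> ball 0 2"
    proof
      fix w assume "w \<in> cball (cis s) (1/2)"
      then have "cmod (w - cis s) \<le> 1/2" by (simp add: dist_norm norm_minus_commute)
      then have "cmod w \<le> 3/2" using norm_triangle_sub[of w "cis s"] by simp
      then show "w \<in> ball 0 2" by simp
    qed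
    show "P holomorphic_on ball (cis s) (1/2)"
      using sub by (intro holomorphic_on_subset[OF P]) auto
    show "continuous_on (cball (cis s) (1/2)) P"
      by (rule continuous_on_subset[OF holomorphic_on_imp_continuous_on[OF P] sub])
    show "cmod (P x) \<le> 1/8" if "cmod (cis s - x) = 1/2" for x
    proof -
      have "x \<in> cball (cis s) (1/2)" using that by (simp add: dist_norm)
      then have "x \<in> ball 0 2" using sub by blast
      then show ?thesis by (intro small) simp
    qed
  qed simp
  then show ?thesis by simp
qed

lemma Im_L': "Im (L' s) = 1 + Re (cis s * deriv P (cis s))"
  by (simp add: L'_def)

lemma Im_L'_pos: "0 < Im (L' s)"
proof -
  have "\<bar>Re (cis s * deriv P (cis s))\<bar> \<le> cmod (cis s * deriv P (cis s))" by (rule abs_Re_le_cmod)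
  also have "\<dots> \<le> 1/4" using deriv_P_bound[of s] by (simp add: norm_mult)
  finally have "- Re (cis s * deriv P (cis s)) \<le> 1/4" by (rule abs_le_D2)
  then show ?thesis unfolding Im_L' by linarith
qed

lemma jac_eq: "jac s = (cmod (\<zeta> s))\<^sup>2 * Im (L' s)"
proof -
  define c where "c = (cmod (\<zeta> s))\<^sup>2"
  have "cnj (\<zeta> s) * (\<zeta> s * L' s) = of_real c * L' s"
    unfolding c_def complex_norm_square by simp
  then have "jac s = Im (of_real c * L' s)" unfolding jac_def by (rule arg_cong)
  then show ?thesis by (simp add: c_def[symmetric])
qed

lemma jac_pos: "0 < jac s"
  unfolding jac_eq using \<zeta>_nz[of s] Im_L'_pos[of s] by simp

lemma ang_deriv: "(ang has_real_derivative Im (L' s)) (at s)"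
proof -
  have "(P has_field_derivative deriv P (cis s)) (at (cis s))"
    using P by (rule holomorphic_derivI) auto
  from field_vector_diff_chain_at[OF cis_has_vector_derivative this]
  have "((\<lambda>s. Im ((P \<circ> cis) s)) has_vector_derivative Im (\<i> * cis s * deriv P (cis s))) (at s)"
    by (rule bounded_linear.has_vector_derivative[OF bounded_linear_Im])
  then have "((\<lambda>s. Im (P (cis s))) has_real_derivative Re (cis s * deriv P (cis s))) (at s)"
    by (simp add: has_real_derivative_iff_has_vector_derivative comp_def)
  from DERIV_add[OF DERIV_ident this] show ?thesis
    unfolding ang_def[abs_def] Im_L' .
qed

lemma ang_strict_mono: "s < t \<Longrightarrow> ang s < ang t"
  by (rule DERIV_pos_imp_increasing) (use ang_deriv Im_L'_pos in blast)+

lemma ang_inj: "ang s = ang t \<longleftrightarrow> s = t"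
  using ang_strict_mono[of s t] ang_strict_mono[of t s] by (cases s t rule: linorder_cases) auto

lemma ang_close: "\<bar>ang s - s\<bar> \<le> 1/8"
  using abs_Im_le_cmod[of "P (cis s)"] small[of "cis s"] by (simp add: ang_def)

lemma cis_shift: "cis (s + 2 * pi * of_int n) = cis s"
  using cis_multiple_2pi[of "of_int n"] by (simp add: cis_mult[symmetric])

lemma ang_shift: "ang (s + 2 * pi * of_int n) = ang s + 2 * pi * of_int n"
  by (simp add: ang_def cis_shift)

lemma rad_shift: "rad (s + 2 * pi * of_int n) = rad s"
  by (simp add: rad_def cis_shift)

lemma \<zeta>_shift: "\<zeta> (s + 2 * pi * of_int n) = \<zeta> s"
  by (simp add: \<zeta>_def cis_shift)

lemma isCont_ang: "isCont ang s"
  using ang_deriv by (rule DERIV_isCont)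

lemma ang_surj: "\<exists>s. ang s = \<theta>"
proof -
  have "\<exists>s\<ge>\<theta> - 1. s \<le> \<theta> + 1 \<and> ang s = \<theta>"
  proof (rule IVT)
    show "ang (\<theta> - 1) \<le> \<theta>" "\<theta> \<le> ang (\<theta> + 1)"
      using abs_le_D1[OF ang_close[of "\<theta> - 1"]] abs_le_D2[OF ang_close[of "\<theta> + 1"]] by linarith+
  qed (use isCont_ang in auto)
  then show ?thesis by blast
qed

definition ang_inv :: "real \<Rightarrow> real" where "ang_inv \<theta> = (THE s. ang s = \<theta>)"

lemma ang_ang_inv [simp]: "ang (ang_inv \<theta>) = \<theta>"
  unfolding ang_inv_def by (rule theI') (use ang_surj ang_inj in metis)

lemma ang_inv_ang [simp]: "ang_inv (ang s) = s"
  using ang_ang_inv[of "ang s"] ang_inj by blast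

lemma ang_inv_shift: "ang_inv (\<theta> + 2 * pi * of_int n) = ang_inv \<theta> + 2 * pi * of_int n"
proof -
  have "ang (ang_inv \<theta> + 2 * pi * of_int n) = \<theta> + 2 * pi * of_int n" by (simp add: ang_shift)
  then show ?thesis using ang_inv_ang[of "ang_inv \<theta> + 2 * pi * of_int n"] by simp
qed

lemma isCont_ang_inv: "isCont ang_inv \<theta>"
proof -
  have "isCont ang_inv (ang (ang_inv \<theta>))"
    by (rule isCont_inverse_function[where d = 1]) (auto simp: isCont_ang)
  then show ?thesis by simp
qed

lemma rad_close: "\<bar>rad s - r\<bar> \<le> r / 4"
proof -
  define x where "x = Re (P (cis s))"
  have x: "\<bar>x\<bar> \<le> 1/8"
    using abs_Re_le_cmod[of "P (cis s)"] small[of "cis s"] by (simp add: x_def)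
  have "exp x \<le> 5/4"
  proof -
    have "exp x \<le> exp (1/8)" using x by simp
    also have "\<dots> \<le> 1 + 1/8 + (1/8)\<^sup>2" by (rule exp_bound) auto
    also have "\<dots> \<le> 5/4" by (simp add: power2_eq_square)
    finally show ?thesis .
  qed
  moreover have "3/4 \<le> exp x" using exp_ge_add_one_self[of x] x by linarith
  ultimately have "\<bar>exp x - 1\<bar> \<le> 1/4" by linarith
  then have "r * \<bar>exp x - 1\<bar> \<le> r * (1/4)" using r by (intro mult_left_mono) auto
  moreover have "\<bar>rad s - r\<bar> = r * \<bar>exp x - 1\<bar>"
  proof -
    have "rad s - r = r * (exp x - 1)" by (simp add: rad_def x_def right_diff_distrib)
    then show ?thesis using r by (simp add: abs_mult)
  qed
  ultimately show ?thesis by simp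
qed

subsection \<open>The boundary is real-analytic\<close>

definition strip :: "complex set" where "strip = {\<sigma>. \<bar>Im \<sigma>\<bar> < ln 2}"

text \<open>The Schwarz reflection, which continues the conjugate of \<open>P\<close> on the unit circle holomorphically.
  It gives the extensions \<open>angC\<close> and \<open>radC\<close> of angle and radius to a complex strip.\<close>

definition Pcc :: "complex \<Rightarrow> complex" where "Pcc w = cnj (P (cnj w))"

definition angC :: "complex \<Rightarrow> complex" where
  "angC \<sigma> = \<sigma> + (P (exp (\<i> * \<sigma>)) - Pcc (exp (- (\<i> * \<sigma>)))) / (2 * \<i>)"

definition radC :: "complex \<Rightarrow> complex" where
  "radC \<sigma> = of_real r * exp ((P (exp (\<i> * \<sigma>)) + Pcc (exp (- (\<i> * \<sigma>)))) / 2)"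

lemma open_strip: "open strip"
  unfolding strip_def by (intro open_Collect_less continuous_intros)

lemma of_real_strip: "of_real s \<in> strip"
  by (simp add: strip_def)

lemma Pcc_holomorphic: "Pcc holomorphic_on ball 0 2"
proof -
  have "cnj ` ball 0 2 = ball 0 2"
    by (auto simp: image_iff intro!: bexI[of _ "cnj _"])
  then have "cnj \<circ> P \<circ> cnj holomorphic_on ball 0 2"
    using P by (intro holomorphic_on_compose_cnj_cnj) auto
  then show ?thesis by (simp add: Pcc_def[abs_def] comp_def)
qed

lemma strip_ball:
  assumes "\<sigma> \<in> strip"
  shows "exp (\<i> * \<sigma>) \<in> ball 0 2" "exp (- (\<i> * \<sigma>)) \<in> ball 0 2"
proof -
  have "exp (- Im \<sigma>) < exp (ln 2)" "exp (Im \<sigma>) < exp (ln 2)"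
    using assms by (auto simp: strip_def simp del: exp_ln)
  then show "exp (\<i> * \<sigma>) \<in> ball 0 2" "exp (- (\<i> * \<sigma>)) \<in> ball 0 2" by auto
qed

lemma comp_strip_holomorphic:
  assumes "H holomorphic_on ball 0 2"
  shows "(\<lambda>\<sigma>. H (exp (\<i> * \<sigma>))) holomorphic_on strip" "(\<lambda>\<sigma>. H (exp (- (\<i> * \<sigma>)))) holomorphic_on strip"
  by (rule holomorphic_on_compose_gen[OF _ assms, unfolded comp_def]; use strip_ball in \<open>auto intro!: holomorphic_intros\<close>)+

lemma angC_holomorphic: "angC holomorphic_on strip"
  unfolding angC_def[abs_def]
  by (intro holomorphic_intros comp_strip_holomorphic P Pcc_holomorphic) auto

lemma radC_holomorphic: "radC holomorphic_on strip"
  unfolding radC_def[abs_def]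
  by (intro holomorphic_intros comp_strip_holomorphic P Pcc_holomorphic) auto

lemma Pcc_cis: "Pcc (exp (- (\<i> * of_real s))) = cnj (P (cis s))" "P (exp (\<i> * of_real s)) = P (cis s)"
  by (simp_all add: Pcc_def cis_conv_exp exp_cnj)

lemma angC_of_real: "angC (of_real s) = of_real (ang s)"
  unfolding angC_def Pcc_cis by (rule complex_eqI) (simp_all add: ang_def complex_diff_cnj)

lemma radC_of_real: "radC (of_real s) = of_real (rad s)"
proof -
  have "(P (cis s) + cnj (P (cis s))) / 2 = of_real (Re (P (cis s)))"
    by (rule complex_eqI) simp_all
  then show ?thesis unfolding radC_def Pcc_cis by (simp add: rad_def exp_of_real)
qed

lemma deriv_angC_nonzero: "deriv angC (of_real s) \<noteq> 0"
proof
  assume 0: "deriv angC (of_real s) = 0"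
  have "(angC has_field_derivative deriv angC (of_real s)) (at (of_real s))"
    by (rule holomorphic_derivI[OF angC_holomorphic open_strip of_real_strip])
  from has_vector_derivative_real_field[OF this]
  have "((\<lambda>s. complex_of_real (ang s)) has_vector_derivative 0) (at s)"
    by (simp add: 0 angC_of_real)
  then have "((\<lambda>s. Re (complex_of_real (ang s))) has_vector_derivative Re 0) (at s)"
    by (rule bounded_linear.has_vector_derivative[OF bounded_linear_Re])
  then have "(ang has_real_derivative 0) (at s)"
    by (simp add: has_real_derivative_iff_has_vector_derivative)
  then show False using DERIV_unique[OF ang_deriv[of s]] Im_L'_pos[of s] by auto
qed

definition bump :: "real \<Rightarrow> real" where "bump \<theta> = rad (ang_inv (2 * pi * \<theta>)) - r"

text \<open>The radius as a function of the angle is \<open>radC\<close> composed with the local holomorphic inverse of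
  \<open>angC\<close>. Since its values at real points are real, the real parts of its Taylor coefficients
  give a real power series.\<close>

lemma bump_analytic: "real_analytic bump"
  unfolding real_analytic_def
proof
  fix x0
  define a where "a = ang_inv (2 * pi * x0)"
  obtain \<rho> where \<rho>: "\<rho> > 0" "ball (complex_of_real a) \<rho> \<subseteq> strip"
      "open (angC ` ball (complex_of_real a) \<rho>)" "inj_on angC (ball (complex_of_real a) \<rho>)"
    using has_complex_derivative_locally_invertible[OF angC_holomorphic of_real_strip open_strip deriv_angC_nonzero] by blast
  let ?B = "ball (complex_of_real a) \<rho>"
  have hol: "angC holomorphic_on ?B" by (rule holomorphic_on_subset[OF angC_holomorphic \<rho>(2)])
  obtain g where g: "g holomorphic_on (angC ` ?B)" "\<And>z. z \<in> ?B \<Longrightarrow> g (angC z) = z"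
    using holomorphic_has_inverse[OF hol open_ball \<rho>(4)] by metis
  have "complex_of_real (2 * pi * x0) = angC (of_real a)" by (simp add: angC_of_real a_def)
  then have "complex_of_real (2 * pi * x0) \<in> angC ` ?B" using \<rho>(1) by auto
  then obtain e where e: "e > 0" "ball (complex_of_real (2 * pi * x0)) e \<subseteq> angC ` ?B"
    using \<rho>(3) open_contains_ball by blast
  define e1 where "e1 = e / (2 * pi)"
  have e1: "e1 > 0" using e by (simp add: e1_def)
  have scale: "2 * pi * z \<in> angC ` ?B" if "z \<in> ball (complex_of_real x0) e1" for z :: complex
  proof -
    have "complex_of_real (2 * pi * x0) - 2 * pi * z = of_real (2 * pi) * (of_real x0 - z)" by (simp add: algebra_simps)
    then have "dist (complex_of_real (2 * pi * x0)) (2 * pi * z) = 2 * pi * dist (of_real x0) z"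
      by (simp only: dist_norm norm_mult norm_of_real) simp
    also have "\<dots> < e" using that by (simp add: e1_def field_simps)
    finally show ?thesis using e(2) by auto
  qed
  have gB: "g z \<in> ?B" if "z \<in> angC ` ?B" for z using that g(2) by auto
  define h where "h z = radC (g (2 * pi * z)) - r" for z :: complex
  have "h holomorphic_on ball (of_real x0) e1"
  proof -
    have "(\<lambda>z. g (2 * pi * z)) holomorphic_on ball (of_real x0) e1"
      by (rule holomorphic_on_compose_gen[OF _ g(1), unfolded comp_def])
         (use scale in \<open>auto intro!: holomorphic_intros\<close>)
    then have "(\<lambda>z. radC (g (2 * pi * z))) holomorphic_on ball (of_real x0) e1"
      by (rule holomorphic_on_compose_gen[OF _ radC_holomorphic, unfolded comp_def])
         (use gB[OF scale] \<rho>(2) in blast)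
    then show ?thesis unfolding h_def by (intro holomorphic_intros)
  qed
  then have series: "(\<lambda>n. (deriv ^^ n) h (of_real x0) / fact n * (z - of_real x0) ^ n) sums h z"
    if "z \<in> ball (of_real x0) e1" for z
    using holomorphic_power_series that by blast
  have "isCont (\<lambda>x. 2 * pi * x) x0" by (intro continuous_intros)
  then have "isCont (\<lambda>x. ang_inv (2 * pi * x)) x0" by (rule isCont_o2) (rule isCont_ang_inv)
  from this[unfolded continuous_at_eps_delta, rule_format, OF \<rho>(1)]
  obtain d where d: "d > 0" "\<And>x. dist x x0 < d \<Longrightarrow> dist (ang_inv (2 * pi * x)) a < \<rho>"
    unfolding a_def by blast
  define c where "c n = Re ((deriv ^^ n) h (of_real x0) / fact n)" for n
  have "(\<lambda>n. c n * (x - x0) ^ n) sums bump x" if x: "\<bar>x - x0\<bar> < min d e1" for x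
  proof -
    have "ang_inv (2 * pi * x) \<in> ball a \<rho>" using d(2)[of x] x by (simp add: dist_norm dist_commute)
    then have "complex_of_real (ang_inv (2 * pi * x)) \<in> ?B"
      by (simp add: dist_norm flip: of_real_diff)
    from g(2)[OF this] have "g (2 * pi * of_real x) = of_real (ang_inv (2 * pi * x))"
      by (simp add: angC_of_real)
    then have h: "h (of_real x) = of_real (bump x)" by (simp add: h_def bump_def radC_of_real)
    have "complex_of_real x \<in> ball (of_real x0) e1"
      using x by (simp add: dist_norm abs_minus_commute flip: of_real_diff)
    from series[OF this]
    have "(\<lambda>n. Re ((deriv ^^ n) h (of_real x0) / fact n * (of_real x - of_real x0) ^ n)) sums Re (h (of_real x))"
      by (rule sums_Re)
    moreover have "Re (w * (complex_of_real x - of_real x0) ^ n) = Re w * (x - x0) ^ n" for w n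
    proof -
      have "(complex_of_real x - of_real x0) ^ n = of_real ((x - x0) ^ n)" by simp
      then show ?thesis by (simp only: times_complex.sel Re_complex_of_real Im_complex_of_real)
    qed
    ultimately show ?thesis unfolding h c_def by (simp only: Re_complex_of_real)
  qed
  then show "\<exists>c. \<exists>\<delta>>0. \<forall>x. \<bar>x - x0\<bar> < \<delta> \<longrightarrow> (\<lambda>n. c n * (x - x0) ^ n) sums bump x"
    using d(1) e1 by (intro exI[of _ c] exI[of _ "min d e1"]) auto
qed

definition star_domain :: "(real \<times> real) set" where
  "star_domain = {(\<rho> * cos (2 * pi * \<theta>), \<rho> * sin (2 * pi * \<theta>)) | \<rho> \<theta>. 0 \<le> \<rho> \<and> \<rho> < r + bump \<theta>}"

lemma star_domain_analytic_perturbed_disk: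
  assumes "1 - exp (- pi * r\<^sup>2) = lam"
  shows "analytic_perturbed_disk lam star_domain"
  unfolding analytic_perturbed_disk_def
proof (intro exI conjI allI)
  show "bump (\<theta> + 1) = bump \<theta>" for \<theta>
    using ang_inv_shift[of "2 * pi * \<theta>" 1] rad_shift[of "ang_inv (2 * pi * \<theta>)" 1]
    by (simp add: bump_def distrib_left)
  have "\<bar>bump \<theta>\<bar> \<le> r / 4" for \<theta> unfolding bump_def by (rule rad_close)
  then have "(SUP \<theta>. \<bar>bump \<theta>\<bar>) \<le> r / 4" by (intro cSUP_least) auto
  then show "(SUP \<theta>. \<bar>bump \<theta>\<bar>) < r / 2" using r by simp
qed (use r assms bump_analytic star_domain_def in auto)

subsection \<open>Area integrals\<close>

definition star_map :: "real \<times> real \<Rightarrow> real \<times> real" where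
  "star_map q = (fst q * Re (\<zeta> (snd q)), fst q * Im (\<zeta> (snd q)))"

definition param :: "(real \<times> real) set" where
  "param = {0<..<1} \<times> {0..<2 * pi}"

lemma Complex_star_map: "Complex (fst (star_map q)) (snd (star_map q)) = of_real (fst q) * \<zeta> (snd q)"
  by (rule complex_eqI) (simp_all add: star_map_def)

lemma star_map_polar: "star_map (\<tau>, s) = (\<tau> * rad s * cos (ang s), \<tau> * rad s * sin (ang s))"
  by (simp add: star_map_def \<zeta>_polar mult.assoc)

lemma continuous_star_map: "continuous_on A star_map"
  unfolding star_map_def[abs_def]
  by (intro continuous_intros continuous_on_compose2[OF cont, of _ snd]) auto

lemma star_map_reduce: "\<exists>t\<in>{0..<2 * pi}. star_map (\<tau>, t) = star_map (\<tau>, s)"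
proof -
  define n where "n = \<lfloor>s / (2 * pi)\<rfloor>"
  define t where "t = s + 2 * pi * of_int (- n)"
  have "of_int n \<le> s / (2 * pi)" "s / (2 * pi) < of_int n + 1" unfolding n_def by linarith+
  then have "t \<in> {0..<2 * pi}" by (simp add: t_def field_simps)
  moreover have "star_map (\<tau>, t) = star_map (\<tau>, s)"
    unfolding t_def star_map_def by (simp only: snd_conv fst_conv \<zeta>_shift)
  ultimately show ?thesis by blast
qed

text \<open>Every ray meets the curve exactly once, at the parameter \<open>ang_inv\<close> of its direction, and
  parameters may be reduced modulo \<open>2 pi\<close>.\<close>

lemma star_domain_eq: "star_domain = insert (0, 0) (star_map ` param)"
proof (intro equalityI subsetI)
  fix x assume "x \<in> star_domain"
  then obtain \<rho> \<theta> where x: "x = (\<rho> * cos (2 * pi * \<theta>), \<rho> * sin (2 * pi * \<theta>))" "0 \<le> \<rho>" "\<rho> < r + bump \<theta>"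
    by (auto simp: star_domain_def)
  show "x \<in> insert (0, 0) (star_map ` param)"
  proof (cases "\<rho> = 0")
    case True
    then show ?thesis using x by simp
  next
    case False
    define s where "s = ang_inv (2 * pi * \<theta>)"
    have lt: "\<rho> < rad s" using x(3) by (simp add: bump_def s_def)
    have "star_map (\<rho> / rad s, s) = x"
      using rad_pos[of s] by (simp add: star_map_polar x(1) s_def)
    moreover obtain t where "t \<in> {0..<2 * pi}" "star_map (\<rho> / rad s, t) = star_map (\<rho> / rad s, s)"
      using star_map_reduce by blast
    moreover have "\<rho> / rad s \<in> {0<..<1}" using False x(2) lt rad_pos[of s] by simp
    ultimately have "(\<rho> / rad s, t) \<in> param" "star_map (\<rho> / rad s, t) = x" by (auto simp: param_def)
    then show ?thesis by blast
  qed
next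
  fix x assume "x \<in> insert (0, 0) (star_map ` param)"
  then consider "x = (0, 0)" | \<tau> s where "0 < \<tau>" "\<tau> < 1" "x = star_map (\<tau>, s)"
    by (auto simp: param_def)
  then show "x \<in> star_domain"
  proof cases
    case 1
    have "0 < r + bump 0" using rad_pos by (simp add: bump_def)
    then show ?thesis unfolding star_domain_def 1 by (auto intro!: exI[of _ 0])
  next
    case 2
    have "\<tau> * rad s < 1 * rad s" using 2 rad_pos[of s] by (intro mult_strict_right_mono) auto
    then have "\<tau> * rad s < r + bump (ang s / (2 * pi))" by (simp add: bump_def)
    moreover have "0 \<le> \<tau> * rad s" using 2 rad_pos[of s] by simp
    ultimately show ?thesis unfolding star_domain_def 2(3) star_map_polar
      by (intro CollectI exI[of _ "\<tau> * rad s"] exI[of _ "ang s / (2 * pi)"] conjI) auto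
  qed
qed

lemma star_map_inj: "inj_on star_map param"
proof (rule inj_onI, clarify)
  fix \<tau> s \<tau>' s'
  assume p: "(\<tau>, s) \<in> param" "(\<tau>', s') \<in> param" and eq: "star_map (\<tau>, s) = star_map (\<tau>', s')"
  define A B where "A = \<tau> * rad s" and "B = \<tau>' * rad s'"
  have AB: "0 < A" "0 < B" using p rad_pos by (auto simp: param_def A_def B_def)
  have "of_real A * cis (ang s) = of_real B * cis (ang s')"
    using eq by (intro complex_eqI) (simp_all add: star_map_polar A_def B_def)
  then have e: "cmod (of_real A * cis (ang s)) = cmod (of_real B * cis (ang s'))"
    and e': "of_real A * cis (ang s) = of_real B * cis (ang s')" by simp_all
  have "A = B" using e AB by (simp add: norm_mult)
  then have "cis (ang s) = cis (ang s')" using e' AB by simp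
  then have "sin (ang s) = sin (ang s') \<and> cos (ang s) = cos (ang s')"
    by (metis cis.sel)
  then obtain n :: int where "ang s = ang s' + 2 * pi * of_int n"
    unfolding sin_cos_eq_iff by blast
  then have s: "s = s' + 2 * pi * of_int n" unfolding ang_shift[symmetric] ang_inj .
  define X where "X = 2 * pi * of_int n"
  have "0 \<le> s" "s < 2 * pi" "0 \<le> s'" "s' < 2 * pi" using p by (auto simp: param_def)
  then have "X < 2 * pi" "- (2 * pi) < X" using s unfolding X_def[symmetric] by linarith+
  then have "X - 2 * pi < 0" "0 < X + 2 * pi" by simp_all
  moreover have "X - 2 * pi = 2 * pi * (of_int n - 1)" "X + 2 * pi = 2 * pi * (of_int n + 1)"
    by (simp_all add: X_def algebra_simps)
  ultimately have "2 * pi * (of_int n - 1) < 0" "0 < 2 * pi * (of_int n + 1)" by (simp_all only:)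
  then have "real_of_int n < 1" "0 < real_of_int n + 1"
    by (simp_all add: mult_less_0_iff zero_less_mult_iff)
  then have "n = 0" by linarith
  then have "s = s'" using s by simp
  then show "\<tau> = \<tau>' \<and> s = s'" using \<open>A = B\<close> rad_pos[of s] by (simp add: A_def B_def)
qed

lemma star_map_image_borel: "star_map ` param \<in> sets borel"
proof -
  let ?K = "\<lambda>n. {1 / Suc n..1 - 1 / Suc n} \<times> {0..2 * pi}"
  have "star_map ` param = (\<Union>n. star_map ` ?K n)"
  proof (intro equalityI subsetI)
    fix x assume "x \<in> star_map ` param"
    then obtain \<tau> s where x: "x = star_map (\<tau>, s)" "0 < \<tau>" "\<tau> < 1" "0 \<le> s" "s < 2 * pi"
      by (auto simp: param_def)
    then obtain n where "1 / Suc n < min \<tau> (1 - \<tau>)" using nat_approx_posE[of "min \<tau> (1 - \<tau>)"] by auto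
    then have "(\<tau>, s) \<in> ?K n" using x by auto
    then show "x \<in> (\<Union>n. star_map ` ?K n)" using x(1) by blast
  next
    fix x assume "x \<in> (\<Union>n. star_map ` ?K n)"
    then obtain n \<tau> s where x: "x = star_map (\<tau>, s)" "1 / Suc n \<le> \<tau>" "\<tau> \<le> 1 - 1 / Suc n" by auto
    have "0 < 1 / real (Suc n)" by simp
    then have "0 < \<tau>" "\<tau> < 1" using x by linarith+
    moreover obtain t where "t \<in> {0..<2 * pi}" "star_map (\<tau>, t) = star_map (\<tau>, s)"
      using star_map_reduce by blast
    ultimately have "(\<tau>, t) \<in> param" "star_map (\<tau>, t) = x" using x(1) by (auto simp: param_def)
    then show "x \<in> star_map ` param" by blast
  qed
  moreover have "star_map ` ?K n \<in> sets borel" for n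
    by (intro borel_closed compact_imp_closed compact_continuous_image continuous_star_map compact_Times compact_Icc)
  ultimately show ?thesis by (auto intro: sets.countable_UN)
qed

lemma star_domain_borel: "star_domain \<in> sets borel"
  unfolding star_domain_eq using star_map_image_borel by (metis borel_singleton insert_is_Un sets.Un)

lemma star_domain_bounded: "bounded star_domain"
proof -
  have "star_domain \<subseteq> star_map ` ({0..1} \<times> {0..2 * pi})"
  proof -
    have "star_map (0, 0) = (0, 0)" by (simp add: star_map_def)
    then have "(0, 0) \<in> star_map ` ({0..1} \<times> {0..2 * pi})" by (intro image_eqI[of _ _ "(0, 0)"]) auto
    moreover have "star_map ` param \<subseteq> star_map ` ({0..1} \<times> {0..2 * pi})" by (intro image_mono) (auto simp: param_def)
    ultimately show ?thesis unfolding star_domain_eq by blast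
  qed
  moreover have "bounded (star_map ` ({0..1} \<times> {0..2 * pi}))"
    by (intro compact_imp_bounded compact_continuous_image continuous_star_map compact_Times compact_Icc)
  ultimately show ?thesis by (rule bounded_subset[rotated])
qed

lemma star_map_has_derivative:
  "(star_map has_derivative (\<lambda>h. (fst h * Re (\<zeta> (snd q)) + fst q * (snd h * Re (\<zeta> (snd q) * L' (snd q))),
      fst h * Im (\<zeta> (snd q)) + fst q * (snd h * Im (\<zeta> (snd q) * L' (snd q)))))) (at q within A)"
proof -
  have z: "((\<lambda>q. \<zeta> (snd q)) has_derivative (\<lambda>h. snd h *\<^sub>R (\<zeta> (snd q) * L' (snd q)))) (at q within A)"
    by (rule has_derivative_compose[OF has_derivative_snd[OF has_derivative_ident] \<zeta>_deriv[unfolded has_vector_derivative_def]])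
  have re: "((\<lambda>q. Re (\<zeta> (snd q))) has_derivative (\<lambda>h. snd h * Re (\<zeta> (snd q) * L' (snd q)))) (at q within A)"
    using bounded_linear.has_derivative[OF bounded_linear_Re z] by simp
  have im: "((\<lambda>q. Im (\<zeta> (snd q))) has_derivative (\<lambda>h. snd h * Im (\<zeta> (snd q) * L' (snd q)))) (at q within A)"
    using bounded_linear.has_derivative[OF bounded_linear_Im z] by simp
  have f: "(fst has_derivative fst) (at q within A)" by (rule has_derivative_fst[OF has_derivative_ident])
  show ?thesis unfolding star_map_def[abs_def]
    by (rule has_derivative_eq_rhs[OF has_derivative_Pair[OF has_derivative_mult[OF f re] has_derivative_mult[OF f im]]])
       (simp add: fun_eq_iff algebra_simps)
qed

lemma star_domain_integral:
  fixes f :: "real \<times> real \<Rightarrow> complex"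
  assumes f: "continuous_on UNIV f"
  shows "set_lebesgue_integral lborel star_domain f =
    integral {0..1} (\<lambda>\<tau>. integral {0..2 * pi} (\<lambda>s. of_real (\<tau> * jac s) * f (star_map (\<tau>, s))))"
proof -
  let ?J = "\<lambda>q::real\<times>real. fst q * jac (snd q)"
  let ?g = "\<lambda>q. of_real (?J q) * f (star_map q)"
  have fm: "f \<in> borel_measurable borel" by (rule borel_measurable_continuous_onI[OF f])
  have gc: "continuous_on A ?g" for A
    by (intro continuous_intros continuous_on_compose2[OF cont_jac, of _ snd] continuous_on_compose2[OF f continuous_star_map]) auto
  have param_borel: "param \<in> sets borel"
    unfolding param_def by (intro borel_Times) auto
  have param_sub: "param \<subseteq> cbox (0, 0) (1, 2 * pi)" by (auto simp: param_def cbox_Pair_eq)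
  have gi: "set_integrable lborel param ?g"
  proof (rule set_integrable_subset)
    show "set_integrable lborel (cbox (0, 0) (1, 2 * pi)) ?g"
      unfolding set_integrable_def by (rule borel_integrable_compact[OF compact_cbox gc])
  qed (use param_borel param_sub in auto)
  have "set_lebesgue_integral lborel star_domain f = set_lebesgue_integral lborel (star_map ` param) f"
    unfolding set_lebesgue_integral_def
  proof (rule integral_cong_AE)
    show "AE q in lborel. indicator star_domain q *\<^sub>R f q = indicator (star_map ` param) q *\<^sub>R f q"
      using AE_lborel_singleton[of "(0, 0)"] by eventually_elim (auto simp: star_domain_eq indicator_def)
  qed (use star_domain_borel star_map_image_borel fm in \<open>auto intro!: borel_measurable_scaleR\<close>)
  also have "\<dots> = set_lebesgue_integral lborel param ?g"
  proof (rule change_of_variables_plane[OF param_borel star_map_has_derivative star_map_inj _ star_map_image_borel fm gi])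
    fix q assume q: "q \<in> param"
    have nn: "0 \<le> ?J q" using q jac_pos[of "snd q"] by (auto simp: param_def)
    have j: "jac (snd q) = Re (\<zeta> (snd q)) * Im (\<zeta> (snd q) * L' (snd q)) - Im (\<zeta> (snd q)) * Re (\<zeta> (snd q) * L' (snd q))"
      unfolding jac_def by simp
    show "?J q = \<bar>fst (fst (1, 0) * Re (\<zeta> (snd q)) + fst q * (snd (1, 0) * Re (\<zeta> (snd q) * L' (snd q))),
        fst (1, 0) * Im (\<zeta> (snd q)) + fst q * (snd (1, 0) * Im (\<zeta> (snd q) * L' (snd q)))) *
      snd (fst (0, 1) * Re (\<zeta> (snd q)) + fst q * (snd (0, 1) * Re (\<zeta> (snd q) * L' (snd q))),
        fst (0, 1) * Im (\<zeta> (snd q)) + fst q * (snd (0, 1) * Im (\<zeta> (snd q) * L' (snd q)))) -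
      fst (fst (0, 1) * Re (\<zeta> (snd q)) + fst q * (snd (0, 1) * Re (\<zeta> (snd q) * L' (snd q))),
        fst (0, 1) * Im (\<zeta> (snd q)) + fst q * (snd (0, 1) * Im (\<zeta> (snd q) * L' (snd q)))) *
      snd (fst (1, 0) * Re (\<zeta> (snd q)) + fst q * (snd (1, 0) * Re (\<zeta> (snd q) * L' (snd q))),
        fst (1, 0) * Im (\<zeta> (snd q)) + fst q * (snd (1, 0) * Im (\<zeta> (snd q) * L' (snd q))))\<bar>"
      (is "_ = \<bar>?e\<bar>")
    proof -
      have "?e = ?J q" unfolding j by (simp add: algebra_simps)
      then show ?thesis using nn by (simp only: abs_of_nonneg)
    qed
  qed
  also have "\<dots> = integral param ?g"
    by (rule set_borel_integral_eq_integral(2)[OF gi])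
  also have "\<dots> = integral (cbox (0, 0) (1, 2 * pi)) ?g"
  proof (rule integral_subset_negligible[OF param_sub])
    have "cbox (0, 0) (1, 2 * pi) - param \<subseteq> cbox (0, 0) (1, 2 * pi) - box (0, 0) (1, 2 * pi)"
      by (auto simp: param_def box_def Basis_prod_def)
    then show "negligible (cbox (0, 0) (1, 2 * pi) - param)"
      using negligible_frontier_interval negligible_subset by blast
  qed
  also have "\<dots> = integral (cbox 0 1) (\<lambda>\<tau>. integral (cbox 0 (2 * pi)) (\<lambda>s. ?g (\<tau>, s)))"
    by (rule integral_prod_continuous[OF gc])
  finally show ?thesis by simp
qed

end


section \<open>The eigenvalue equation\<close>

lemma norm_disc_eval_le:
  assumes "cmod w \<le> 2"
  shows "cmod (disc_eval a w) \<le> norm a"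
proof -
  have le: "cmod (coef a (int n) * w ^ n) \<le> cmod (coef a (int n)) * wt (int n)" for n
    using assms by (simp add: norm_mult norm_power wt_def mult_left_mono power_mono)
  have S: "((\<lambda>n. cmod (coef a n) * wt n) has_sum (\<Sum>\<^sub>\<infinity>n\<in>range int. cmod (coef a n) * wt n)) (range int)"
    by (intro has_sum_infsum summable_on_subset[OF summable_coef]) auto
  then have "((\<lambda>n. cmod (coef a (int n)) * wt (int n)) has_sum (\<Sum>\<^sub>\<infinity>n\<in>range int. cmod (coef a n) * wt n)) UNIV"
    by (subst (asm) has_sum_reindex) (auto simp: comp_def)
  then have sums: "(\<lambda>n. cmod (coef a (int n)) * wt (int n)) sums (\<Sum>\<^sub>\<infinity>n\<in>range int. cmod (coef a n) * wt n)"
    by (rule has_sum_imp_sums)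
  have "cmod (disc_eval a w) \<le> (\<Sum>n. cmod (coef a (int n)) * wt (int n))"
    unfolding disc_eval_def by (rule norm_suminf_le[OF le sums_summable[OF sums]])
  also have "\<dots> = (\<Sum>\<^sub>\<infinity>n\<in>range int. cmod (coef a n) * wt n)" using sums by (rule sums_unique[symmetric])
  also have "\<dots> \<le> (\<Sum>\<^sub>\<infinity>n. cmod (coef a n) * wt n)"
    using has_sum_infsum[OF summable_coef]
    by (rule has_sum_mono2[OF S]) (auto simp: less_imp_le[OF wt_pos])
  finally show ?thesis by (simp add: norm_wiener.rep_eq)
qed

definition cpoly :: "nat \<Rightarrow> (nat \<Rightarrow> complex) \<Rightarrow> complex \<Rightarrow> complex" where
  "cpoly N F w = (\<Sum>k\<le>N. F k * w ^ k)"

lemma deriv_cpoly_0: "(deriv ^^ k) (cpoly N F) 0 = (if k \<le> N then fact k * F k else 0)"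
proof -
  define q where "q = (\<Sum>j\<le>N. monom (F j) j)"
  have q: "cpoly N F = poly q" by (simp add: q_def cpoly_def poly_sum poly_monom fun_eq_iff)
  have "(deriv ^^ k) (poly q) = poly ((pderiv ^^ k) q)"
    by (induction k) (auto intro!: DERIV_imp_deriv poly_DERIV)
  then have "(deriv ^^ k) (cpoly N F) 0 = coeff ((pderiv ^^ k) q) 0" by (simp add: q poly_0_coeff_0)
  also have "\<dots> = fact k * coeff q k"
    by (simp add: coeff_higher_pderiv pochhammer_fact)
  also have "coeff q k = (if k \<le> N then F k else 0)"
    by (simp add: q_def coeff_sum if_distrib cong: if_cong)
  finally show ?thesis by simp
qed

text \<open>By the area identity the only obstruction is the centre value of the boundary function, which is
  purely imaginary. For \<open>E\<close> with the conjugate coefficients of \<open>F\<close> the integrand is a square of a modulus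
  times a positive weight, so the integral is real; the sum of Taylor coefficients is real as well and
  \<open>E 0 = 1\<close>, hence the centre value is also real.\<close>

lemma solution_domain:
  fixes F :: "nat \<Rightarrow> complex"
  assumes rlam: "0 < r" "1 - exp (- pi * r\<^sup>2) = lam"
    and p: "norm p \<le> 1/8" "\<And>n. n < 0 \<Longrightarrow> coef p n = 0"
    and M: "\<And>n. n < 0 \<Longrightarrow> coef (boundary_fun lam N r F p) n = 0" "Re (coef (boundary_fun lam N r F p) 0) = 0"
    and F0: "F 0 = 1"
  shows "\<exists>U. analytic_perturbed_disk lam U \<and> U \<in> sets borel \<and> bounded U \<and>
    (\<forall>E. E holomorphic_on UNIV \<longrightarrow>
      set_lebesgue_integral lborel U (\<lambda>(x, \<omega>). cpoly N F (Complex x (-\<omega>)) * (E (Complex x \<omega>) * of_real (exp (- (pi * (x\<^sup>2 + \<omega>\<^sup>2))))))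
        = lam * (\<Sum>k\<le>N. F k * (deriv ^^ k) E 0 / pi ^ k))"
proof -
  interpret small_disc r "disc_eval p"
  proof
    show "cmod (disc_eval p w) \<le> 1/8" if "cmod w < 2" for w
      using norm_disc_eval_le[of w p] p(1) that by linarith
  qed (use rlam(1) disc_eval_holomorphic in auto)
  let ?f = "\<lambda>E (x, \<omega>). cpoly N F (Complex x (-\<omega>)) * (E (Complex x \<omega>) * of_real (exp (- (pi * (x\<^sup>2 + \<omega>\<^sup>2)))))"
  have id: "set_lebesgue_integral lborel star_domain (?f E) =
      pi * (coef (boundary_fun lam N r F p) 0 * E 0) + lam * (\<Sum>k\<le>N. F k * (deriv ^^ k) E 0 / pi ^ k)"
    if E: "E holomorphic_on UNIV" for E
  proof -
    have Ec: "continuous_on UNIV E" by (rule holomorphic_on_imp_continuous_on[OF E])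
    have fc: "continuous_on UNIV (?f E)"
      unfolding case_prod_beta cpoly_def Complex_eq
      by (intro continuous_intros continuous_on_compose2[OF Ec]) auto
    have f_eq: "of_real (\<tau> * jac s) * ?f E (star_map (\<tau>, s)) =
      (\<Sum>k\<le>N. F k * cnj (\<tau> * \<zeta> s) ^ k) * E (\<tau> * \<zeta> s) * exp (- (pi * ((of_real \<tau>)\<^sup>2 * (\<zeta> s * cnj (\<zeta> s))))) * (\<tau> * jac s)" for \<tau> s
    proof -
      define x y where "x = fst (star_map (\<tau>, s))" and "y = snd (star_map (\<tau>, s))"
      have z: "Complex x y = \<tau> * \<zeta> s" using Complex_star_map[of "(\<tau>, s)"] by (simp add: x_def y_def)
      have z': "Complex x (- y) = cnj (\<tau> * \<zeta> s)" unfolding z[symmetric] by (rule complex_eqI) simp_all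
      have "complex_of_real (x\<^sup>2 + y\<^sup>2) = Complex x y * cnj (Complex x y)"
        by (simp add: complex_mult_cnj)
      also have "\<dots> = (of_real \<tau>)\<^sup>2 * (\<zeta> s * cnj (\<zeta> s))" unfolding z by (simp add: power2_eq_square mult_ac)
      finally have e: "complex_of_real (exp (- (pi * (x\<^sup>2 + y\<^sup>2)))) = exp (- (pi * ((of_real \<tau>)\<^sup>2 * (\<zeta> s * cnj (\<zeta> s)))))"
        by (simp only: exp_of_real[symmetric] of_real_minus of_real_mult)
      have "?f E (star_map (\<tau>, s)) = cpoly N F (Complex x (- y)) * (E (Complex x y) * of_real (exp (- (pi * (x\<^sup>2 + y\<^sup>2)))))"
        by (simp add: x_def y_def case_prod_beta)
      also have "\<dots> = (\<Sum>k\<le>N. F k * cnj (\<tau> * \<zeta> s) ^ k) * (E (\<tau> * \<zeta> s) * exp (- (pi * ((of_real \<tau>)\<^sup>2 * (\<zeta> s * cnj (\<zeta> s))))))"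
        unfolding z z' e cpoly_def ..
      finally show ?thesis by (simp only: mult.assoc mult.left_commute mult.commute)
    qed
    show ?thesis
      unfolding star_domain_integral[OF fc] f_eq unfolding of_real_mult[of _ "jac _"]
      by (rule solution_area_identity[OF rlam(1) p(2) M(1) E])
  qed
  \<comment> \<open>The centre value is \<open>\<i> \<mu>\<close>.\<close>
  define \<mu> where "\<mu> = Im (coef (boundary_fun lam N r F p) 0)"
  have M0: "coef (boundary_fun lam N r F p) 0 = \<i> * \<mu>"
    using M(2) by (intro complex_eqI) (simp_all add: \<mu>_def)
  define E where "E = cpoly N (\<lambda>k. cnj (F k))"
  have E: "E holomorphic_on UNIV"
    unfolding E_def cpoly_def[abs_def] by (intro holomorphic_intros)
  have "E 0 = 1"
  proof -
    have "{..N} = insert 0 {1..N}" by auto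
    then show ?thesis by (simp add: E_def cpoly_def F0)
  qed
  have im0: "Im (set_lebesgue_integral lborel star_domain (?f E)) = 0"
  proof -
    have "?f E q = of_real ((cmod (E (Complex (fst q) (snd q))))\<^sup>2 * exp (- (pi * ((fst q)\<^sup>2 + (snd q)\<^sup>2))))" for q
    proof -
      have "cpoly N F (Complex (fst q) (- snd q)) = cnj (E (Complex (fst q) (snd q)))"
        by (simp add: E_def cpoly_def complex_cnj)
      then show ?thesis
        unfolding of_real_mult complex_norm_square case_prod_beta by (simp only: ac_simps)
    qed
    then have "set_lebesgue_integral lborel star_domain (?f E) = (LINT q|lborel. complex_of_real (indicator star_domain q * ((cmod (E (Complex (fst q) (snd q))))\<^sup>2 * exp (- (pi * ((fst q)\<^sup>2 + (snd q)\<^sup>2))))))"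
      unfolding set_lebesgue_integral_def by (simp add: scaleR_conv_of_real)
    then show ?thesis by (simp only: integral_complex_of_real Im_complex_of_real)
  qed
  define X where "X = (\<Sum>k\<le>N. fact k * (cmod (F k))\<^sup>2 / pi ^ k)"
  have X: "(\<Sum>k\<le>N. F k * (deriv ^^ k) E 0 / pi ^ k) = of_real X"
    unfolding E_def deriv_cpoly_0 X_def of_real_sum
    by (rule sum.cong[OF refl]) (simp add: complex_norm_square[unfolded of_real_power] mult.left_commute)
  have "pi * \<mu> = 0"
    using im0 unfolding id[OF E] M0 \<open>E 0 = 1\<close> X by simp
  then have "coef (boundary_fun lam N r F p) 0 = 0" by (simp add: M0)
  then show ?thesis
    using star_domain_analytic_perturbed_disk[OF rlam(2)] star_domain_borel star_domain_bounded id by (intro exI[of _ star_domain]) auto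
qed

definition hnorm :: "nat \<Rightarrow> real" where
  "hnorm k = sqrt (LINT s|lborel. (hermite_raw k s)\<^sup>2)"

lemma hermite_fun_eq: "hermite_fun k t = of_real (hermite_raw k t) / of_real (hnorm k)"
  by (simp add: hermite_fun_def hnorm_def)

lemma hnorm_0_pos: "0 < hnorm 0"
proof -
  have "(LINT s|lborel. (hermite_raw 0 s)\<^sup>2) \<noteq> 0"
  proof
    assume "(LINT s|lborel. (hermite_raw 0 s)\<^sup>2) = 0"
    then have "AE s in lborel. (hermite_raw 0 s)\<^sup>2 = 0"
      by (subst (asm) integral_nonneg_eq_0_iff_AE) (auto simp: hermite_raw_square_integrable)
    then have "AE s::real in lborel. False" by (simp add: hermite_raw_poly)
    then show False by (simp add: AE_iff_null null_sets_def)
  qed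
  moreover have "0 \<le> (LINT s|lborel. (hermite_raw 0 s)\<^sup>2)" by (rule Bochner_Integration.integral_nonneg) simp
  ultimately show ?thesis by (simp add: hnorm_def less_le)
qed

theorem theorem1:
  fixes lam :: real and N :: nat
  assumes "0 < lam" and "lam < 1"
  shows "\<exists>\<epsilon>0>0. \<forall>a :: nat \<Rightarrow> complex. \<forall>f0 :: real \<Rightarrow> complex.
    (\<forall>k\<in>{1..N}. cmod (a k) < \<epsilon>0) \<longrightarrow>
    f0 = (\<lambda>t. hermite_fun 0 t + (\<Sum>k=1..N. a k * hermite_fun k t)) \<longrightarrow>
    (\<exists>U. analytic_perturbed_disk lam U \<and>
      (AE t in lborel. loc_op U f0 t = of_real lam * f0 t))"
proof -
  define r where "r = sqrt (- ln (1 - lam) / pi)"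
  have "ln (1 - lam) / pi < 0" using assms by (intro divide_neg_pos) auto
  then have r0: "0 < r" "r\<^sup>2 = - ln (1 - lam) / pi" by (simp_all add: r_def)
  have r: "1 - exp (- pi * r\<^sup>2) = lam" using assms by (simp add: r0(2))
  obtain \<epsilon> where \<epsilon>: "0 < \<epsilon>" and sol: "\<And>F. F 0 = 1 \<Longrightarrow> (\<forall>k\<in>{1..N}. cmod (F k) < \<epsilon>) \<Longrightarrow>
      \<exists>p. norm p \<le> 1/8 \<and> (\<forall>n<0. coef p n = 0) \<and>
       (\<forall>n<0. coef (boundary_fun lam N r F p) n = 0) \<and> Re (coef (boundary_fun lam N r F p) 0) = 0"
    using boundary_fun_solution[OF r0(1) r, of "1/8" N] by auto
  \<comment> \<open>The Bargmann transform of \<open>hermite_raw k\<close> is \<open>\<beta> k\<close> times the \<open>k\<close>-th power.\<close>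
  define \<beta> where "\<beta> k = 2 powr (1/4) / sqrt 2 * (2 * pi) ^ k" for k :: nat
  \<comment> \<open>The factor by which \<open>\<bar>F k\<bar>\<close> exceeds \<open>\<bar>a k\<bar>\<close> after the normalisation \<open>F 0 = 1\<close> below.\<close>
  define b where "b k = \<bar>hnorm 0 / hnorm k * (2 * pi) ^ k\<bar>" for k
  define \<epsilon>0 where "\<epsilon>0 = \<epsilon> / (1 + (\<Sum>k\<in>{1..N}. b k))"
  have sb: "0 \<le> (\<Sum>k\<in>{1..N}. b k)" by (intro sum_nonneg) (simp add: b_def)
  have "0 < \<epsilon>0" using \<epsilon> sb by (simp add: \<epsilon>0_def)
  moreover have "\<exists>U. analytic_perturbed_disk lam U \<and> (AE t in lborel. loc_op U f0 t = of_real lam * f0 t)"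
    if a: "\<forall>k\<in>{1..N}. cmod (a k) < \<epsilon>0"
      and f0: "f0 = (\<lambda>t. hermite_fun 0 t + (\<Sum>k=1..N. a k * hermite_fun k t))"
    for a :: "nat \<Rightarrow> complex" and f0
  proof -
    define \<alpha> where "\<alpha> k = (if k = 0 then 1 else a k) / of_real (hnorm k)" for k
    define c where "c = \<beta> 0 / hnorm 0"
    have c: "c \<noteq> 0" using hnorm_0_pos by (simp add: c_def \<beta>_def)
    define F where "F k = \<alpha> k * \<beta> k / c" for k
    have F0: "F 0 = 1" using hnorm_0_pos by (simp add: F_def \<alpha>_def c_def \<beta>_def)
    have F: "cmod (F k) < \<epsilon>" if k: "k \<in> {1..N}" for k
    proof -
      have "\<beta> k / c = hnorm 0 * (2 * pi) ^ k" using hnorm_0_pos by (simp add: c_def \<beta>_def)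
      then have "hnorm 0 / hnorm k * (2 * pi) ^ k = \<beta> k / c / hnorm k" by simp
      then have "F k = a k * of_real (hnorm 0 / hnorm k * (2 * pi) ^ k)"
        using k by (simp add: F_def \<alpha>_def)
      then have "cmod (F k) = cmod (a k) * b k" by (simp only: norm_mult norm_of_real b_def)
      also have "\<dots> \<le> \<epsilon>0 * b k" using a k by (intro mult_right_mono) (auto simp: b_def less_imp_le)
      also have "\<dots> \<le> \<epsilon>0 * (\<Sum>k\<in>{1..N}. b k)"
        using \<open>0 < \<epsilon>0\<close> k by (intro mult_left_mono member_le_sum) (auto simp: b_def)
      also have "\<dots> < \<epsilon>0 * (1 + (\<Sum>k\<in>{1..N}. b k))" using \<open>0 < \<epsilon>0\<close> by simp
      also have "\<dots> = \<epsilon>" using sb by (simp add: \<epsilon>0_def)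
      finally show ?thesis .
    qed
    obtain p where p: "norm p \<le> 1/8" "\<forall>n<0. coef p n = 0"
       "\<forall>n<0. coef (boundary_fun lam N r F p) n = 0" "Re (coef (boundary_fun lam N r F p) 0) = 0"
      using sol[of F, OF F0] F by blast
    obtain U where U: "analytic_perturbed_disk lam U" "U \<in> sets borel" "bounded U"
      and int: "\<And>E. E holomorphic_on UNIV \<Longrightarrow>
        set_lebesgue_integral lborel U (\<lambda>(x, \<omega>). cpoly N F (Complex x (-\<omega>)) * (E (Complex x \<omega>) * of_real (exp (- (pi * (x\<^sup>2 + \<omega>\<^sup>2))))))
        = lam * (\<Sum>k\<le>N. F k * (deriv ^^ k) E 0 / pi ^ k)"
      using solution_domain[OF r0(1) r p(1) _ _ p(4) F0] p(2,3) by blast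
    have f0_eq: "f0 = hermite_comb N \<alpha>"
    proof -
      have "{..N} = insert 0 {1..N}" by auto
      then show ?thesis unfolding f0 hermite_comb_def by (simp add: fun_eq_iff hermite_fun_eq \<alpha>_def)
    qed
    have cF: "(\<Sum>k\<le>N. \<alpha> k * (2 powr (1/4) / sqrt 2 * (2 * pi) ^ k) * w ^ k) = c * cpoly N F w" for w
    proof -
      have "\<alpha> k * of_real (\<beta> k) = c * F k" for k using c by (simp add: F_def)
      then show ?thesis unfolding cpoly_def sum_distrib_left \<beta>_def by (simp add: mult.assoc)
    qed
    have "AE t in lborel. loc_op U (hermite_comb N \<alpha>) t = of_real lam * hermite_comb N \<alpha> t"
    proof (rule loc_op_eigenfunction[OF U(2,3)])
      fix t
      have "set_lebesgue_integral lborel U (\<lambda>(x, \<omega>). c * cpoly N F (Complex x (-\<omega>)) * (hermite_gen t (Complex x \<omega>) * of_real (exp (- (pi * (x\<^sup>2 + \<omega>\<^sup>2))))))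
        = c * set_lebesgue_integral lborel U (\<lambda>(x, \<omega>). cpoly N F (Complex x (-\<omega>)) * (hermite_gen t (Complex x \<omega>) * of_real (exp (- (pi * (x\<^sup>2 + \<omega>\<^sup>2))))))"
        unfolding set_lebesgue_integral_def integral_mult_right_zero[symmetric]
        by (rule Bochner_Integration.integral_cong) (auto simp: case_prod_beta)
      also have "\<dots> = c * (lam * (\<Sum>k\<le>N. F k * (deriv ^^ k) (hermite_gen t) 0 / pi ^ k))"
        by (simp only: int[OF hermite_gen_holomorphic])
      also have "\<dots> = lam * (\<Sum>k\<le>N. (c * F k) * (of_real (2 powr (1/4) * hermite_raw k t / 2 ^ k)) / pi ^ k)"
        unfolding deriv_hermite_gen_0 by (simp add: sum_distrib_left mult_ac)
      also have "\<dots> = lam * hermite_comb N \<alpha> t"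
        unfolding hermite_comb_def
      proof (intro arg_cong2[where f = "(*)"] refl sum.cong)
        fix k
        have "(2 powr (1/4) * 2 powr (1/4) :: real) = sqrt 2"
          unfolding powr_add[symmetric] by (simp add: powr_half_sqrt)
        then have "\<beta> k * (2 powr (1/4) * hermite_raw k t / 2 ^ k) / pi ^ k = hermite_raw k t"
          by (simp add: \<beta>_def field_simps power_mult_distrib)
        then have "of_real (\<beta> k) * of_real (2 powr (1/4) * hermite_raw k t / 2 ^ k) / of_real (pi ^ k) = complex_of_real (hermite_raw k t)"
          by (simp only: flip: of_real_mult of_real_divide)
        moreover have "c * F k = \<alpha> k * of_real (\<beta> k)" using c by (simp add: F_def)
        ultimately show "(c * F k) * (of_real (2 powr (1/4) * hermite_raw k t / 2 ^ k)) / of_real (pi ^ k) = \<alpha> k * of_real (hermite_raw k t)"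
          by (simp only: mult.assoc times_divide_eq_right[symmetric])
      qed
      finally show "set_lebesgue_integral lborel U (\<lambda>(x, \<omega>).
        (\<Sum>k\<le>N. \<alpha> k * (2 powr (1/4) / sqrt 2 * (2 * pi) ^ k) * Complex x (-\<omega>) ^ k) *
        (hermite_gen t (Complex x \<omega>) * of_real (exp (- (pi * (x\<^sup>2 + \<omega>\<^sup>2))))))
        = of_real lam * hermite_comb N \<alpha> t"
        unfolding cF .
    qed
    then show ?thesis using U(1) unfolding f0_eq by blast
  qed
  ultimately show ?thesis by blast
qed

end
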